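(* Let $n\ge3$, let $\Lambda$ be a dominant weight with $\kappa=(\Lambda+\rho,\delta)$ satisfying $\operatorname{Re}\kappa>0$ and $\kappa\ne n$, and let $u\in\mathbb C$. Let $$P(\Lambda)=\mathrm e^{\Lambda}\sum_{\underline d}\mathrm e^{-\sum_{i=1}^nd_i(\underline d)\alpha_i},$$ the sum running over affine Gelfand--Tsetlin patterns $\underline d$ permitted with respect to $\Lambda$. Then $$P(\Lambda)=\chi(\mathbb L_{\Lambda,u})=\chi(\mathcal M_{0,u})\sum_{w\in\widehat W_\Lambda}(-1)^{l(w)}\,\mathrm e^{\,w(\Lambda+\rho)-\rho}.$$
   Context: **Root data.** $\mathfrak h^*=\{\sum_{i=1}^nc_i\epsilon_i:\sum c_i=0\}$ with $(\epsilon_i,\epsilon_j)=\delta_{ij}$; $\widetilde{\mathfrak h}^*=\mathfrak h^*\oplus\mathbb C\delta\oplus\mathbb C\omega_0$ with $(\delta,\omega_0)=1$, $(\delta,\delta)=(\omega_0,\omega_0)=0$, and $\delta,\omega_0\perp\mathfrak h^*$. $\alpha_i=\epsilon_i-\epsilon_{i+1}$ ($1\le i\le n-1$), $\alpha_0=\delta+\epsilon_n-\epsilon_1$, $\alpha_{i+n}=\alpha_i$. $\omega_0,\dots,\omega_{n-1}$ are determined by $(\omega_i,\alpha_j)=\delta_{ij}$ for $0\le j\le n-1$ and $(\omega_i,\omega_0)=0$; $\rho=\sum_{i=0}^{n-1}\omega_i$. With $\Phi=\{\epsilon_i-\epsilon_j:i\ne j\}$: affine roots $\widehat\Phi=\{\alpha+m\delta:\alpha\in\Phi,m\in\mathbb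 Z\}\cup\{m\delta:m\ne0\}$; the roots $\alpha+m\delta$ with $\alpha\in\Phi$ are real; $\widehat\Phi_+$ consists of $\alpha+m\delta$ with $\alpha\in\Phi$, $m>0$, of $\epsilon_i-\epsilon_j$ with $i<j$, and of $m\delta$ with $m>0$; $\widehat\Phi_+^{\rm re}$ denotes positive real roots. For integers $l<r$, $\alpha_{l,r}=\sum_{s=l}^{r-1}\alpha_s$. **Weights.** $\Lambda\in\omega_0^\perp=\operatorname{Span}_{\mathbb C}(\omega_0,\dots,\omega_{n-1})$, of level $k=(\Lambda,\delta)$, $\kappa=k+n$. $\Lambda$ is dominant if $(\Lambda+\rho,\alpha)\notin\mathbb Z_{\le0}$ for all $\alpha\in\widehat\Phi_+$. $\widehat W_\Lambda$ is the group generated by the reflections $s_\alpha(v)=v-2\frac{(v,\alpha)}{(\alpha,\alpha)}\alpha$ for $\alpha\in\widehat\Phi_+^{\rm re}$ with $(\alpha,\Lambda+\rho)\in\mathbb Z$; $l(w)$ is its Coxeter length, so $(-1)^{l(w)}=\det w$. Let $\mathtt y_i$ ($i\in\mathbb Z$) be numbers with $\mathtt y_l-\mathtt y_r=(\alpha_{l,r},\Lambda+\rho)$ for $l<r$ (only differences matter below). **Patterns.** An affine Gelfand--Tsetlin pattern is an array $\underline d=(d_{i,j})_{i\ge j,\ i,j\in\mathbb Z}$ of nonnegative integers with $d_{i,j}\ge d_{i+1,j}$, $d_{i+n,j+n}=d_{i,j}$, and for each $i$ only finitely many $d_{i,j}\ne0$; $d_i(\underline d)=\sum_{j\le i}d_{i,j}$.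 It is permitted with respect to $\Lambda$ if for all integers $l<r$ with $l\not\equiv r\pmod n$ and $\mathtt y_l-\mathtt y_r\in\mathbb Z$, and all $i\ge r-1$: $d_{i,l}\le d_{i+1,r}+\mathtt y_l-\mathtt y_r-1$. **Modules and characters.** $\mathbb L_{\Lambda,u}$ is the vector space with basis $\xi_{\underline d}$ indexed by permitted patterns, where $\xi_{\underline d}$ has weight $\Lambda-\sum_{i=1}^nd_i(\underline d)\alpha_i$; it carries a structure of $\widetilde{\mathfrak{gl}}_n$-module ($\widetilde{\mathfrak{gl}}_n=\widehat{\mathfrak{gl}}_n\oplus\mathbb CD$) isomorphic to $\mathcal L_{\Lambda,u}=\mathcal L_\Lambda\otimes\mathcal F^k_u$, where $\mathcal L_\Lambda$ is the irreducible highest weight $\widetilde{\mathfrak{sl}}_n$-module of highest weight $\Lambda$ and $\mathcal F_u^k$ is the Fock module of the Heisenberg algebra $\mathtt a_r=\mathrm{Id}\otimes t^r$ of level $k$ with $\mathtt a_0=u$. $\chi(V)=\sum_\nu\dim V_\nu\,\mathrm e^\nu$ is the formal weight character (with respect to $\widetilde{\mathfrak h}\subset\widetilde{\mathfrak{sl}}_n$), and $\mathcal M_{\Lambda,u}$ is the Verma module for $\widetilde{\mathfrak{sl}}_n$ tensored with the Fock module, so $$\chi(\mathcal M_{0,u})=\prod_{m\ge1}(1-\mathrm e^{-m\delta})^{-n}\prod_{\alpha\in\widehat\Phi_+^{\rm re}}(1-\mathrm e^{-\alpha})^{-1}.$$ *)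

theory Defs
  imports
    Complex_Main
    "HOL-Library.Function_Algebras"
    "HOL-Library.Product_Plus"
    "HOL-Library.Groups_Big_Fun"
    "HOL-Library.Poly_Mapping"
    "HOL-Library.Nonpos_Ints"
    "HOL-Algebra.Bij"
    "HOL-Algebra.Generated_Groups"
begin

section \<open>Root data\<close>

text \<open>
  The triple \<open>(c, a, b)\<close> stands for \<open>c\<^sub>1 \<epsilon>\<^sub>1 + \<dots> + c\<^sub>n \<epsilon>\<^sub>n + a \<delta> + b \<omega>\<^sub>0\<close>. The space dual to the affine
  Cartan subalgebra is the set \<open>hdual n\<close> of those triples for which \<open>c\<close> is supported on \<open>{1..n}\<close>
  and has coordinate sum zero. Addition of weights is pointwise.
\<close>

type_synonym weight = "(nat \<Rightarrow> complex) \<times> complex \<times> complex"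

definition hdual :: "nat \<Rightarrow> weight set" where
  "hdual n = {(c, a, b). (\<forall>i. i \<notin> {1..n} \<longrightarrow> c i = 0) \<and> (\<Sum>i=1..n. c i) = 0}"

definition wscale :: "complex \<Rightarrow> weight \<Rightarrow> weight" where
  "wscale z v = (case v of (c, a, b) \<Rightarrow> (\<lambda>i. z * c i, z * a, z * b))"

definition pairing :: "nat \<Rightarrow> weight \<Rightarrow> weight \<Rightarrow> complex" where
  "pairing n v v' = (case (v, v') of ((c, a, b), (c', a', b')) \<Rightarrow>
     (\<Sum>i=1..n. c i * c' i) + a * b' + b * a')"

definition eps :: "nat \<Rightarrow> weight" where
  "eps i = (\<lambda>j. if j = i then 1 else 0, 0, 0)"

definition delta :: weight where
  "delta = (\<lambda>_. 0, 1, 0)"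

definition omega0 :: weight where
  "omega0 = (\<lambda>_. 0, 0, 1)"

definition alpha :: "nat \<Rightarrow> int \<Rightarrow> weight" where
  "alpha n i = (let r = nat (i mod int n) in
     if r = 0 then delta + eps n - eps 1 else eps r - eps (r + 1))"

definition omega :: "nat \<Rightarrow> nat \<Rightarrow> weight" where
  "omega n i = (THE v. v \<in> hdual n \<and>
     (\<forall>j<n. pairing n v (alpha n (int j)) = (if i = j then 1 else 0)) \<and> pairing n v omega0 = 0)"

definition rho :: "nat \<Rightarrow> weight" where
  "rho n = (\<Sum>i<n. omega n i)"

definition pos_real_roots :: "nat \<Rightarrow> weight set" where
  "pos_real_roots n =
     {eps i - eps j + wscale (of_nat m) delta | i j m.
        i \<in> {1..n} \<and> j \<in> {1..n} \<and> i \<noteq> j \<and> m > 0} \<union>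
     {eps i - eps j | i j. i \<in> {1..n} \<and> j \<in> {1..n} \<and> i < j}"

definition pos_roots :: "nat \<Rightarrow> weight set" where
  "pos_roots n = pos_real_roots n \<union> {wscale (of_nat m) delta | m. m > 0}"

definition alpha_seg :: "nat \<Rightarrow> int \<Rightarrow> int \<Rightarrow> weight" where
  "alpha_seg n l r = (\<Sum>s\<in>{l..<r}. alpha n s)"

text \<open>Dominance for weights \<open>\<Lambda>\<close> orthogonal to \<open>\<omega>\<^sub>0\<close>; \<open>\<Lambda>\<close> need not be integral.\<close>

definition dominant :: "nat \<Rightarrow> weight \<Rightarrow> bool" where
  "dominant n \<Lambda> \<longleftrightarrow> \<Lambda> \<in> hdual n \<and> pairing n \<Lambda> omega0 = 0 \<and>
     (\<forall>\<alpha>\<in>pos_roots n. pairing n (\<Lambda> + rho n) \<alpha> \<notin> \<int>\<^sub>\<le>\<^sub>0)"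

definition kappa :: "nat \<Rightarrow> weight \<Rightarrow> complex" where
  "kappa n \<Lambda> = pairing n (\<Lambda> + rho n) delta"


section \<open>The integral Weyl group\<close>

definition refl :: "nat \<Rightarrow> weight \<Rightarrow> weight \<Rightarrow> weight" where
  "refl n \<alpha> = (\<lambda>v\<in>hdual n. v - wscale (2 * pairing n v \<alpha> / pairing n \<alpha> \<alpha>) \<alpha>)"

definition int_roots :: "nat \<Rightarrow> weight \<Rightarrow> weight set" where
  "int_roots n \<Lambda> = {\<alpha> \<in> pos_real_roots n. pairing n \<alpha> (\<Lambda> + rho n) \<in> \<int>}"

definition int_weyl :: "nat \<Rightarrow> weight \<Rightarrow> (weight \<Rightarrow> weight) set" where
  "int_weyl n \<Lambda> = generate (BijGroup (hdual n)) (refl n ` int_roots n \<Lambda>)"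

text \<open>
  The Coxeter generators of the integral Weyl group are the reflections in the base of the integral
  root system, that is, in those positive integral real roots that are not sums of at least two
  positive integral real roots. Sums of exactly two roots would not suffice: for the affine root
  system of rank one, \<open>\<alpha>\<^sub>1 + \<delta> = \<alpha>\<^sub>1 + \<alpha>\<^sub>1 + \<alpha>\<^sub>0\<close> is not a sum of two real roots.
\<close>

definition int_base :: "nat \<Rightarrow> weight \<Rightarrow> weight set" where
  "int_base n \<Lambda> = {\<alpha> \<in> int_roots n \<Lambda>.
     \<not> (\<exists>\<beta>s. length \<beta>s \<ge> 2 \<and> set \<beta>s \<subseteq> int_roots n \<Lambda> \<and> sum_list \<beta>s = \<alpha>)}"

definition coxeter_length :: "nat \<Rightarrow> weight \<Rightarrow> (weight \<Rightarrow> weight) \<Rightarrow> nat" where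
  "coxeter_length n \<Lambda> w = (LEAST k. \<exists>ss. length ss = k \<and> set ss \<subseteq> refl n ` int_base n \<Lambda> \<and>
     w = foldr (\<lambda>s t. s \<otimes>\<^bsub>BijGroup (hdual n)\<^esub> t) ss \<one>\<^bsub>BijGroup (hdual n)\<^esub>)"


section \<open>Permitted patterns\<close>

text \<open>The numbers \<open>y\<^sub>i\<close>, normalized by \<open>y\<^sub>0 = 0\<close>; see \<open>yy_diff\<close> below for the differences.\<close>

definition yy :: "nat \<Rightarrow> weight \<Rightarrow> int \<Rightarrow> complex" where
  "yy n \<Lambda> i = (if i \<ge> 0 then - pairing n (alpha_seg n 0 i) (\<Lambda> + rho n)
                else pairing n (alpha_seg n i 0) (\<Lambda> + rho n))"

text \<open>
  The entries \<open>d i j\<close> with \<open>i < j\<close> are not part of an array; they are set to \<open>0\<close>, so that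
  an array corresponds to exactly one function.
\<close>

type_synonym pattern = "int \<Rightarrow> int \<Rightarrow> nat"

definition gt_pattern :: "nat \<Rightarrow> pattern \<Rightarrow> bool" where
  "gt_pattern n d \<longleftrightarrow>
     (\<forall>i j. i < j \<longrightarrow> d i j = 0) \<and>
     (\<forall>i j. j \<le> i \<longrightarrow> d (i + 1) j \<le> d i j) \<and>
     (\<forall>i j. j \<le> i \<longrightarrow> d (i + int n) (j + int n) = d i j) \<and>
     (\<forall>i. finite {j. j \<le> i \<and> d i j \<noteq> 0})"

definition row_sum :: "pattern \<Rightarrow> int \<Rightarrow> nat" where
  "row_sum d i = (\<Sum>j\<in>{j. j \<le> i \<and> d i j \<noteq> 0}. d i j)"

definition permitted :: "nat \<Rightarrow> weight \<Rightarrow> pattern set" where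
  "permitted n \<Lambda> = {d. gt_pattern n d \<and>
     (\<forall>l r i m. l < r \<longrightarrow> l mod int n \<noteq> r mod int n \<longrightarrow> yy n \<Lambda> l - yy n \<Lambda> r = of_int m \<longrightarrow>
        r - 1 \<le> i \<longrightarrow> int (d i l) \<le> int (d (i + 1) r) + m - 1)}"

definition pattern_depth :: "nat \<Rightarrow> pattern \<Rightarrow> weight" where
  "pattern_depth n d = (\<Sum>i=1..n. wscale (of_nat (row_sum d (int i))) (alpha n (int i)))"


section \<open>Formal characters\<close>

text \<open>
  A formal character \<open>\<Sum>\<^sub>\<nu> f\<^sub>\<nu> e\<^sup>\<nu>\<close> is the function \<open>\<nu> \<mapsto> f\<^sub>\<nu>\<close>. Sums, products and infinite products
  are computed coefficientwise; they have their intended meaning only when each coefficient involves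
  finitely many nonzero terms.
\<close>

type_synonym fchar = "weight \<Rightarrow> int"

definition fexp :: "weight \<Rightarrow> fchar" where
  "fexp \<nu> = (\<lambda>\<mu>. if \<mu> = \<nu> then 1 else 0)"

definition fmult :: "fchar \<Rightarrow> fchar \<Rightarrow> fchar" (infixl "\<star>" 70) where
  "f \<star> g = (\<lambda>\<nu>. Sum_any (\<lambda>\<mu>. f \<mu> * g (\<nu> - \<mu>)))"

definition fsum :: "('i \<Rightarrow> fchar) \<Rightarrow> 'i set \<Rightarrow> fchar" where
  "fsum F I = (\<lambda>\<nu>. \<Sum>i\<in>{i\<in>I. F i \<nu> \<noteq> 0}. F i \<nu>)"

text \<open>
  The expanded product: choose a term \<open>e\<^bsup>\<mu> i\<^esup>\<close> from every factor, with \<open>\<mu> i = 0\<close> for all but finitely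
  many \<open>i\<close>. This is the formal product of the factors provided each has constant term \<open>1\<close>.
\<close>

definition fprod :: "('i \<Rightarrow> fchar) \<Rightarrow> 'i set \<Rightarrow> fchar" where
  "fprod F I = fsum (\<lambda>\<mu> \<nu>. if (\<Sum>i\<in>Poly_Mapping.keys \<mu>. Poly_Mapping.lookup \<mu> i) = \<nu>
       then (\<Prod>i\<in>Poly_Mapping.keys \<mu>. F i (Poly_Mapping.lookup \<mu> i)) else 0)
     {\<mu> :: 'i \<Rightarrow>\<^sub>0 weight. Poly_Mapping.keys \<mu> \<subseteq> I}"

text \<open>The expansion \<open>\<Sum>\<^sub>k e\<^bsup>-k\<alpha>\<^esup>\<close> of \<open>(1 - e\<^bsup>-\<alpha>\<^esup>)\<^sup>-\<^sup>1\<close>; see \<open>geom_inverse\<close> below.\<close>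

definition geom :: "weight \<Rightarrow> fchar" where
  "geom \<alpha> = fsum (\<lambda>k::nat. fexp (- wscale (of_nat k) \<alpha>)) UNIV"

text \<open>
  The character of the Verma module of highest weight \<open>0\<close> tensored with a Fock module (it does not
  depend on \<open>u\<close>). The exponent \<open>-n\<close> of the imaginary factors is rendered by \<open>n\<close> equal factors
  indexed by \<open>c\<close>.
\<close>

definition char_M0 :: "nat \<Rightarrow> fchar" where
  "char_M0 n =
     fprod (\<lambda>(m::nat, c::nat). geom (wscale (of_nat m) delta)) ({1..} \<times> {1..n}) \<star>
     fprod geom (pos_real_roots n)"

definition P_char :: "nat \<Rightarrow> weight \<Rightarrow> fchar" where
  "P_char n \<Lambda> = fexp \<Lambda> \<star> fsum (\<lambda>d. fexp (- pattern_depth n d)) (permitted n \<Lambda>)"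

definition weyl_sum :: "nat \<Rightarrow> weight \<Rightarrow> fchar" where
  "weyl_sum n \<Lambda> = fsum
     (\<lambda>w \<nu>. (-1) ^ coxeter_length n \<Lambda> w * fexp (w (\<Lambda> + rho n) - rho n) \<nu>) (int_weyl n \<Lambda>)"


section \<open>The module with basis the permitted patterns\<close>

text \<open>
  Finitely supported functions are the vector space with a given basis. The Cartan subalgebra is
  identified with its dual \<open>hdual n\<close> by means of the bilinear form, so that \<open>h\<close> acts on a vector of
  weight \<open>\<nu>\<close> by the scalar \<open>pairing n \<nu> h\<close>. Weights are compared only inside \<open>hdual n\<close>, since vectors
  outside of it may define the same linear form.
\<close>

definition pm_scale :: "complex \<Rightarrow> ('b \<Rightarrow>\<^sub>0 complex) \<Rightarrow> ('b \<Rightarrow>\<^sub>0 complex)" where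
  "pm_scale z v = Poly_Mapping.map (\<lambda>x. z * x) v"

lemma lookup_pm_scale: "Poly_Mapping.lookup (pm_scale z v) b = z * Poly_Mapping.lookup v b"
  by (simp add: pm_scale_def Poly_Mapping.map.rep_eq when_def)

lemma vector_space_pm_scale: "vector_space pm_scale"
  by unfold_locales
    (auto intro!: poly_mapping_eqI simp: lookup_pm_scale lookup_add algebra_simps)

definition weight_space ::
    "nat \<Rightarrow> ('b \<Rightarrow>\<^sub>0 complex) set \<Rightarrow> (weight \<Rightarrow> ('b \<Rightarrow>\<^sub>0 complex) \<Rightarrow> ('b \<Rightarrow>\<^sub>0 complex)) \<Rightarrow>
     weight \<Rightarrow> ('b \<Rightarrow>\<^sub>0 complex) set" where
  "weight_space n V act \<nu> = {v \<in> V. \<forall>h\<in>hdual n. act h v = pm_scale (pairing n \<nu> h) v}"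

definition char_of ::
    "nat \<Rightarrow> ('b \<Rightarrow>\<^sub>0 complex) set \<Rightarrow> (weight \<Rightarrow> ('b \<Rightarrow>\<^sub>0 complex) \<Rightarrow> ('b \<Rightarrow>\<^sub>0 complex)) \<Rightarrow> fchar" where
  "char_of n V act = (\<lambda>\<nu>. if \<nu> \<in> hdual n
     then int (vector_space.dim pm_scale (weight_space n V act \<nu>)) else 0)"

definition xi :: "pattern \<Rightarrow> (pattern \<Rightarrow>\<^sub>0 complex)" where
  "xi d = Poly_Mapping.single d 1"

definition L_space :: "nat \<Rightarrow> weight \<Rightarrow> (pattern \<Rightarrow>\<^sub>0 complex) set" where
  "L_space n \<Lambda> = module.span pm_scale (xi ` permitted n \<Lambda>)"

text \<open>
  The action of \<open>h + z a\<^sub>0\<close>, where \<open>a\<^sub>0 = Id \<otimes> t\<^sup>0\<close> acts by the scalar \<open>u\<close>.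
\<close>

definition L_act ::
    "nat \<Rightarrow> weight \<Rightarrow> complex \<Rightarrow> weight \<times> complex \<Rightarrow> (pattern \<Rightarrow>\<^sub>0 complex) \<Rightarrow> (pattern \<Rightarrow>\<^sub>0 complex)" where
  "L_act n \<Lambda> u = (\<lambda>(h, z).
     Poly_Mapping.mapp (\<lambda>d x. (pairing n (\<Lambda> - pattern_depth n d) h + z * u) * x))"

definition char_L :: "nat \<Rightarrow> weight \<Rightarrow> complex \<Rightarrow> fchar" where
  "char_L n \<Lambda> u = char_of n (L_space n \<Lambda>) (\<lambda>h. L_act n \<Lambda> u (h, 0))"


section \<open>Consistency of the conventions\<close>

lemma pairing_add_left: "pairing n (v + v') w = pairing n v w + pairing n v' w"
  by (simp add: pairing_def split: prod.splits) (simp add: algebra_simps sum.distrib)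

lemma omega_ex1:
  assumes n: "n \<ge> 2" and i: "i < n"
  shows "\<exists>!v. v \<in> hdual n \<and>
     (\<forall>j<n. pairing n v (alpha n (int j)) = (if i = j then 1 else 0)) \<and> pairing n v omega0 = 0"
proof -
  have sum_eps: "(\<Sum>k=1..n. c k * (if k = j then 1 else 0)) = c j" if "j \<in> {1..n}" for c :: "nat \<Rightarrow> complex" and j
    using that by (simp add: if_distrib[of "\<lambda>x. _ * x"] cong: if_cong)
  have p0: "pairing n (c, a, b) (alpha n 0) = b + c n - c 1" for c a b
  proof -
    have "(\<Sum>k=1..n. c k * ((if k = n then 1 else 0) - (if k = 1 then 1 else 0))) = c n - c 1"
      using n sum_eps[of n c] sum_eps[of 1 c] by (simp only: right_diff_distrib sum_subtractf) auto
    then show ?thesis by (simp add: alpha_def pairing_def delta_def eps_def)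
  qed
  have pj: "pairing n (c, a, b) (alpha n (int j)) = c j - c (j + 1)" if "1 \<le> j" "j < n" for c a b j
  proof -
    have "(\<Sum>k=1..n. c k * ((if k = j then 1 else 0) - (if k = j + 1 then 1 else 0))) = c j - c (j + 1)"
      using that sum_eps[of j c] sum_eps[of "j + 1" c]
      by (simp only: right_diff_distrib sum_subtractf) auto
    then show ?thesis using that by (simp add: alpha_def pairing_def eps_def zero_prod_def)
  qed
  have pw: "pairing n (c, a, b) omega0 = a" for c a b
    by (simp add: pairing_def omega0_def)
  define e where "e k = (if k \<in> {1..n} then (if k \<le> i then 1 else 0) - of_nat i / of_nat n else 0 :: complex)" for k
  have "(\<Sum>k=1..n. e k) = (\<Sum>k=1..n. (if k \<le> i then 1 else 0) - of_nat i / of_nat n)"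
    by (rule sum.cong) (auto simp: e_def)
  also have "\<dots> = (\<Sum>k=1..n. if k \<le> i then 1 else 0) - of_nat i"
    using n by (simp add: sum_subtractf)
  also have "(\<Sum>k=1..n. if k \<le> i then 1 else 0 :: complex) = (\<Sum>k=1..i. 1)"
    using i by (intro sum.mono_neutral_cong_right) auto
  finally have e0: "(\<Sum>k=1..n. e k) = 0" by simp
  have char: "((\<forall>j<n. pairing n (c, a, b) (alpha n (int j)) = (if i = j then 1 else 0))) \<longleftrightarrow>
      b + c n - c 1 = (if i = 0 then 1 else 0) \<and>
      (\<forall>j. 1 \<le> j \<longrightarrow> j < n \<longrightarrow> c j - c (j + 1) = (if i = j then 1 else 0))" for c a b
  proof -
    have "(\<forall>j<n. Q j) \<longleftrightarrow> Q 0 \<and> (\<forall>j. 1 \<le> j \<longrightarrow> j < n \<longrightarrow> Q j)" for Q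
      using n by (metis less_one not_less zero_less_iff_neq_zero le_zero_eq zero_neq_numeral)
    from this[of "\<lambda>j. pairing n (c, a, b) (alpha n (int j)) = (if i = j then 1 else 0)"]
    show ?thesis using p0 pj by simp
  qed
  show ?thesis
  proof (rule ex1I[of _ "(e, 0, 1)"])
    show "(e, 0, 1) \<in> hdual n \<and>
     (\<forall>j<n. pairing n (e, 0, 1) (alpha n (int j)) = (if i = j then 1 else 0)) \<and> pairing n (e, 0, 1) omega0 = 0"
      unfolding char pw using e0 n i by (auto simp: hdual_def e_def)
  next
    fix v :: weight
    assume v: "v \<in> hdual n \<and>
     (\<forall>j<n. pairing n v (alpha n (int j)) = (if i = j then 1 else 0)) \<and> pairing n v omega0 = 0"
    obtain c a b where cab: "v = (c, a, b)" by (cases v) auto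
    have a: "a = 0" using v cab pw by simp
    have c0: "c k = 0" if "k \<notin> {1..n}" for k using v cab that unfolding hdual_def by auto
    have csum: "(\<Sum>k=1..n. c k) = 0" using v cab unfolding hdual_def by auto
    have r: "b + c n - c 1 = (if i = 0 then 1 else 0)"
      "\<And>j. 1 \<le> j \<Longrightarrow> j < n \<Longrightarrow> c j - c (j + 1) = (if i = j then 1 else 0)"
      using v[unfolded cab char] by blast+
    have ediff: "e j - e (j + 1) = (if i = j then 1 else 0)" if "1 \<le> j" "j < n" for j
      using that i by (auto simp: e_def)
    have ce: "c k - e k = c 1 - e 1" if "1 \<le> k" "k \<le> n" for k
      using that
    proof (induction k rule: dec_induct)
      case base show ?case by simp
    next
      case (step k)
      have "c k - c (k + 1) = e k - e (k + 1)"
      proof -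
        have k: "1 \<le> k" "k < n" using step.hyps step.prems by linarith+
        show ?thesis by (rule trans[OF r(2)[OF k] ediff[OF k, symmetric]])
      qed
      moreover have "c k - e k = c 1 - e 1"
        by (rule step.IH) (use step.prems in linarith)
      moreover have "c (k + 1) - e (k + 1) = (c k - e k) - ((c k - c (k + 1)) - (e k - e (k + 1)))"
        by simp
      ultimately have "c (k + 1) - e (k + 1) = c 1 - e 1" by (simp only: diff_self diff_0_right)
      then show ?case by simp
    qed
    have "(\<Sum>k=1..n. c k - e k) = (\<Sum>k=1..n. c 1 - e 1)" by (intro sum.cong refl ce) auto
    then have "of_nat n * (c 1 - e 1) = 0" using csum e0 by (simp add: sum_subtractf)
    then have "c 1 - e 1 = 0" using n by simp
    then have "c k - e k = 0" if "k \<in> {1..n}" for k using ce[of k] that by (simp only: atLeastAtMost_iff)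
    then have c: "c = e" by (metis c0 e_def eq_iff_diff_eq_0 ext)
    have "b = 1"
    proof (cases "i = 0")
      case True
      then show ?thesis using r(1) n c by (simp add: e_def)
    next
      case False
      then show ?thesis using r(1) n i c by (simp add: e_def)
    qed
    then show "v = (e, 0, 1)" using cab a c by simp
  qed
qed

lemma L_act_xi:
  "L_act n \<Lambda> u (h, z) (xi d) = pm_scale (pairing n (\<Lambda> - pattern_depth n d) h + z * u) (xi d)"
  by (rule poly_mapping_eqI)
    (auto simp: L_act_def xi_def lookup_pm_scale Poly_Mapping.lookup_mapp lookup_single when_def)

lemma yy_diff:
  assumes "l < r"
  shows "yy n \<Lambda> l - yy n \<Lambda> r = pairing n (alpha_seg n l r) (\<Lambda> + rho n)"
proof -
  have split: "alpha_seg n a c = alpha_seg n a b + alpha_seg n b c" if "a \<le> b" "b \<le> c" for a b c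
  proof -
    have "{a..<c} = {a..<b} \<union> {b..<c}" using that by auto
    then show ?thesis unfolding alpha_seg_def by (simp add: sum.union_disjoint)
  qed
  consider "0 \<le> l" | "l < 0" "0 \<le> r" | "r < 0" using assms by linarith
  then show ?thesis
  proof cases
    case 1
    then show ?thesis using assms split[of 0 l r] by (simp add: yy_def pairing_add_left)
  next
    case 2
    then show ?thesis using assms split[of l 0 r] by (simp add: yy_def pairing_add_left)
  next
    case 3
    then show ?thesis using assms split[of l r 0] by (simp add: yy_def pairing_add_left)
  qed
qed

lemma geom_inverse:
  assumes "\<alpha> \<noteq> 0"
  shows "(fexp 0 - fexp (- \<alpha>)) \<star> geom \<alpha> = fexp 0"
proof
  fix \<nu> :: weight
  have inj: "wscale (of_nat k) \<alpha> = wscale (of_nat k') \<alpha> \<longleftrightarrow> k = k'" for k k'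
    using assms by (cases \<alpha>) (auto simp: wscale_def zero_prod_def fun_eq_iff)
  have geom_eq: "geom \<alpha> \<mu> = (if \<exists>k. \<mu> = - wscale (of_nat k) \<alpha> then 1 else 0)" for \<mu>
  proof (cases "\<exists>k. \<mu> = - wscale (of_nat k) \<alpha>")
    case True
    then obtain k where k: "\<mu> = - wscale (of_nat k) \<alpha>" by blast
    have "{i. fexp (- wscale (of_nat i) \<alpha>) \<mu> \<noteq> 0} = {k}"
      using inj by (auto simp: fexp_def k)
    then show ?thesis using k by (auto simp: geom_def fsum_def fexp_def)
  next
    case False
    then have "{i. fexp (- wscale (of_nat i) \<alpha>) \<mu> \<noteq> 0} = {}" by (auto simp: fexp_def)
    then show ?thesis using False by (auto simp: geom_def fsum_def)
  qed
  have w0: "wscale 0 \<alpha> = 0" by (cases \<alpha>) (auto simp: wscale_def zero_prod_def fun_eq_iff)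
  have wS: "wscale (of_nat (Suc k)) \<alpha> = \<alpha> + wscale (of_nat k) \<alpha>" for k
    by (cases \<alpha>) (auto simp: wscale_def fun_eq_iff algebra_simps)
  let ?f = "\<lambda>\<mu>. (fexp 0 - fexp (- \<alpha>)) \<mu> * geom \<alpha> (\<nu> - \<mu>)"
  have "((fexp 0 - fexp (- \<alpha>)) \<star> geom \<alpha>) \<nu> = Sum_any ?f" by (simp add: fmult_def)
  also have "\<dots> = sum ?f {0, - \<alpha>}"
    by (rule Sum_any.expand_superset) (auto simp: fexp_def)
  also have "\<dots> = geom \<alpha> \<nu> - geom \<alpha> (\<nu> + \<alpha>)"
    using assms by (simp add: fexp_def)
  also have "\<dots> = fexp 0 \<nu>"
  proof (cases "\<nu> = 0")
    case True
    have "geom \<alpha> 0 = 1" using w0 by (auto simp: geom_eq intro: exI[of _ 0])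
    moreover have "\<alpha> \<noteq> - wscale (of_nat k) \<alpha>" for k
    proof
      assume "\<alpha> = - wscale (of_nat k) \<alpha>"
      then have "\<alpha> + wscale (of_nat k) \<alpha> = 0" by (metis add.left_inverse add.commute)
      then have "wscale (of_nat (Suc k)) \<alpha> = wscale (of_nat 0) \<alpha>" using w0 wS[of k] by simp
      then show False using inj by blast
    qed
    ultimately show ?thesis using True by (auto simp: geom_eq fexp_def)
  next
    case False
    have "(\<exists>k. \<nu> = - wscale (of_nat k) \<alpha>) \<longleftrightarrow> (\<exists>k. \<nu> + \<alpha> = - wscale (of_nat k) \<alpha>)"
    proof
      assume "\<exists>k. \<nu> = - wscale (of_nat k) \<alpha>"
      then obtain k where k: "\<nu> = - wscale (of_nat k) \<alpha>" by blast
      with False w0 obtain k' where "k = Suc k'" by (cases k) auto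
      then have "\<nu> = - (\<alpha> + wscale (of_nat k') \<alpha>)" using k wS[of k'] by simp
      then have "\<nu> + \<alpha> = - wscale (of_nat k') \<alpha>" by simp
      then show "\<exists>k. \<nu> + \<alpha> = - wscale (of_nat k) \<alpha>" by blast
    next
      assume "\<exists>k. \<nu> + \<alpha> = - wscale (of_nat k) \<alpha>"
      then obtain k where k: "\<nu> + \<alpha> = - wscale (of_nat k) \<alpha>" by blast
      then have "\<nu> = - wscale (of_nat k) \<alpha> - \<alpha>" by (metis add_diff_cancel_right')
      then have "\<nu> = - (\<alpha> + wscale (of_nat k) \<alpha>)" by simp
      then have "\<nu> = - wscale (of_nat (Suc k)) \<alpha>" using wS[of k] by simp
      then show "\<exists>k. \<nu> = - wscale (of_nat k) \<alpha>" by blast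
    qed
    then show ?thesis using False by (simp add: geom_eq fexp_def)
  qed
  finally show "((fexp 0 - fexp (- \<alpha>)) \<star> geom \<alpha>) \<nu> = fexp 0 \<nu>" .
qed

end

theory Submission
  imports Defs "HOL-Combinatorics.Permutations"
begin

text \<open>
  Both equalities count patterns. The first holds because the vectors \<open>\<xi>\<^sub>d\<close> are weight vectors and the
  bilinear form separates the points of \<^term>\<open>hdual n\<close>, so that a weight space of the module is spanned
  by the permitted patterns of the corresponding depth. The second is proved by the path method of
  Lindstrom, Gessel and Viennot, in a periodic and weighted form.

  A pattern that satisfies no further condition is an \<open>n\<close>-tuple of partitions, namely its columns
  \<open>1, \<dots>, n\<close>. Recording how often the conjugate partition of column \<open>j\<close> has a part \<open>k\<close> amounts to
  choosing a multiplicity for each \<open>\<alpha>\<^bsub>j,j+k\<^esub>\<close>. Every positive real root is \<open>\<alpha>\<^bsub>j,j+k\<^esub>\<close> for exactly one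
  such pair with \<open>k\<close> not divisible by \<open>n\<close>, and each \<open>m \<delta>\<close> occurs \<open>n\<close> times. Hence the character of
  the Verma-Fock module is the generating function of all patterns (\<open>char_M0_patterns\<close>), and its product
  with the alternating sum over the integral Weyl group is a signed count of pairs \<open>(d, w)\<close> by the
  weight \<open>w (\<Lambda> + \<rho>) - \<rho> - depth d\<close>.

  Extend \<open>\<epsilon>\<^sub>1, \<dots>, \<epsilon>\<^sub>n\<close> to a family \<open>E\<^sub>l\<close> indexed by all integers with \<open>\<alpha>\<^sub>l = E\<^sub>l - E\<^bsub>l+1\<^esub>\<close>, and put
  \<open>g\<^sub>j = (w (\<Lambda> + \<rho>), E\<^sub>j)\<close>. Column \<open>j\<close> is drawn as a descending lattice path that comes from above at
  abscissa \<open>j\<close>, has ordinate \<open>d\<^bsub>i,j\<^esub> - g\<^sub>j\<close> after abscissa \<open>i\<close>, and ends at ordinate \<open>- g\<^sub>j\<close>. The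
  reflection in \<open>E\<^sub>l - E\<^sub>r\<close> exchanges \<open>g\<^sub>l\<close> and \<open>g\<^sub>r\<close>, that is, the ends of the paths \<open>l\<close> and \<open>r\<close>. If
  two paths meet, exchanging their tails behind a meeting point and multiplying \<open>w\<close> by this reflection
  preserves the weight and reverses the sign. As \<open>Re \<kappa> > 0\<close>, a path never meets its own translates by
  the period, which allows the exchange to be made at all translates of the meeting point at once. The
  exchange is an involution, because the set of meeting points and the set of paths through the chosen
  one are unchanged (\<open>flip_config\<close>), so all pairs with a meeting point cancel.

  If no paths meet, then of two paths whose ends differ by an integer the one that starts further left
  stays below the other one. This says precisely
  that the inequalities of a permitted pattern hold, with \<open>g\<close> in place of the numbers \<open>y\<close>, and it
  forces the ends to be in the same order as those for \<open>w = 1\<close>; then \<open>w = 1\<close> by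
  \<open>orbit_dominant_unique\<close> and \<open>word_stabilizer\<close>. What survives is the number of permitted patterns
  (\<open>signed_count\<close>).

  Two points need care. All sums must be finite: an element \<open>w\<close> is an isometry and moves \<open>\<Lambda> + \<rho>\<close> by an
  integral vector, and the resulting quadratic equation bounds the height of \<open>w (\<Lambda> + \<rho>)\<close> from above
  (\<open>orbit_height_bounded\<close>). The sign is defined by the Coxeter length: the reflections in the base
  generate the group (\<open>reflect_in_base_words\<close>), and modulo \<open>n\<close> a product of \<open>k\<close> integral reflections
  permutes the residues by a product of \<open>k\<close> transpositions (\<open>word_length_parity\<close>).
\<close>

section \<open>Columns of a pattern as lattice paths\<close>

lemma gt_zero: "gt_pattern n d \<Longrightarrow> i < j \<Longrightarrow> d i j = 0"
  by (simp add: gt_pattern_def)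

lemma gt_antimono:
  assumes "gt_pattern n d" "j \<le> i" "i \<le> i'"
  shows "d i' j \<le> d i j"
  using \<open>i \<le> i'\<close>
proof (induction i' rule: int_ge_induct)
  case (step i')
  then have "d (i' + 1) j \<le> d i' j"
    using assms by (simp add: gt_pattern_def)
  with step.IH show ?case by simp
qed simp

lemma gt_periodic:
  assumes "gt_pattern n d"
  shows "d (i + int n * k) (j + int n * k) = d i j"
proof (cases "i < j")
  case True
  then show ?thesis using gt_zero[OF assms] by simp
next
  case False
  have step: "d (i + int n) (j + int n) = d i j" if "j \<le> i" for i j
    using assms that by (simp add: gt_pattern_def)
  have nat: "d (i + int n * int m) (j + int n * int m) = d i j" if "j \<le> i" for i j m
  proof (induction m)
    case (Suc m)
    have "d (i + int n * int m + int n) (j + int n * int m + int n)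
        = d (i + int n * int m) (j + int n * int m)"
      using that by (intro step) simp
    with Suc show ?case by (simp add: algebra_simps)
  qed simp
  show ?thesis
  proof (cases "k \<ge> 0")
    case True
    with nat[of j i "nat k"] False show ?thesis by simp
  next
    case k: False
    with nat[of "j + int n * k" "i + int n * k" "nat (- k)"] False show ?thesis by simp
  qed
qed

lemma gt_row_finite: "gt_pattern n d \<Longrightarrow> finite {j. d i j \<noteq> 0}"
proof -
  assume gt: "gt_pattern n d"
  then have "finite {j. j \<le> i \<and> d i j \<noteq> 0}" by (simp add: gt_pattern_def)
  moreover have "{j. j \<le> i \<and> d i j \<noteq> 0} = {j. d i j \<noteq> 0}"
    using gt_zero[OF gt] by (metis less_le_not_le linorder_le_less_linear)
  ultimately show ?thesis by simp
qed

lemma shift_into_period: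
  assumes "n > 0"
  obtains k where "i + int n * k \<in> {1..int n}"
proof
  have "(i - 1) mod int n + 1 \<in> {1..int n}"
    using assms pos_mod_bound[of "int n" "i - 1"] pos_mod_sign[of "int n" "i - 1"]
    by (simp del: pos_mod_bound add: zless_imp_add1_zle)
  moreover have "(i - 1) mod int n + 1 = i + int n * (- ((i - 1) div int n))"
    by (simp add: minus_mult_div_eq_mod[symmetric])
  ultimately show "i + int n * (- ((i - 1) div int n)) \<in> {1..int n}" by simp
qed

text \<open>
  Periodicity moves any entry into one of the finitely many rows \<open>1, \<dots>, n\<close>, each of which has finitely
  many nonzero entries. Hence all columns have bounded length.
\<close>

lemma gt_bounded_support:
  assumes gt: "gt_pattern n d" and n: "n > 0"
  shows "\<exists>K::nat. \<forall>i j. d i j \<noteq> 0 \<longrightarrow> i \<le> j + int K"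
proof -
  define F where "F = (\<Union>i\<in>{1..int n}. {j. d i j \<noteq> 0})"
  have "finite F" unfolding F_def using gt_row_finite[OF gt] by simp
  then obtain b where b: "\<And>j. j \<in> F \<Longrightarrow> b \<le> j"
    by (metis bdd_below.E bdd_below_finite)
  have "i \<le> j + int (nat (int n - b))" if ij: "d i j \<noteq> 0" for i j
  proof -
    obtain k where k: "i + int n * k \<in> {1..int n}" by (rule shift_into_period[OF n])
    have "j + int n * k \<in> F"
      unfolding F_def using k gt_periodic[OF gt, of i k j] ij by (intro UN_I[OF k]) simp
    then have "b \<le> j + int n * k" by (rule b)
    with k show ?thesis by auto
  qed
  then show ?thesis by blast
qed

text \<open>
  At abscissa \<open>i\<close> the path of column \<open>j\<close> descends from ordinate \<open>d\<^bsub>i-1,j\<^esub> - g\<^sub>j\<close>, or from infinity if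
  \<open>i = j\<close>, to \<open>d\<^bsub>i,j\<^esub> - g\<^sub>j\<close>. The number \<open>t\<close> is the height of the point \<open>(i, h)\<close> above the end of the path.
  Ordinates are complex, so that the translation \<open>(i, h) \<mapsto> (i + n, h + \<kappa>)\<close> makes sense for every \<open>\<kappa>\<close>;
  paths can meet only if their ends differ by an integer.
\<close>

definition on_path :: "(int \<Rightarrow> complex) \<Rightarrow> pattern \<Rightarrow> int \<Rightarrow> int \<times> complex \<Rightarrow> bool" where
  "on_path g d j q \<longleftrightarrow> j \<le> fst q \<and>
     (\<exists>t. snd q + g j = of_nat t \<and> d (fst q) j \<le> t \<and> (j < fst q \<longrightarrow> t \<le> d (fst q - 1) j))"

definition crossings :: "(int \<Rightarrow> complex) \<Rightarrow> pattern \<Rightarrow> (int \<times> complex) set" where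
  "crossings g d = {q. \<exists>a b. a \<noteq> b \<and> on_path g d a q \<and> on_path g d b q}"

definition quasi_periodic :: "nat \<Rightarrow> complex \<Rightarrow> (int \<Rightarrow> complex) \<Rightarrow> bool" where
  "quasi_periodic n \<kappa> g \<longleftrightarrow> (\<forall>j k. g (j + int n * k) = g j - of_int k * \<kappa>)"

lemma quasi_periodicD: "quasi_periodic n \<kappa> g \<Longrightarrow> g (j + int n * k) = g j - of_int k * \<kappa>"
  by (simp add: quasi_periodic_def)

text \<open>
  A path descends, whereas the translate of a point by a positive multiple of the period lies to the
  right and above, because \<open>Re \<kappa> > 0\<close>. So no path passes through two translates of one point.
\<close>

lemma congruent_paths_disjoint:
  assumes gt: "gt_pattern n d" and per: "quasi_periodic n \<kappa> g" and \<kappa>: "Re \<kappa> > 0"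
    and on: "on_path g d a q" "on_path g d b q" and mod: "a mod int n = b mod int n"
  shows "a = b"
proof -
  have aux: False if on: "on_path g d j (i, h)" "on_path g d (j + int n * k) (i, h)" and k: "k > 0" and n: "n > 0"
    for i h j k
  proof -
    obtain t where t: "h + g j = of_nat t" "d i j \<le> t" "j < i \<longrightarrow> t \<le> d (i - 1) j" "j \<le> i"
      using on(1) by (auto simp: on_path_def)
    obtain s where s: "h + g (j + int n * k) = of_nat s" "d i (j + int n * k) \<le> s" "j + int n * k \<le> i"
      using on(2) by (auto simp: on_path_def)
    have nk: "int n * k \<ge> 1" using n k by (simp add: int_one_le_iff_zero_less)
    have "of_nat t = of_nat s + of_int k * \<kappa>"
      using quasi_periodicD[OF per, of j k] by (simp flip: t(1) s(1))
    then have "Re (of_nat t) = Re (of_nat s + of_int k * \<kappa>)" by simp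
    then have "real t = real s + of_int k * Re \<kappa>" by simp
    moreover have "of_int k * Re \<kappa> > 0" using k \<kappa> by simp
    ultimately have "t > s" by linarith
    moreover have "s \<ge> d (i - int n * k) j"
      using s(2) gt_periodic[OF gt, of "i - int n * k" k j] by simp
    moreover have "d (i - int n * k) j \<ge> d (i - 1) j"
      using s(3) nk by (intro gt_antimono[OF gt]) auto
    moreover have "d (i - 1) j \<ge> t" using t(3) s(3) nk by auto
    ultimately show False by simp
  qed
  show ?thesis
  proof (cases "n = 0")
    case True
    then show ?thesis using mod by simp
  next
    case False
    obtain k where k: "b = a + int n * k"
      using mod_eqE[OF mod] by blast
    have "k = 0"
    proof (rule ccontr)
      assume "k \<noteq> 0"
      then consider "k > 0" | "- k > 0" by linarith
      then show False
      proof cases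
        case 1
        then show False using aux[of a "fst q" "snd q" k] on k False by simp
      next
        case 2
        then show False using aux[of b "fst q" "snd q" "- k"] on k False by simp
      qed
    qed
    then show ?thesis using k by simp
  qed
qed

text \<open>
  At abscissa \<open>r\<close> path \<open>r\<close> occupies everything above its first ordinate, so path \<open>l\<close> has to be below it.
  It stays below: if the inequality fails for the first time at \<open>i\<close>, then the upper end of the vertical
  piece of path \<open>l\<close> at the next abscissa lies on both paths.
\<close>

lemma no_crossings_imp_less:
  assumes gt: "gt_pattern n d" and none: "crossings g d = {}"
    and lr: "l < r" and m: "g l - g r = of_int m" and i: "r - 1 \<le> i"
  shows "int (d i l) \<le> int (d (i + 1) r) + m - 1"
proof -
  have cross: False
    if "on_path g d l q" "on_path g d r q" for q
    using that lr none unfolding crossings_def by (metis (mono_tags, lifting) empty_Collect_eq less_irrefl)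
  show ?thesis
    using i
  proof (induction i rule: int_ge_induct)
    case base
    show ?case
    proof (rule ccontr)
      assume "\<not> ?thesis"
      then have ge: "int (d (r - 1) l) \<ge> int (d r r) + m" by simp
      define t where "t = nat (int (d (r - 1) l) - m)"
      have t: "int t = int (d (r - 1) l) - m" "d r r \<le> t" using ge by (auto simp: t_def)
      define h where "h = of_nat (d (r - 1) l) - g l"
      have "on_path g d l (r, h)"
        unfolding on_path_def using lr gt_antimono[OF gt, of l "r - 1" r]
        by (auto simp: h_def intro!: exI[of _ "d (r - 1) l"])
      moreover have "h + g r = of_nat t"
      proof -
        have "of_int (int t) = (of_int (int (d (r - 1) l) - m) :: complex)" using t(1) by simp
        then show ?thesis using m by (simp add: h_def algebra_simps)
      qed
      then have "on_path g d r (r, h)"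
        unfolding on_path_def using t(2) by auto
      ultimately show False by (rule cross)
    qed
  next
    case (step i)
    show ?case
    proof (rule ccontr)
      assume "\<not> ?thesis"
      then have ge: "int (d (i + 1) l) \<ge> int (d (i + 1 + 1) r) + m" by simp
      define t where "t = nat (int (d (i + 1) l) - m)"
      have t: "int t = int (d (i + 1) l) - m" "d (i + 1 + 1) r \<le> t" using ge by (auto simp: t_def)
      have "d (i + 1) l \<le> d i l" using step.hyps lr by (intro gt_antimono[OF gt]) auto
      then have t': "t \<le> d (i + 1) r" using t(1) step.IH by linarith
      define h where "h = of_nat (d (i + 1) l) - g l"
      have "on_path g d l (i + 1 + 1, h)"
        unfolding on_path_def using lr step.hyps gt_antimono[OF gt, of l "i + 1" "i + 1 + 1"]
        by (auto simp: h_def add.commute intro!: exI[of _ "d (i + 1) l"])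
      moreover have "h + g r = of_nat t"
      proof -
        have "of_int (int t) = (of_int (int (d (i + 1) l) - m) :: complex)" using t(1) by simp
        then show ?thesis using m by (simp add: h_def algebra_simps)
      qed
      then have "on_path g d r (i + 1 + 1, h)"
        unfolding on_path_def using t(2) t' step.hyps by (auto simp: add.commute)
      ultimately show False by (rule cross)
    qed
  qed
qed

text \<open>
  Far to the right both columns have vanished, and the inequality compares the ends of the paths.
\<close>

lemma no_crossings_imp_decreasing:
  assumes gt: "gt_pattern n d" and n: "n > 0" and none: "crossings g d = {}"
    and lr: "l < r" and m: "g l - g r = of_int m"
  shows "m > 0"
proof -
  obtain K where K: "\<And>i j. d i j \<noteq> 0 \<Longrightarrow> i \<le> j + int K"
    using gt_bounded_support[OF gt n] by blast
  have "d (r + int K + 1) r = 0" using K[of "r + int K + 1" r] by auto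
  with no_crossings_imp_less[OF gt none lr m, of "r + int K"] show ?thesis by simp
qed

section \<open>Exchanging the tails of paths\<close>

text \<open>
  Path \<open>j\<close> is cut at abscissa \<open>thr j\<close>, at height \<open>T j\<close> above its end, and continued by the tail of path
  \<open>\<tau> j\<close>. Before the cut its ordinates are unchanged; the entries change because they measure the
  height above the new end. A path that keeps its tail has \<open>\<tau> j = j\<close> and may be cut anywhere.
\<close>

definition tail_swap :: "(int \<Rightarrow> int) \<Rightarrow> (int \<Rightarrow> int) \<Rightarrow> (int \<Rightarrow> nat) \<Rightarrow> pattern \<Rightarrow> pattern" where
  "tail_swap \<tau> thr T d i j =
     (if i < j then 0 else if i < thr j then d i j + T (\<tau> j) - T j else d i (\<tau> j))"

text \<open>
  The assumption \<open>height\<close> says that a path and its partner are cut at the same ordinate; \<open>lower\<close> and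
  \<open>upper\<close> say that the cut lies on the path.
\<close>

locale swap_data =
  fixes n :: nat and d :: pattern and g :: "int \<Rightarrow> complex"
    and \<tau> thr :: "int \<Rightarrow> int" and T :: "int \<Rightarrow> nat"
  assumes n: "n > 0" and gt: "gt_pattern n d"
    and invol: "\<And>j. \<tau> (\<tau> j) = j"
    and thr_swap: "\<And>j. thr (\<tau> j) = thr j"
    and thr_ge: "\<And>j. j \<le> thr j"
    and thr_bounded: "\<exists>K. \<forall>j. thr j \<le> j + K"
    and shift: "\<And>j. \<tau> (j + int n) = \<tau> j + int n" "\<And>j. thr (j + int n) = thr j + int n"
      "\<And>j. T (j + int n) = T j"
    and height: "\<And>j. of_nat (T (\<tau> j)) - g (\<tau> j) = of_nat (T j) - g j"
    and lower: "\<And>j. d (thr j) j \<le> T j"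
    and upper: "\<And>j. j < thr j \<Longrightarrow> T j \<le> d (thr j - 1) j"
begin

abbreviation "d' \<equiv> tail_swap \<tau> thr T d"

lemma swap_le: "\<tau> j \<le> thr j"
  using thr_ge[of "\<tau> j"] thr_swap[of j] by simp

lemma T_le: "j \<le> i \<Longrightarrow> i < thr j \<Longrightarrow> T j \<le> d i j"
  using upper[of j] gt_antimono[OF gt, of j i "thr j - 1"] by simp

lemma le_T: "thr j \<le> i \<Longrightarrow> d i j \<le> T j"
  using lower[of j] gt_antimono[OF gt, of j "thr j" i] thr_ge[of j] by simp

lemma before: "j \<le> i \<Longrightarrow> i < thr j \<Longrightarrow> int (d' i j) = int (d i j) + int (T (\<tau> j)) - int (T j)"
  using T_le[of j i] by (simp add: tail_swap_def of_nat_diff)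

lemma after: "thr j \<le> i \<Longrightarrow> d' i j = d i (\<tau> j)"
  using thr_ge[of j] by (simp add: tail_swap_def)

lemma gt_tail_swap: "gt_pattern n d'"
  unfolding gt_pattern_def
proof (intro conjI allI impI)
  fix i j :: int assume "i < j" then show "d' i j = 0" by (simp add: tail_swap_def)
next
  fix i j :: int assume ij: "j \<le> i"
  consider "i + 1 < thr j" | "i + 1 = thr j" | "thr j \<le> i" by linarith
  then show "d' (i + 1) j \<le> d' i j"
  proof cases
    case 1
    then show ?thesis
      using ij before[of j i] before[of j "i + 1"] gt_antimono[OF gt, of j i "i + 1"] by simp
  next
    case 2
    then have "d' (i + 1) j \<le> T (\<tau> j)" using after[of j "i + 1"] le_T[of "\<tau> j" "i + 1"] thr_swap by simp
    moreover have "T (\<tau> j) \<le> d' i j" using 2 ij before[of j i] T_le[of j i] by simp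
    ultimately show ?thesis by simp
  next
    case 3
    then show ?thesis
      using after[of j i] after[of j "i + 1"] gt_antimono[OF gt, of "\<tau> j" i "i + 1"] swap_le[of j] by simp
  qed
next
  fix i j :: int assume "j \<le> i"
  have "d (i + int n) (j + int n) = d i j" for i j using gt_periodic[OF gt, of i 1 j] by simp
  then show "d' (i + int n) (j + int n) = d' i j"
    by (simp add: tail_swap_def shift)
next
  fix i :: int
  obtain K where K: "\<And>j. thr j \<le> j + K" using thr_bounded by blast
  have "{j. j \<le> i \<and> d' i j \<noteq> 0} \<subseteq> {i - K..i} \<union> \<tau> ` {j. d i j \<noteq> 0}"
  proof
    fix j assume j: "j \<in> {j. j \<le> i \<and> d' i j \<noteq> 0}"
    show "j \<in> {i - K..i} \<union> \<tau> ` {j. d i j \<noteq> 0}"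
    proof (cases "i < thr j")
      case True
      then show ?thesis using j K[of j] by auto
    next
      case False
      then have "d i (\<tau> j) \<noteq> 0" using j after[of j i] by simp
      then show ?thesis using invol[of j] by (metis (mono_tags, lifting) UnI2 image_eqI mem_Collect_eq)
    qed
  qed
  then show "finite {j. j \<le> i \<and> d' i j \<noteq> 0}"
    using gt_row_finite[OF gt, of i] by (meson finite_UnI finite_atLeastAtMost_int finite_imageI finite_subset)
qed

lemma swap_swap: "tail_swap \<tau> thr (T \<circ> \<tau>) d' = d"
proof (intro ext)
  fix i j
  consider "i < j" | "j \<le> i" "i < thr j" | "thr j \<le> i" by linarith
  then show "tail_swap \<tau> thr (T \<circ> \<tau>) d' i j = d i j"
  proof cases
    case 1 then show ?thesis using gt_zero[OF gt] by (simp add: tail_swap_def)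
  next
    case 2
    then have "int (d' i j) = int (d i j) + int (T (\<tau> j)) - int (T j)" by (rule before)
    then have "d' i j + T j - T (\<tau> j) = d i j" using T_le[OF 2] by simp
    then show ?thesis using 2 by (simp add: tail_swap_def[of _ _ "T \<circ> \<tau>"] invol)
  next
    case 3
    then show ?thesis using after[of "\<tau> j" i] thr_swap[of j] thr_ge[of j]
      by (simp add: tail_swap_def[of _ _ "T \<circ> \<tau>"] invol)
  qed
qed

text \<open>
  The points at or behind the cut: further right, or further down at the same abscissa.
\<close>

definition past :: "int \<times> complex \<Rightarrow> int \<Rightarrow> bool" where
  "past q j \<longleftrightarrow> thr j < fst q \<or> (thr j = fst q \<and> (\<exists>m::nat. of_nat (T j) - g j - snd q = of_nat m))"

lemma past_swap: "past q (\<tau> j) = past q j"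
  using height[of j] by (simp add: past_def thr_swap)

text \<open>
  Behind the cut the new path \<open>j\<close> is the old path \<open>\<tau> j\<close>, before the cut it is the old path \<open>j\<close>. At the
  abscissa of the cut, the vertical pieces of both old paths contain the cut, and the new piece
  consists of the upper part of one and the lower part of the other.
\<close>

lemma on_path_swap:
  "on_path (g \<circ> \<tau>) d' j q \<longleftrightarrow> on_path g d (if past q j then \<tau> j else j) q"
proof -
  obtain i h where q: "q = (i, h)" by (cases q)
  have g_swap: "h + g (\<tau> j) = h + g j + of_nat (T (\<tau> j)) - of_nat (T j)"
    using height[of j] by (simp add: algebra_simps)
  \<comment> \<open>Ordinates relative to the two ends differ by the difference of the heights of the exchange point.\<close>
  have rel: "h + g (\<tau> j) = of_nat t' \<longleftrightarrow> h + g j = of_nat t"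
    if "int t' = int t + int (T (\<tau> j)) - int (T j)" for t t'
  proof -
    have "(of_int (int t') :: complex) = of_int (int t + int (T (\<tau> j)) - int (T j))" using that by simp
    then have "(of_nat t' :: complex) = of_nat t + of_nat (T (\<tau> j)) - of_nat (T j)" by simp
    then show ?thesis using g_swap by simp
  qed
  consider "i < j" | "j \<le> i" "i < thr j" | "thr j = i" | "thr j < i" by linarith
  then show ?thesis
  proof cases
    case 1
    then show ?thesis using thr_ge[of j] by (auto simp: q on_path_def past_def)
  next
    case 2
    then have np: "\<not> past q j" by (simp add: q past_def)
    have "(\<exists>t'. h + g (\<tau> j) = of_nat t' \<and> d' i j \<le> t' \<and> (j < i \<longrightarrow> t' \<le> d' (i - 1) j)) \<longleftrightarrow>
      (\<exists>t. h + g j = of_nat t \<and> d i j \<le> t \<and> (j < i \<longrightarrow> t \<le> d (i - 1) j))" (is "?L \<longleftrightarrow> ?R")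
    proof
      assume ?L
      then obtain t' where t': "h + g (\<tau> j) = of_nat t'" "d' i j \<le> t'" "j < i \<longrightarrow> t' \<le> d' (i - 1) j" by blast
      define t where "t = nat (int t' - int (T (\<tau> j)) + int (T j))"
      have t: "int t' = int t + int (T (\<tau> j)) - int (T j)"
        using t'(2) before[OF 2] by (simp add: t_def)
      show ?R
        using t' t rel[OF t] before[OF 2] before[of j "i - 1"] 2 by (intro exI[of _ t]) auto
    next
      assume ?R
      then obtain t where t: "h + g j = of_nat t" "d i j \<le> t" "j < i \<longrightarrow> t \<le> d (i - 1) j" by blast
      define t' where "t' = nat (int t + int (T (\<tau> j)) - int (T j))"
      have t': "int t' = int t + int (T (\<tau> j)) - int (T j)"
        using t(2) T_le[OF 2] by (simp add: t'_def)
      show ?L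
        using t t' rel[OF t'] before[OF 2] before[of j "i - 1"] 2 by (intro exI[of _ t']) auto
    qed
    then show ?thesis using np 2 by (simp add: q on_path_def)
  next
    case 3
    have d'i: "d' i j = d i (\<tau> j)" using after[of j i] 3 by simp
    have low: "d i (\<tau> j) \<le> T (\<tau> j)" using le_T[of "\<tau> j" i] thr_swap 3 by simp
    have le: "j \<le> i" "\<tau> j \<le> i" using thr_ge[of j] swap_le[of j] 3 by simp_all
    have up: "T j \<le> d (i - 1) j" if "j < i" using T_le[of j "i - 1"] that 3 by simp
    have up': "T (\<tau> j) \<le> d (i - 1) (\<tau> j)" if "\<tau> j < i"
      using T_le[of "\<tau> j" "i - 1"] that 3 thr_swap by simp
    have d'i1: "int (d' (i - 1) j) = int (d (i - 1) j) + int (T (\<tau> j)) - int (T j)" if "j < i"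
      using before[of j "i - 1"] that 3 by simp
    have past_iff: "past q j \<longleftrightarrow> t' \<le> T (\<tau> j)" if "h + g (\<tau> j) = of_nat t'" for t'
    proof -
      have "of_nat (T j) - g j - h = of_nat (T (\<tau> j)) - of_nat t'"
        using height[of j] that by (simp add: algebra_simps flip: that)
      then have "past q j \<longleftrightarrow> (\<exists>m::nat. of_nat (T (\<tau> j)) - of_nat t' = (of_nat m :: complex))"
        using 3 by (simp add: past_def q)
      also have "\<dots> \<longleftrightarrow> (\<exists>m::nat. T (\<tau> j) = t' + m)"
        by (simp add: diff_eq_eq add.commute flip: of_nat_add)
      also have "\<dots> \<longleftrightarrow> t' \<le> T (\<tau> j)" by (simp add: le_iff_add)
      finally show ?thesis .
    qed
    show ?thesis
    proof (cases "past q j")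
      case True
      have "on_path (g \<circ> \<tau>) d' j q \<longleftrightarrow> on_path g d (\<tau> j) q"
      proof
        assume "on_path (g \<circ> \<tau>) d' j q"
        then obtain t' where t': "h + g (\<tau> j) = of_nat t'" "d i (\<tau> j) \<le> t'"
          by (auto simp: on_path_def q d'i)
        then have "t' \<le> T (\<tau> j)" using True past_iff by simp
        then show "on_path g d (\<tau> j) q"
          unfolding on_path_def q fst_conv snd_conv using t' le up' by (intro conjI exI[of _ t']) auto
      next
        assume "on_path g d (\<tau> j) q"
        then obtain t' where t': "h + g (\<tau> j) = of_nat t'" "d i (\<tau> j) \<le> t'"
          by (auto simp: on_path_def q)
        then have t'': "t' \<le> T (\<tau> j)" using True past_iff by simp
        have "t' \<le> d' (i - 1) j" if "j < i" using up[OF that] d'i1[OF that] t'' by linarith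
        then show "on_path (g \<circ> \<tau>) d' j q"
          unfolding on_path_def q fst_conv snd_conv using t' le d'i by (intro conjI exI[of _ t']) auto
      qed
      then show ?thesis using True by simp
    next
      case False
      have "on_path (g \<circ> \<tau>) d' j q \<longleftrightarrow> on_path g d j q"
      proof
        assume "on_path (g \<circ> \<tau>) d' j q"
        then obtain t' where t': "h + g (\<tau> j) = of_nat t'" "j < i \<longrightarrow> t' \<le> d' (i - 1) j"
          by (auto simp: on_path_def q)
        then have gr: "t' > T (\<tau> j)" using False past_iff by simp
        define t where "t = nat (int t' - int (T (\<tau> j)) + int (T j))"
        have t: "int t' = int t + int (T (\<tau> j)) - int (T j)" "t \<ge> T j"
          using gr by (simp_all add: t_def)
        show "on_path g d j q"
          unfolding on_path_def q fst_conv snd_conv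
          using t t' rel[OF t(1)] le d'i1 lower[of j] 3 by (intro conjI exI[of _ t]) auto
      next
        assume "on_path g d j q"
        then obtain t where t: "h + g j = of_nat t" "d i j \<le> t" "j < i \<longrightarrow> t \<le> d (i - 1) j"
          by (auto simp: on_path_def q)
        have gr: "t > T j"
        proof (rule ccontr)
          assume "\<not> t > T j"
          then have "of_nat (T j) - g j - h = of_nat (T j - t)"
            using t(1) by (simp add: of_nat_diff algebra_simps flip: t(1))
          then show False using False 3 by (auto simp: past_def q)
        qed
        define t' where "t' = nat (int t + int (T (\<tau> j)) - int (T j))"
        have t': "int t' = int t + int (T (\<tau> j)) - int (T j)" "t' \<ge> T (\<tau> j)"
          using gr by (simp_all add: t'_def)
        show "on_path (g \<circ> \<tau>) d' j q"
          unfolding on_path_def q fst_conv snd_conv o_def d'i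
          using t t' rel[OF t'(1)] le d'i1 low by (intro conjI exI[of _ t']) auto
      qed
      then show ?thesis using False by simp
    qed
  next
    case 4
    then have "past q j" by (simp add: past_def q)
    moreover have "j < i" "\<tau> j < i" using thr_ge[of j] swap_le[of j] 4 by simp_all
    ultimately show ?thesis
      using after[of j i] after[of j "i - 1"] 4 by (simp add: on_path_def q)
  qed
qed

text \<open>
  At every point the exchange only relabels the paths through it, by an involution.
\<close>

lemma crossings_swap: "crossings (g \<circ> \<tau>) d' = crossings g d"
proof -
  define \<pi> where "\<pi> q j = (if past q j then \<tau> j else j)" for q j
  have inv: "\<pi> q (\<pi> q j) = j" for q j by (cases "past q j") (simp_all add: \<pi>_def past_swap invol)
  have neq: "\<pi> q a \<noteq> \<pi> q b" if "a \<noteq> b" for q a b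
    using that inv[of q a] inv[of q b] by auto
  have on: "on_path (g \<circ> \<tau>) d' j q \<longleftrightarrow> on_path g d (\<pi> q j) q" for j q
    by (simp add: on_path_swap \<pi>_def)
  have "q \<in> crossings (g \<circ> \<tau>) d' \<longleftrightarrow> q \<in> crossings g d" for q
  proof
    assume "q \<in> crossings (g \<circ> \<tau>) d'"
    then obtain a b where "a \<noteq> b" "on_path g d (\<pi> q a) q" "on_path g d (\<pi> q b) q"
      unfolding crossings_def on by blast
    with neq[OF \<open>a \<noteq> b\<close>, of q] show "q \<in> crossings g d" unfolding crossings_def by blast
  next
    assume "q \<in> crossings g d"
    then obtain a b where "a \<noteq> b" "on_path g d a q" "on_path g d b q"
      unfolding crossings_def by blast
    then have "on_path (g \<circ> \<tau>) d' (\<pi> q a) q" "on_path (g \<circ> \<tau>) d' (\<pi> q b) q"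
      by (simp_all add: on inv)
    with neq[OF \<open>a \<noteq> b\<close>, of q] show "q \<in> crossings (g \<circ> \<tau>) d'"
      unfolding crossings_def by blast
  qed
  then show ?thesis by blast
qed

end

section \<open>Periodic coordinates of weights\<close>

lemma wscale_triple: "wscale z (c, a, b) = (\<lambda>i. z * c i, z * a, z * b)"
  by (simp add: wscale_def)

interpretation wv: vector_space wscale
  by unfold_locales (simp_all add: split_paired_all wscale_triple fun_eq_iff algebra_simps)

lemma pairing_commute: "pairing n v w = pairing n w v"
  by (simp add: pairing_def algebra_simps split: prod.splits)

lemma pairing_wscale_left: "pairing n (wscale z v) w = z * pairing n v w"
  by (simp add: pairing_def wscale_def algebra_simps sum_distrib_left split: prod.splits)

lemma pairing_wscale_right: "pairing n w (wscale z v) = z * pairing n w v"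
  using pairing_wscale_left[of n z v w] by (simp only: pairing_commute)

lemma pairing_diff_left: "pairing n (v - v') w = pairing n v w - pairing n v' w"
  using pairing_add_left[of n "v - v'" v' w] by simp

lemma pairing_diff_right: "pairing n w (v - v') = pairing n w v - pairing n w v'"
  using pairing_diff_left[of n v v' w] by (simp only: pairing_commute)

lemma hdual_add: "v \<in> hdual n \<Longrightarrow> w \<in> hdual n \<Longrightarrow> v + w \<in> hdual n"
  by (auto simp: hdual_def sum.distrib)

lemma hdual_scale: "v \<in> hdual n \<Longrightarrow> wscale z v \<in> hdual n"
  by (auto simp: hdual_def wscale_def simp flip: sum_distrib_left)

lemma hdual_zero: "0 \<in> hdual n"
  by (simp add: hdual_def zero_prod_def)

lemma hdual_diff: "v \<in> hdual n \<Longrightarrow> w \<in> hdual n \<Longrightarrow> v - w \<in> hdual n"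
  by (auto simp: hdual_def sum_subtractf)

lemma hdual_sum: "(\<And>i. i \<in> I \<Longrightarrow> f i \<in> hdual n) \<Longrightarrow> sum f I \<in> hdual n"
  by (induction I rule: infinite_finite_induct) (auto simp: hdual_zero hdual_add)

lemma rho_in_hdual:
  assumes "n \<ge> 2"
  shows "rho n \<in> hdual n"
  unfolding rho_def
proof (rule hdual_sum)
  fix i assume "i \<in> {..<n}"
  then show "omega n i \<in> hdual n"
    using theI'[OF omega_ex1[OF assms, of i]] by (simp add: omega_def)
qed

definition residue :: "nat \<Rightarrow> int \<Rightarrow> nat" where
  "residue n j = nat ((j - 1) mod int n) + 1"

text \<open>
  The family \<open>E\<^sub>l\<close> extends \<open>\<epsilon>\<^sub>1, \<dots>, \<epsilon>\<^sub>n\<close> by \<open>E\<^bsub>l+n\<^esub> = E\<^sub>l - \<delta>\<close>. With this choice \<open>\<alpha>\<^sub>l = E\<^sub>l - E\<^bsub>l+1\<^esub>\<close> holds for all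
  integers \<open>l\<close>, and the positive real roots are the differences \<open>E\<^sub>l - E\<^sub>r\<close> with \<open>l < r\<close> incongruent.
\<close>

definition ext_eps :: "nat \<Rightarrow> int \<Rightarrow> weight" where
  "ext_eps n j = eps (residue n j) - wscale (of_int ((j - 1) div int n)) delta"

definition coord :: "nat \<Rightarrow> weight \<Rightarrow> int \<Rightarrow> complex" where
  "coord n v j = pairing n v (ext_eps n j)"

lemma residue_range: "n > 0 \<Longrightarrow> residue n j \<in> {1..n}"
  using pos_mod_bound[of "int n" "j - 1"] by (auto simp: residue_def nat_less_iff Suc_le_eq simp del: pos_mod_bound)

lemma residue_eq_iff:
  assumes "n > 0"
  shows "residue n i = residue n j \<longleftrightarrow> i mod int n = j mod int n"
proof -
  have "residue n i = residue n j \<longleftrightarrow> (i - 1) mod int n = (j - 1) mod int n"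
    using assms pos_mod_sign[of "int n"] by (auto simp: residue_def nat_eq_iff)
  also have "\<dots> \<longleftrightarrow> i mod int n = j mod int n"
    by (metis diff_add_cancel mod_add_left_eq mod_diff_left_eq)
  finally show ?thesis .
qed

lemma residue_of_nat: "j \<in> {1..n} \<Longrightarrow> residue n (int j) = j"
  by (auto simp: residue_def nat_diff_distrib' simp flip: of_nat_diff)

lemma residue_shift: "residue n (j + int n * k) = residue n j"
proof -
  have "(j + int n * k - 1) mod int n = (j - 1) mod int n"
    using mod_mult_self2[of "j - 1" "int n" k] by (simp only: algebra_simps)
  then show ?thesis by (simp add: residue_def)
qed

lemma int_residue: "n > 0 \<Longrightarrow> int (residue n j) = j + int n * (- ((j - 1) div int n))"
proof -
  assume n: "n > 0"
  have "int (nat ((j - 1) mod int n)) = (j - 1) mod int n" using n by simp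
  then show ?thesis by (simp add: residue_def minus_mult_div_eq_mod[symmetric])
qed

lemma ext_eps_shift: "n > 0 \<Longrightarrow> ext_eps n (j + int n * k) = ext_eps n j - wscale (of_int k) delta"
proof -
  assume n: "n > 0"
  have "(j + int n * k - 1) div int n = (j - 1) div int n + k"
    using n div_mult_self2[of "int n" "j - 1" k] by (simp add: algebra_simps)
  then show ?thesis
    unfolding ext_eps_def residue_shift by (simp add: wv.scale_left_distrib)
qed

lemma ext_eps_of_nat: "j \<in> {1..n} \<Longrightarrow> ext_eps n (int j) = eps j"
  by (simp add: ext_eps_def residue_of_nat)

lemma alpha_eq_ext_eps:
  assumes n: "n \<ge> 2"
  shows "alpha n s = ext_eps n s - ext_eps n (s + 1)"
proof -
  define r where "r = s mod int n"
  define t where "t = s div int n"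
  have s: "s = r + int n * t" by (simp add: r_def t_def)
  have r: "0 \<le> r" "r < int n" using n by (simp_all add: r_def)
  show ?thesis
  proof (cases "r = 0")
    case True
    have "ext_eps n s = ext_eps n (int n + int n * (t - 1))" using s True by (simp add: algebra_simps)
    also have "\<dots> = eps n - wscale (of_int (t - 1)) delta"
      using n by (subst ext_eps_shift) (simp_all add: ext_eps_of_nat)
    finally have 1: "ext_eps n s = eps n - wscale (of_int (t - 1)) delta" .
    have "ext_eps n (s + 1) = ext_eps n (int 1 + int n * t)" using s True by (simp add: add.commute)
    also have "\<dots> = eps 1 - wscale (of_int t) delta"
      using n ext_eps_of_nat[of 1 n] by (subst ext_eps_shift) simp_all
    finally have 2: "ext_eps n (s + 1) = eps 1 - wscale (of_int t) delta" .
    have "alpha n s = delta + eps n - eps 1" using True by (simp add: alpha_def r_def)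
    then show ?thesis unfolding 1 2 by (simp add: wv.scale_left_diff_distrib)
  next
    case False
    define m where "m = nat r"
    have m: "r = int m" "1 \<le> m" "m < n" using False r by (simp_all add: m_def)
    have "ext_eps n s = eps m - wscale (of_int t) delta"
      using n m unfolding s m(1) by (subst ext_eps_shift) (simp_all add: ext_eps_of_nat)
    moreover have "s + 1 = int (m + 1) + int n * t" using s m by simp
    then have "ext_eps n (s + 1) = eps (m + 1) - wscale (of_int t) delta"
      using n m ext_eps_shift[of n "int (m + 1)" t] ext_eps_of_nat[of "m + 1" n]
      by (simp del: of_nat_add of_nat_Suc)
    moreover have "alpha n s = eps m - eps (m + 1)" using m by (simp add: alpha_def flip: r_def)
    ultimately show ?thesis by simp
  qed
qed

lemma alpha_seg_eq:
  assumes n: "n \<ge> 2" and "l \<le> r"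
  shows "alpha_seg n l r = ext_eps n l - ext_eps n r"
  using \<open>l \<le> r\<close>
proof (induction r rule: int_ge_induct)
  case base
  then show ?case by (simp add: alpha_seg_def)
next
  case (step r)
  have "{l..<r + 1} = insert r {l..<r}" using step.hyps by auto
  then have "alpha_seg n l (r + 1) = alpha n r + alpha_seg n l r" by (simp add: alpha_seg_def)
  then show ?case using step.IH alpha_eq_ext_eps[OF n, of r] by simp
qed

lemma coord_quasi_periodic: "n > 0 \<Longrightarrow> quasi_periodic n (pairing n v delta) (coord n v)"
  by (simp add: quasi_periodic_def coord_def ext_eps_shift pairing_diff_right pairing_wscale_right)

lemma yy_diff_coord:
  assumes n: "n \<ge> 2"
  shows "yy n \<Lambda> l - yy n \<Lambda> r = coord n (\<Lambda> + rho n) l - coord n (\<Lambda> + rho n) r"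
proof -
  have *: "yy n \<Lambda> l - yy n \<Lambda> r = coord n (\<Lambda> + rho n) l - coord n (\<Lambda> + rho n) r" if "l < r" for l r
    unfolding yy_diff[OF that] using that n
    by (simp add: alpha_seg_eq coord_def pairing_diff_left pairing_commute[of n _ "\<Lambda> + rho n"] pairing_diff_right)
  consider "l < r" | "l = r" | "r < l" by linarith
  then show ?thesis
  proof cases
    case 3
    then show ?thesis using *[of r l] by (metis minus_diff_eq)
  qed (use * in auto)
qed

lemma coord_add: "coord n (v + w) j = coord n v j + coord n w j"
  by (simp add: coord_def pairing_add_left)

lemma coord_diff: "coord n (v - w) j = coord n v j - coord n w j"
  by (simp add: coord_def pairing_diff_left)

lemma coord_scale: "coord n (wscale z v) j = z * coord n v j"
  by (simp add: coord_def pairing_wscale_left)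

lemma pairing_eps:
  assumes "j \<in> {1..n}"
  shows "pairing n (c, a, b) (eps j) = c j"
  using assms by (simp add: pairing_def eps_def if_distrib cong: if_cong)

lemma pairing_delta: "pairing n (c, a, b) delta = b"
  by (simp add: pairing_def delta_def)

lemma coord_triple:
  assumes "n > 0"
  shows "coord n (c, a, b) j = c (residue n j) - of_int ((j - 1) div int n) * b"
  using residue_range[OF assms, of j]
  by (simp add: coord_def ext_eps_def pairing_diff_right pairing_wscale_right pairing_eps pairing_delta
      del: atLeastAtMost_iff)

lemma coord_ext_eps:
  assumes n: "n > 0"
  shows "coord n (ext_eps n l) j = (if j mod int n = l mod int n then 1 else 0)"
proof -
  obtain a where "ext_eps n l = (\<lambda>i. if i = residue n l then 1 else 0, a, 0)"
    by (simp add: ext_eps_def eps_def wscale_def delta_def fun_eq_iff)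
  then show ?thesis using residue_eq_iff[OF n, of j l] by (simp add: coord_triple[OF n])
qed

lemma coord_delta: "n > 0 \<Longrightarrow> coord n delta j = 0"
  by (simp add: delta_def coord_triple)

lemma ext_eps_diff_in_hdual: "n > 0 \<Longrightarrow> ext_eps n l - ext_eps n r \<in> hdual n"
proof -
  assume n: "n > 0"
  have "ext_eps n l = (\<lambda>i. if i = residue n l then 1 else 0, - of_int ((l - 1) div int n), 0)" for l
    by (simp add: ext_eps_def eps_def wscale_def delta_def fun_eq_iff)
  then show ?thesis
    using residue_range[OF n, of l] residue_range[OF n, of r]
    by (auto simp: hdual_def sum_subtractf)
qed

lemma alpha_in_hdual: "n \<ge> 2 \<Longrightarrow> alpha n s \<in> hdual n"
  using ext_eps_diff_in_hdual[of n s "s + 1"] by (simp add: alpha_eq_ext_eps)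

lemma pattern_depth_in_hdual: "n \<ge> 2 \<Longrightarrow> pattern_depth n d \<in> hdual n"
  unfolding pattern_depth_def by (intro hdual_sum hdual_scale alpha_in_hdual)

section \<open>Reflections as periodic transpositions\<close>

definition swap_index :: "nat \<Rightarrow> int \<Rightarrow> int \<Rightarrow> int \<Rightarrow> int" where
  "swap_index n l r j = (if j mod int n = l mod int n then j + (r - l)
     else if j mod int n = r mod int n then j + (l - r) else j)"

lemma congruence_cases [case_names first second neither]:
  obtains k where "j = l + int n * k" | k where "j = r + int n * k"
    | "j mod int n \<noteq> l mod int n" "j mod int n \<noteq> r mod int n"
proof -
  consider "j mod int n = l mod int n" | "j mod int n = r mod int n"
    | "j mod int n \<noteq> l mod int n" "j mod int n \<noteq> r mod int n" by blast
  then show thesis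
  proof cases
    case 1
    show thesis by (rule mod_eqE[OF 1[symmetric]]) (rule that(1))
  next
    case 2
    show thesis by (rule mod_eqE[OF 2[symmetric]]) (rule that(2))
  next
    case 3
    then show thesis by (rule that(3))
  qed
qed

lemma mod_add_diff_cong:
  fixes j l r N :: int
  assumes "j mod N = l mod N"
  shows "(j + (r - l)) mod N = r mod N"
  using mod_add_cong[OF assms, of "r - l" "r - l"] by simp

lemma swap_index_invol:
  "l mod int n \<noteq> r mod int n \<Longrightarrow> swap_index n l r (swap_index n l r j) = j"
  using mod_add_diff_cong[of j "int n" l r] mod_add_diff_cong[of j "int n" r l]
  by (auto simp: swap_index_def)

lemma swap_index_bij: "l mod int n \<noteq> r mod int n \<Longrightarrow> bij (swap_index n l r)"
  by (intro involuntory_imp_bij) (simp add: swap_index_invol)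

lemma swap_index_shift: "swap_index n l r (j + int n * k) = swap_index n l r j + int n * k"
  by (simp add: swap_index_def)

lemma swap_index_apply:
  "swap_index n l r (l + int n * k) = r + int n * k"
  "l mod int n \<noteq> r mod int n \<Longrightarrow> swap_index n l r (r + int n * k) = l + int n * k"
  "j mod int n \<noteq> l mod int n \<Longrightarrow> j mod int n \<noteq> r mod int n \<Longrightarrow> swap_index n l r j = j"
  by (simp_all add: swap_index_def)

lemma residue_swap_index:
  assumes n: "n > 0" and lr: "l mod int n \<noteq> r mod int n"
  shows "residue n (swap_index n l r j) = transpose (residue n l) (residue n r) (residue n j)"
proof (cases rule: congruence_cases[of j l n _ r])
  case (first k)
  then show ?thesis by (simp add: swap_index_apply residue_shift)
next
  case (second k)
  then show ?thesis using lr by (simp add: swap_index_apply residue_shift)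
next
  case neither
  then show ?thesis
    using residue_eq_iff[OF n, of j] by (simp add: swap_index_apply transpose_apply_other)
qed

lemma swap_index_incongruent:
  assumes n: "n > 0" and ab: "a mod int n \<noteq> b mod int n" and lr: "l mod int n \<noteq> r mod int n"
  shows "swap_index n a b l mod int n \<noteq> swap_index n a b r mod int n"
proof -
  have "residue n l \<noteq> residue n r" using lr residue_eq_iff[OF n] by simp
  then have "residue n (swap_index n a b l) \<noteq> residue n (swap_index n a b r)"
    unfolding residue_swap_index[OF n ab] using transpose_eq_iff by metis
  then show ?thesis using residue_eq_iff[OF n] by simp
qed

text \<open>
  The reflection in \<open>E\<^sub>a - E\<^sub>b\<close> permutes the family \<open>E\<close>.
\<close>

lemma ext_eps_swap_index:
  assumes n: "n > 0" and ab: "a mod int n \<noteq> b mod int n"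
  shows "ext_eps n (swap_index n a b j) =
    ext_eps n j - wscale (coord n (ext_eps n j) a - coord n (ext_eps n j) b) (ext_eps n a - ext_eps n b)"
proof (cases rule: congruence_cases[of j a n _ b])
  case (first k)
  then show ?thesis
    using ab by (simp add: swap_index_apply ext_eps_shift[OF n] coord_ext_eps[OF n] coord_diff coord_scale coord_delta[OF n])
next
  case (second k)
  then show ?thesis
    using ab by (simp add: swap_index_apply ext_eps_shift[OF n] coord_ext_eps[OF n] coord_diff coord_scale coord_delta[OF n])
next
  case neither
  then show ?thesis by (simp add: swap_index_apply coord_ext_eps[OF n])
qed

lemma pos_real_roots_eq:
  assumes n: "n \<ge> 2"
  shows "pos_real_roots n = {ext_eps n l - ext_eps n r | l r. l < r \<and> l mod int n \<noteq> r mod int n}"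
proof (intro equalityI subsetI)
  have n0: "n > 0" using n by simp
  have res: "residue n (int j + int n * m) = j" if "j \<in> {1..n}" for j m
    using that by (simp only: residue_shift residue_of_nat)
  fix \<alpha> assume "\<alpha> \<in> pos_real_roots n"
  then consider (pos) i j m where "i \<in> {1..n}" "j \<in> {1..n}" "i \<noteq> j" "m > 0"
      "\<alpha> = eps i - eps j + wscale (of_nat m) delta"
    | (zero) i j where "i \<in> {1..n}" "j \<in> {1..n}" "i < j" "\<alpha> = eps i - eps j"
    unfolding pos_real_roots_def by blast
  then obtain i j m where ij: "i \<in> {1..n}" "j \<in> {1..n}" "i \<noteq> j" "m > 0 \<or> i < j"
      "\<alpha> = eps i - eps j + wscale (of_nat m) delta"
  proof cases
    case pos then show ?thesis using that by blast
  next
    case zero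
    then show ?thesis using that[of i j 0] by simp
  qed
  let ?r = "int j + int n * int m"
  have "ext_eps n ?r = eps j - wscale (of_nat m) delta"
    using ij n0 by (subst ext_eps_shift) (simp_all add: ext_eps_of_nat)
  then have "\<alpha> = ext_eps n (int i) - ext_eps n ?r" using ij by (simp add: ext_eps_of_nat)
  moreover have "int i < ?r"
  proof (cases "m > 0")
    case True
    then have "int n * int m \<ge> int n * 1" by (intro mult_left_mono) auto
    moreover have "int i \<le> int n" "int j \<ge> 1" using ij(1,2) by simp_all
    ultimately show ?thesis by linarith
  next
    case False
    then show ?thesis using ij(4) by simp
  qed
  moreover have "int i mod int n \<noteq> ?r mod int n"
    using residue_eq_iff[OF n0, of "int i" ?r] res[OF ij(2)] residue_of_nat[OF ij(1)] ij(3) by simp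
  ultimately show "\<alpha> \<in> {ext_eps n l - ext_eps n r | l r. l < r \<and> l mod int n \<noteq> r mod int n}" by blast
next
  have n0: "n > 0" using n by simp
  fix \<alpha> assume "\<alpha> \<in> {ext_eps n l - ext_eps n r | l r. l < r \<and> l mod int n \<noteq> r mod int n}"
  then obtain l r where lr: "\<alpha> = ext_eps n l - ext_eps n r" "l < r" "l mod int n \<noteq> r mod int n" by blast
  define i where "i = residue n l"
  define j where "j = residue n r"
  define s where "s = (l - 1) div int n"
  define t where "t = (r - 1) div int n"
  have ij: "i \<in> {1..n}" "j \<in> {1..n}" "i \<noteq> j"
    using residue_range[OF n0] residue_eq_iff[OF n0, of l r] lr(3) by (simp_all add: i_def j_def del: atLeastAtMost_iff)
  have st: "s \<le> t" using lr(2) n0 by (simp add: s_def t_def zdiv_mono1)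
  have "int i = (l - 1) mod int n + 1" "int j = (r - 1) mod int n + 1"
    using n0 by (simp_all add: i_def j_def residue_def)
  then have l: "l = int i + int n * s" and r: "r = int j + int n * t"
    by (simp_all add: s_def t_def)
  have "\<alpha> = eps i - eps j + wscale (of_int (t - s)) delta"
    by (simp add: lr(1) ext_eps_def wv.scale_left_diff_distrib flip: i_def j_def s_def t_def)
  also have "(of_int (t - s) :: complex) = of_nat (nat (t - s))" using st by simp
  finally have \<alpha>: "\<alpha> = eps i - eps j + wscale (of_nat (nat (t - s))) delta" .
  show "\<alpha> \<in> pos_real_roots n"
  proof (cases "s = t")
    case True
    then have "i < j" using l r lr(2) by simp
    moreover have "\<alpha> = eps i - eps j" using \<alpha> True by simp
    ultimately show ?thesis using ij unfolding pos_real_roots_def by blast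
  next
    case False
    then have "nat (t - s) > 0" using st by simp
    then show ?thesis using \<alpha> ij unfolding pos_real_roots_def by blast
  qed
qed

lemma refl_ext_eps:
  assumes n: "n > 0" and lr: "l mod int n \<noteq> r mod int n" and v: "v \<in> hdual n"
  shows "refl n (ext_eps n l - ext_eps n r) v
    = v - wscale (coord n v l - coord n v r) (ext_eps n l - ext_eps n r)"
proof -
  have "pairing n (ext_eps n l - ext_eps n r) (ext_eps n l - ext_eps n r) = 2"
    using lr by (simp add: pairing_diff_right coord_ext_eps[OF n] coord_diff flip: coord_def)
  moreover have "pairing n v (ext_eps n l - ext_eps n r) = coord n v l - coord n v r"
    by (simp add: pairing_diff_right coord_def)
  ultimately show ?thesis using v by (simp add: refl_def)
qed

lemma refl_in_hdual:
  assumes n: "n > 0" and lr: "l mod int n \<noteq> r mod int n" and v: "v \<in> hdual n"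
  shows "refl n (ext_eps n l - ext_eps n r) v \<in> hdual n"
  unfolding refl_ext_eps[OF assms] using v by (intro hdual_diff hdual_scale ext_eps_diff_in_hdual n)

lemma coord_refl:
  assumes n: "n > 0" and lr: "l mod int n \<noteq> r mod int n" and v: "v \<in> hdual n"
  shows "coord n (refl n (ext_eps n l - ext_eps n r) v) j = coord n v (swap_index n l r j)"
proof -
  have "coord n v (swap_index n l r j) = coord n v j -
      (coord n (ext_eps n j) l - coord n (ext_eps n j) r) * (coord n v l - coord n v r)"
    unfolding coord_def[of n v] ext_eps_swap_index[OF n lr] pairing_diff_right pairing_wscale_right ..
  then show ?thesis
    unfolding refl_ext_eps[OF assms] coord_diff coord_scale
    by (simp add: coord_ext_eps[OF n] mult.commute eq_commute[of "j mod int n"])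
qed

lemma pairing_refl:
  assumes n: "n > 0" and lr: "l mod int n \<noteq> r mod int n" and v: "v \<in> hdual n"
  shows "pairing n (refl n (ext_eps n l - ext_eps n r) v) (refl n (ext_eps n l - ext_eps n r) v)
    = pairing n v v"
proof -
  let ?\<alpha> = "ext_eps n l - ext_eps n r"
  have "pairing n ?\<alpha> ?\<alpha> = 2"
    using lr by (simp add: pairing_diff_right coord_ext_eps[OF n] coord_diff flip: coord_def)
  moreover define z where "z = coord n v l - coord n v r"
  then have "pairing n v ?\<alpha> = z" "pairing n ?\<alpha> v = z"
    by (simp_all add: pairing_diff_right coord_def pairing_commute[of n _ v])
  ultimately show ?thesis
    unfolding refl_ext_eps[OF assms] z_def[symmetric] pairing_diff_left[of n v] pairing_diff_right[of n _ v]
      pairing_wscale_left pairing_wscale_right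
    by simp
qed

lemma refl_add:
  assumes n: "n > 0" and lr: "l mod int n \<noteq> r mod int n" and v: "v \<in> hdual n" "w \<in> hdual n"
  shows "refl n (ext_eps n l - ext_eps n r) (v + w)
    = refl n (ext_eps n l - ext_eps n r) v + refl n (ext_eps n l - ext_eps n r) w"
proof -
  let ?\<alpha> = "ext_eps n l - ext_eps n r"
  have "coord n (v + w) l - coord n (v + w) r = (coord n v l - coord n v r) + (coord n w l - coord n w r)"
    by (simp add: coord_add)
  then show ?thesis
    unfolding refl_ext_eps[OF n lr v(1)] refl_ext_eps[OF n lr v(2)] refl_ext_eps[OF n lr hdual_add[OF v]]
    by (simp only: wv.scale_left_distrib add_diff_add)
qed

text \<open>
  The coordinates determine a weight up to its coefficient of \<open>\<delta>\<close>. At nonzero level the norm depends on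
  this coefficient by a nonzero linear term.
\<close>

lemma weight_eqI:
  assumes n: "n > 0" and v: "v \<in> hdual n" and w: "w \<in> hdual n"
    and coord: "coord n v = coord n w" and norm: "pairing n v v = pairing n w w"
    and level: "pairing n v delta \<noteq> 0"
  shows "v = w"
proof -
  obtain c a b where v_eq: "v = (c, a, b)" by (rule prod_cases3)
  obtain c' a' b' where w_eq: "w = (c', a', b')" by (rule prod_cases3)
  have "coord n v (1 + int n * 1) = coord n v 1 - b" "coord n w (1 + int n * 1) = coord n w 1 - b'"
    unfolding quasi_periodicD[OF coord_quasi_periodic[OF n]] unfolding v_eq w_eq pairing_delta by simp_all
  then have b: "b = b'" unfolding coord by simp
  have c: "c i = c' i" for i
  proof (cases "i \<in> {1..n}")
    case True
    then have "coord n v (int i) = c i" "coord n w (int i) = c' i"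
      unfolding v_eq w_eq coord_triple[OF n] residue_of_nat[OF True] by simp_all
    then show ?thesis unfolding coord by simp
  next
    case False
    then show ?thesis using v w unfolding v_eq w_eq hdual_def by simp
  qed
  have "b \<noteq> 0" using level unfolding v_eq pairing_delta .
  moreover have "2 * a * b = 2 * a' * b"
    using norm unfolding v_eq w_eq pairing_def by (simp add: b c)
  ultimately have "a = a'" by simp
  moreover have "c = c'" using c by (rule ext)
  ultimately show ?thesis unfolding v_eq w_eq b by simp
qed

lemma refl_refl:
  assumes n: "n > 0" and lr: "l mod int n \<noteq> r mod int n" and v: "v \<in> hdual n"
  shows "refl n (ext_eps n l - ext_eps n r) (refl n (ext_eps n l - ext_eps n r) v) = v"
proof -
  let ?\<alpha> = "ext_eps n l - ext_eps n r"
  let ?u = "refl n ?\<alpha> v"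
  have "swap_index n l r l = r" "swap_index n l r r = l"
    using lr by (simp_all add: swap_index_def)
  then have "coord n ?u l = coord n v r" "coord n ?u r = coord n v l"
    by (simp_all only: coord_refl[OF assms])
  then have "refl n ?\<alpha> ?u = ?u - wscale (coord n v r - coord n v l) ?\<alpha>"
    using refl_ext_eps[OF n lr refl_in_hdual[OF assms]] by simp
  also have "\<dots> = v - (wscale (coord n v l - coord n v r) ?\<alpha> + wscale (coord n v r - coord n v l) ?\<alpha>)"
    unfolding refl_ext_eps[OF assms] by (rule diff_diff_eq)
  also have "wscale (coord n v l - coord n v r) ?\<alpha> + wscale (coord n v r - coord n v l) ?\<alpha> = 0"
    unfolding wv.scale_left_distrib[symmetric] by simp
  finally show ?thesis by simp
qed

lemma refl_in_Bij:
  assumes n: "n > 0" and lr: "l mod int n \<noteq> r mod int n"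
  shows "refl n (ext_eps n l - ext_eps n r) \<in> Bij (hdual n)"
proof -
  let ?s = "refl n (ext_eps n l - ext_eps n r)"
  have "bij_betw ?s (hdual n) (hdual n)"
    by (rule bij_betw_byWitness[where f' = ?s]) (use refl_refl[OF assms] refl_in_hdual[OF assms] in blast)+
  moreover have "?s \<in> extensional (hdual n)" unfolding refl_def by (rule restrict_extensional)
  ultimately show ?thesis by (simp add: Bij_def)
qed

section \<open>Products of integral reflections\<close>

abbreviation reflect :: "nat \<Rightarrow> int \<Rightarrow> int \<Rightarrow> weight \<Rightarrow> weight" where
  "reflect n l r \<equiv> refl n (ext_eps n l - ext_eps n r)"

abbreviation word_prod :: "nat \<Rightarrow> (weight \<Rightarrow> weight) list \<Rightarrow> weight \<Rightarrow> weight" where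
  "word_prod n ss \<equiv> foldr (\<lambda>s t. s \<otimes>\<^bsub>BijGroup (hdual n)\<^esub> t) ss \<one>\<^bsub>BijGroup (hdual n)\<^esub>"

lemma BijGroup_mult_apply:
  "s \<in> Bij S \<Longrightarrow> t \<in> Bij S \<Longrightarrow> x \<in> S \<Longrightarrow> (s \<otimes>\<^bsub>BijGroup S\<^esub> t) x = s (t x)"
  by (simp add: BijGroup_def compose_def)

lemma BijGroup_one_apply: "x \<in> S \<Longrightarrow> \<one>\<^bsub>BijGroup S\<^esub> x = x"
  by (simp add: BijGroup_def)

definition lattice_weights :: "weight set" where
  "lattice_weights = {(c, a, b). (\<forall>i. c i \<in> \<int>) \<and> a \<in> \<int> \<and> b = 0}"

lemma lattice_weights_diff: "v \<in> lattice_weights \<Longrightarrow> w \<in> lattice_weights \<Longrightarrow> v - w \<in> lattice_weights"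
  by (auto simp: lattice_weights_def)

lemma lattice_weights_zero: "0 \<in> lattice_weights"
  by (auto simp: lattice_weights_def zero_prod_def)

lemma lattice_weights_scale: "z \<in> \<int> \<Longrightarrow> v \<in> lattice_weights \<Longrightarrow> wscale z v \<in> lattice_weights"
  by (auto simp: lattice_weights_def wscale_def)

lemma ext_eps_in_lattice: "ext_eps n l \<in> lattice_weights"
  by (auto simp: lattice_weights_def ext_eps_def eps_def wscale_def delta_def)

lemma coord_lattice:
  assumes "n > 0" "v \<in> lattice_weights"
  shows "coord n v j \<in> \<int>" "coord n v (j + int n * k) = coord n v j"
proof -
  obtain c a where "v = (c, a, 0)" "\<And>i. c i \<in> \<int>" using assms(2) by (auto simp: lattice_weights_def)
  then show "coord n v j \<in> \<int>" "coord n v (j + int n * k) = coord n v j"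
    by (simp_all add: coord_triple[OF assms(1)] residue_shift)
qed

lemma coord_zero: "coord n 0 j = 0"
  using coord_diff[of n 0 0 j] by simp

locale dominant_weight =
  fixes n :: nat and \<Lambda> :: weight
  assumes n: "n \<ge> 2" and dominant: "dominant n \<Lambda>" and level: "Re (kappa n \<Lambda>) > 0"
begin

definition v0 :: weight where "v0 = \<Lambda> + rho n"

abbreviation y :: "int \<Rightarrow> complex" where "y \<equiv> coord n v0"
abbreviation \<kappa> :: complex where "\<kappa> \<equiv> kappa n \<Lambda>"

lemma n0: "n > 0"
  using n by simp

lemma v0_in: "v0 \<in> hdual n"
  using dominant rho_in_hdual[OF n] by (simp add: v0_def dominant_def hdual_add)

lemma level_v0: "pairing n v0 delta = \<kappa>"
  by (simp add: v0_def kappa_def)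

lemma kappa_nz: "\<kappa> \<noteq> 0"
  using level by auto

lemma y_periodic: "quasi_periodic n \<kappa> y"
  using coord_quasi_periodic[OF n0, of v0] by (simp add: level_v0)

lemma y_shift: "y (j + int n * k) = y j - of_int k * \<kappa>"
  by (rule quasi_periodicD[OF y_periodic])

text \<open>
  For congruent indices the difference is a positive multiple of \<open>\<kappa>\<close>; for incongruent ones this is
  dominance.
\<close>

lemma y_decreasing:
  assumes lr: "l < r" and m: "y l - y r = of_int m"
  shows "m > 0"
proof (cases "l mod int n = r mod int n")
  case True
  obtain k where k: "r = l + int n * k" by (rule mod_eqE[OF True])
  then have "int n * k > 0" using lr by simp
  then have "k > 0" using n0 zero_less_mult_pos[of "int n" k] by simp
  have "of_int k * \<kappa> = of_int m" using m unfolding k y_shift by simp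
  then have "Re (of_int k * \<kappa>) = Re (of_int m)" by (rule arg_cong)
  then have "real_of_int m = real_of_int k * Re \<kappa>" by simp
  moreover have "real_of_int k * Re \<kappa> > 0" using \<open>k > 0\<close> level by simp
  ultimately show ?thesis by linarith
next
  case False
  then have "ext_eps n l - ext_eps n r \<in> pos_real_roots n"
    unfolding pos_real_roots_eq[OF n] using lr by blast
  then have "ext_eps n l - ext_eps n r \<in> pos_roots n"
    unfolding pos_roots_def by (rule UnI1)
  then have "pairing n v0 (ext_eps n l - ext_eps n r) \<notin> \<int>\<^sub>\<le>\<^sub>0"
    using dominant by (simp add: dominant_def v0_def)
  moreover have "pairing n v0 (ext_eps n l - ext_eps n r) = of_int m"
    unfolding m[symmetric] coord_def by (rule pairing_diff_right)
  ultimately have "of_int m \<notin> (\<int>\<^sub>\<le>\<^sub>0 :: complex set)" by simp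
  moreover have "of_int m \<in> (\<int>\<^sub>\<le>\<^sub>0 :: complex set)" if "m \<le> 0"
    using that by (rule nonpos_Ints_of_int)
  ultimately show ?thesis by force
qed

lemma y_eq_iff: "y i = y j \<longleftrightarrow> i = j"
proof
  assume eq: "y i = y j"
  show "i = j"
  proof (rule ccontr)
    assume "i \<noteq> j"
    then consider "i < j" | "j < i" by linarith
    then show False
    proof cases
      case 1
      show False using y_decreasing[OF 1, of 0] eq by simp
    next
      case 2
      show False using y_decreasing[OF 2, of 0] eq by simp
    qed
  qed
qed simp

definition linked :: "int \<Rightarrow> int \<Rightarrow> bool" where
  "linked l r \<longleftrightarrow> y l - y r \<in> \<int>"

lemma linked_sym: "linked l r \<longleftrightarrow> linked r l"
  using Ints_minus[of "y l - y r"] Ints_minus[of "y r - y l"] by (auto simp: linked_def)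

lemma linked_trans: "linked a b \<Longrightarrow> linked b c \<Longrightarrow> linked a c"
  unfolding linked_def using Ints_add[of "y a - y b" "y b - y c"] by simp

lemma linked_cong: "linked a b \<Longrightarrow> linked a x \<longleftrightarrow> linked b x"
  using linked_trans[of a b x] linked_trans[of b a x] linked_sym[of a b] by auto

lemma linked_shift: "linked (l + int n * k) (r + int n * k) \<longleftrightarrow> linked l r"
  by (simp add: linked_def y_shift)

lemma int_roots_eq:
  "int_roots n \<Lambda> = {ext_eps n l - ext_eps n r | l r. l < r \<and> l mod int n \<noteq> r mod int n \<and> linked l r}"
proof -
  have "pairing n (ext_eps n l - ext_eps n r) (\<Lambda> + rho n) = y l - y r" for l r
    by (simp add: pairing_commute[of n _ "\<Lambda> + rho n"] pairing_diff_right coord_def v0_def)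
  then have "pairing n \<alpha> (\<Lambda> + rho n) \<in> \<int> \<longleftrightarrow> linked l r" if "\<alpha> = ext_eps n l - ext_eps n r" for \<alpha> l r
    by (simp add: that linked_def)
  then show ?thesis
    unfolding int_roots_def pos_real_roots_eq[OF n] by blast
qed

lemma int_reflE:
  assumes "s \<in> refl n ` int_roots n \<Lambda>"
  obtains l r where "s = reflect n l r" "l < r" "l mod int n \<noteq> r mod int n" "linked l r"
  using assms unfolding int_roots_eq by blast

lemma reflect_sym:
  assumes "l mod int n \<noteq> r mod int n"
  shows "reflect n l r = reflect n r l"
proof (rule ext)
  fix v
  show "reflect n l r v = reflect n r l v"
  proof (cases "v \<in> hdual n")
    case True
    have "wscale (coord n v r - coord n v l) (ext_eps n r - ext_eps n l) =
        wscale (- (coord n v l - coord n v r)) (- (ext_eps n l - ext_eps n r))"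
      by (simp only: minus_diff_eq)
    also have "\<dots> = wscale (coord n v l - coord n v r) (ext_eps n l - ext_eps n r)"
      by (simp only: wv.scale_minus_left wv.scale_minus_right minus_minus)
    finally show ?thesis
      unfolding refl_ext_eps[OF n0 assms True] refl_ext_eps[OF n0 assms[symmetric] True] by simp
  next
    case False
    then show ?thesis by (simp add: refl_def)
  qed
qed

lemma int_reflI:
  assumes "l \<noteq> r" "l mod int n \<noteq> r mod int n" "linked l r"
  shows "reflect n l r \<in> refl n ` int_roots n \<Lambda>"
proof (cases "l < r")
  case True
  then show ?thesis using assms unfolding int_roots_eq by blast
next
  case False
  then have "r < l" "linked r l" using assms linked_sym by auto
  then have "ext_eps n r - ext_eps n l \<in> int_roots n \<Lambda>"
    unfolding int_roots_eq using assms(2)[symmetric] by blast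
  then show ?thesis unfolding reflect_sym[OF assms(2)] by (rule imageI)
qed

lemma word_headE:
  assumes "set (s # ss) \<subseteq> refl n ` int_roots n \<Lambda>"
  obtains l r where "s = reflect n l r" "l < r" "l mod int n \<noteq> r mod int n" "linked l r"
proof -
  have "s \<in> refl n ` int_roots n \<Lambda>" using assms by simp
  then show thesis by (rule int_reflE) (rule that)
qed

lemma one_in_Bij: "\<one>\<^bsub>BijGroup S\<^esub> \<in> Bij S"
proof -
  have "\<one>\<^bsub>BijGroup S\<^esub> \<in> carrier (BijGroup S)"
    using group_BijGroup by (intro monoid.one_closed group.is_monoid)
  then show ?thesis by (simp add: BijGroup_def)
qed

lemma mult_in_Bij: "s \<in> Bij S \<Longrightarrow> t \<in> Bij S \<Longrightarrow> s \<otimes>\<^bsub>BijGroup S\<^esub> t \<in> Bij S"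
  by (simp add: BijGroup_def compose_Bij)

lemma word_in_Bij: "set ss \<subseteq> refl n ` int_roots n \<Lambda> \<Longrightarrow> word_prod n ss \<in> Bij (hdual n)"
proof (induction ss)
  case Nil
  then show ?case by (simp add: one_in_Bij)
next
  case (Cons s ss)
  obtain l r where "s = reflect n l r" "l mod int n \<noteq> r mod int n"
    using word_headE[OF Cons.prems] by blast
  then have "s \<in> Bij (hdual n)" using refl_in_Bij[OF n0] by simp
  with Cons show ?case by (simp add: mult_in_Bij)
qed

lemma word_Cons:
  assumes "set (s # ss) \<subseteq> refl n ` int_roots n \<Lambda>" "v \<in> hdual n"
  shows "word_prod n (s # ss) v = s (word_prod n ss v)" "word_prod n ss v \<in> hdual n"
proof -
  have in_Bij: "word_prod n ss \<in> Bij (hdual n)" using assms by (intro word_in_Bij) simp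
  obtain l r where "s = reflect n l r" "l mod int n \<noteq> r mod int n" using word_headE[OF assms(1)] by blast
  then have "s \<in> Bij (hdual n)" using refl_in_Bij[OF n0] by simp
  with in_Bij assms(2) show "word_prod n (s # ss) v = s (word_prod n ss v)"
    by (simp add: BijGroup_mult_apply)
  show "word_prod n ss v \<in> hdual n" using in_Bij assms(2) Bij_imp_funcset by blast
qed

lemma word_additive:
  assumes "set ss \<subseteq> refl n ` int_roots n \<Lambda>" "v \<in> hdual n" "w \<in> hdual n"
  shows "word_prod n ss (v + w) = word_prod n ss v + word_prod n ss w"
  using assms(1)
proof (induction ss)
  case Nil
  then show ?case using assms(2,3) by (simp add: BijGroup_one_apply hdual_add)
next
  case (Cons s ss)
  obtain l r where lr: "s = reflect n l r" "l mod int n \<noteq> r mod int n" using word_headE[OF Cons.prems] by blast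
  show ?case
    unfolding word_Cons(1)[OF Cons.prems assms(2)] word_Cons(1)[OF Cons.prems assms(3)]
      word_Cons(1)[OF Cons.prems hdual_add[OF assms(2,3)]]
    unfolding lr(1)
    using Cons refl_add[OF n0 lr(2) word_Cons(2)[OF Cons.prems assms(2)] word_Cons(2)[OF Cons.prems assms(3)]]
    by simp
qed

lemma word_norm:
  assumes "set ss \<subseteq> refl n ` int_roots n \<Lambda>" "v \<in> hdual n"
  shows "pairing n (word_prod n ss v) (word_prod n ss v) = pairing n v v"
  using assms(1)
proof (induction ss)
  case Nil
  then show ?case using assms(2) by (simp add: BijGroup_one_apply)
next
  case (Cons s ss)
  obtain l r where lr: "s = reflect n l r" "l mod int n \<noteq> r mod int n" using word_headE[OF Cons.prems] by blast
  show ?case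
    unfolding word_Cons(1)[OF Cons.prems assms(2)] unfolding lr(1)
    using Cons pairing_refl[OF n0 lr(2) word_Cons(2)[OF Cons.prems assms(2)]] by simp
qed

text \<open>
  Coordinates are permuted contravariantly, so \<open>\<sigma>\<close> is composed in the opposite order. The permutation
  \<open>p\<close> of the residues is a product of one transposition for each letter; it carries the sign.
\<close>

lemma word_permutes:
  assumes "set ss \<subseteq> refl n ` int_roots n \<Lambda>"
  shows "\<exists>\<sigma> p. bij \<sigma> \<and> (\<forall>v\<in>hdual n. coord n (word_prod n ss v) = coord n v \<circ> \<sigma>) \<and>
    swapidseq (length ss) p \<and> (\<forall>j. residue n (\<sigma> j) = p (residue n j)) \<and> (\<forall>i. i \<notin> {1..n} \<longrightarrow> p i = i)"
  using assms
proof (induction ss)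
  case Nil
  show ?case
  proof (intro exI[of _ "id :: int \<Rightarrow> int"] exI[of _ "id :: nat \<Rightarrow> nat"] conjI ballI allI impI)
    show "bij (id :: int \<Rightarrow> int)" by (rule bij_id)
    show "swapidseq (length []) id" by simp
  qed (simp_all add: BijGroup_one_apply)
next
  case (Cons s ss)
  obtain l r where lr: "s = reflect n l r" "l mod int n \<noteq> r mod int n" using word_headE[OF Cons.prems] by blast
  have "set ss \<subseteq> refl n ` int_roots n \<Lambda>" using Cons.prems by simp
  from Cons.IH[OF this] obtain \<sigma> p where IH: "bij \<sigma>" "\<And>v. v \<in> hdual n \<Longrightarrow> coord n (word_prod n ss v) = coord n v \<circ> \<sigma>"
    "swapidseq (length ss) p" "\<And>j. residue n (\<sigma> j) = p (residue n j)" "\<And>i. i \<notin> {1..n} \<Longrightarrow> p i = i"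
    by blast
  let ?\<tau> = "swap_index n l r"
  let ?t = "transpose (residue n l) (residue n r)"
  have neq: "residue n l \<noteq> residue n r" using lr(2) residue_eq_iff[OF n0] by simp
  show ?case
  proof (intro exI[of _ "\<sigma> \<circ> ?\<tau>"] exI[of _ "p \<circ> ?t"] conjI ballI allI impI)
    show "bij (\<sigma> \<circ> ?\<tau>)" using IH(1) swap_index_bij[OF lr(2)] by (rule bij_comp[rotated])
    show "swapidseq (length (s # ss)) (p \<circ> ?t)" using swapidseq_endswap[OF IH(3) neq] by simp
    fix j show "residue n ((\<sigma> \<circ> ?\<tau>) j) = (p \<circ> ?t) (residue n j)"
      by (simp add: IH(4) residue_swap_index[OF n0 lr(2)])
  next
    fix i assume i: "i \<notin> {1..n}"
    then have "?t i = i" using residue_range[OF n0] by (metis transpose_apply_other)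
    then show "(p \<circ> ?t) i = i" using IH(5)[OF i] by simp
  next
    fix v assume v: "v \<in> hdual n"
    show "coord n (word_prod n (s # ss) v) = coord n v \<circ> (\<sigma> \<circ> ?\<tau>)"
    proof
      fix j
      show "coord n (word_prod n (s # ss) v) j = (coord n v \<circ> (\<sigma> \<circ> ?\<tau>)) j"
        unfolding word_Cons(1)[OF Cons.prems v] unfolding lr(1) coord_refl[OF n0 lr(2) word_Cons(2)[OF Cons.prems v]]
        using IH(2)[OF v] by simp
    qed
  qed
qed

text \<open>
  As \<open>y\<close> is injective, the image of \<open>\<Lambda> + \<rho>\<close> determines \<open>\<sigma>\<close>, hence \<open>p\<close> and its parity.
\<close>

lemma word_length_parity:
  assumes ss: "set ss \<subseteq> refl n ` int_roots n \<Lambda>" and ts: "set ts \<subseteq> refl n ` int_roots n \<Lambda>"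
    and eq: "word_prod n ss = word_prod n ts"
  shows "even (length ss) = even (length ts)"
proof -
  obtain \<sigma> p where \<sigma>: "coord n (word_prod n ss v0) = y \<circ> \<sigma>" "swapidseq (length ss) p"
    "\<And>j. residue n (\<sigma> j) = p (residue n j)" "\<And>i. i \<notin> {1..n} \<Longrightarrow> p i = i"
    using word_permutes[OF ss] v0_in by blast
  obtain \<sigma>' p' where \<sigma>': "coord n (word_prod n ts v0) = y \<circ> \<sigma>'" "swapidseq (length ts) p'"
    "\<And>j. residue n (\<sigma>' j) = p' (residue n j)" "\<And>i. i \<notin> {1..n} \<Longrightarrow> p' i = i"
    using word_permutes[OF ts] v0_in by blast
  have "y (\<sigma> j) = y (\<sigma>' j)" for j using \<sigma>(1) \<sigma>'(1) eq by (metis comp_apply)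
  then have eq': "\<sigma> j = \<sigma>' j" for j using y_eq_iff by simp
  have "p i = p' i" for i
  proof (cases "i \<in> {1..n}")
    case True
    then show ?thesis using \<sigma>(3)[of "int i"] \<sigma>'(3)[of "int i"] eq'[of "int i"] by (simp add: residue_of_nat)
  next
    case False
    then show ?thesis using \<sigma>(4) \<sigma>'(4) by simp
  qed
  then have "p = p'" by blast
  then show ?thesis using swapidseq_even_even[OF \<sigma>(2)] \<sigma>'(2) by blast
qed

lemma orbit_in_lattice:
  assumes "set ss \<subseteq> refl n ` int_roots n \<Lambda>"
  shows "word_prod n ss v0 - v0 \<in> lattice_weights"
  using assms
proof (induction ss)
  case Nil
  show ?case using v0_in by (simp add: BijGroup_one_apply lattice_weights_zero)
next
  case (Cons s ss)
  obtain l r where lr: "s = reflect n l r" "l mod int n \<noteq> r mod int n" "linked l r"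
    using word_headE[OF Cons.prems] by blast
  let ?u = "word_prod n ss v0"
  have IH: "?u - v0 \<in> lattice_weights" using Cons by simp
  have "coord n ?u l - coord n ?u r = (coord n (?u - v0) l - coord n (?u - v0) r) + (y l - y r)"
    by (simp add: coord_diff)
  also have "\<dots> \<in> \<int>"
    using coord_lattice(1)[OF n0 IH] lr(3) unfolding linked_def
    by (intro Ints_add[OF Ints_diff])
  finally have z: "coord n ?u l - coord n ?u r \<in> \<int>" .
  have eq: "word_prod n (s # ss) v0 - v0 =
      (?u - v0) - wscale (coord n ?u l - coord n ?u r) (ext_eps n l - ext_eps n r)"
    unfolding word_Cons(1)[OF Cons.prems v0_in] unfolding lr(1)
      refl_ext_eps[OF n0 lr(2) word_Cons(2)[OF Cons.prems v0_in]] by (simp add: diff_diff_eq add.commute)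
  show ?case
    unfolding eq using lattice_weights_diff[OF ext_eps_in_lattice ext_eps_in_lattice]
    by (intro lattice_weights_diff[OF IH] lattice_weights_scale[OF z])
qed

text \<open>
  The residues of the indices that become linked to \<open>x\<close> after a translation by some multiple of the
  period. Integral reflections act separately on these classes.
\<close>

definition link_class :: "int \<Rightarrow> nat set" where
  "link_class x = {j \<in> {1..n}. \<exists>k. linked (int j + int n * k) x}"

lemma residue_in_link_class: "residue n j \<in> link_class x \<longleftrightarrow> (\<exists>k. linked (j + int n * k) x)"
proof -
  note j = int_residue[OF n0, of j]
  have "(\<exists>k. linked (int (residue n j) + int n * k) x) \<longleftrightarrow> (\<exists>k. linked (j + int n * k) x)"
  proof
    assume "\<exists>k. linked (int (residue n j) + int n * k) x"
    then obtain k where "linked (j + int n * (k - (j - 1) div int n)) x"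
      unfolding j by (auto simp: algebra_simps)
    then show "\<exists>k. linked (j + int n * k) x" ..
  next
    assume "\<exists>k. linked (j + int n * k) x"
    then obtain k where "linked (j + int n * k) x" ..
    then have "linked (int (residue n j) + int n * (k + (j - 1) div int n)) x"
      unfolding j by (simp add: algebra_simps)
    then show "\<exists>k. linked (int (residue n j) + int n * k) x" ..
  qed
  then show ?thesis using residue_range[OF n0, of j] by (simp add: link_class_def)
qed

lemma link_class_cong:
  assumes "linked l r"
  shows "residue n l \<in> link_class x \<longleftrightarrow> residue n r \<in> link_class x"
proof -
  have "linked (l + int n * k) x \<longleftrightarrow> linked (r + int n * k) x" for k
    using assms by (intro linked_cong) (simp add: linked_shift)
  then show ?thesis unfolding residue_in_link_class by blast
qed

lemma class_sum_ext_eps: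
  assumes "linked l r"
  shows "(\<Sum>j\<in>link_class x. coord n (ext_eps n l - ext_eps n r) (int j)) = 0"
proof -
  have "coord n (ext_eps n l) (int j) = (if j = residue n l then 1 else 0)" if "j \<in> {1..n}" for j l
    using residue_eq_iff[OF n0, of "int j" l] that by (simp add: coord_ext_eps[OF n0] residue_of_nat)
  moreover have "link_class x \<subseteq> {1..n}" by (auto simp: link_class_def)
  ultimately have "(\<Sum>j\<in>link_class x. coord n (ext_eps n l - ext_eps n r) (int j)) =
      (\<Sum>j\<in>link_class x. (if j = residue n l then 1 else 0) - (if j = residue n r then 1 else 0))"
    by (intro sum.cong refl) (auto simp: coord_diff)
  also have "\<dots> = 0"
    using link_class_cong[OF assms, of x] by (simp add: sum_subtractf link_class_def)
  finally show ?thesis .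
qed

text \<open>
  A reflection changes two coordinates of the same class by opposite amounts. This invariant excludes a
  common shift of all indices of a class, which would preserve their order.
\<close>

lemma orbit_class_sum:
  assumes "set ss \<subseteq> refl n ` int_roots n \<Lambda>"
  shows "(\<Sum>j\<in>link_class x. coord n (word_prod n ss v0 - v0) (int j)) = 0"
  using assms
proof (induction ss)
  case Nil
  show ?case using v0_in by (simp add: BijGroup_one_apply coord_zero)
next
  case (Cons s ss)
  obtain l r where lr: "s = reflect n l r" "l mod int n \<noteq> r mod int n" "linked l r"
    using word_headE[OF Cons.prems] by blast
  let ?u = "word_prod n ss v0"
  let ?z = "coord n ?u l - coord n ?u r"
  have "word_prod n (s # ss) v0 - v0 = (?u - v0) - wscale ?z (ext_eps n l - ext_eps n r)"
    unfolding word_Cons(1)[OF Cons.prems v0_in] unfolding lr(1)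
      refl_ext_eps[OF n0 lr(2) word_Cons(2)[OF Cons.prems v0_in]] by (simp add: diff_diff_eq add.commute)
  then have "(\<Sum>j\<in>link_class x. coord n (word_prod n (s # ss) v0 - v0) (int j)) =
     (\<Sum>j\<in>link_class x. coord n (?u - v0) (int j)) -
     ?z * (\<Sum>j\<in>link_class x. coord n (ext_eps n l - ext_eps n r) (int j))"
    by (simp only: coord_diff[of n "?u - v0"] coord_scale sum_subtractf sum_distrib_left)
  also have "\<dots> = 0"
    using Cons class_sum_ext_eps[OF lr(3)] by simp
  finally show ?case .
qed

end

section \<open>Rigidity of the orbit of \<open>\<Lambda> + \<rho>\<close>\<close>

text \<open>
  Suppose \<open>\<sigma> x > x\<close> and \<open>\<sigma> x' \<le> x'\<close>. Then \<open>\<sigma>\<close> maps the elements of \<open>C\<close> between \<open>x\<close> and \<open>x'\<close> bijectively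
  to those between \<open>\<sigma> x\<close> and \<open>\<sigma> x'\<close>, but one of these finite sets is a proper part of the other.
\<close>

lemma order_automorphism_shift:
  fixes \<sigma> :: "int \<Rightarrow> int"
  assumes bij: "bij_betw \<sigma> C C" and mono: "strict_mono_on C \<sigma>"
    and x: "x \<in> C" "\<sigma> x > x" and x': "x' \<in> C"
  shows "\<sigma> x' > x'"
proof (rule ccontr)
  assume "\<not> \<sigma> x' > x'"
  then have le: "\<sigma> x' \<le> x'" by simp
  have in_C: "\<sigma> a \<in> C" if "a \<in> C" for a using bij that by (rule bij_betw_apply)
  have mono_less: "\<sigma> a < \<sigma> b" if "a \<in> C" "b \<in> C" "a < b" for a b
    using mono that by (simp add: strict_mono_on_def)
  have mono_le: "\<sigma> a \<le> \<sigma> b" if "a \<in> C" "b \<in> C" "a \<le> b" for a b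
    using mono_less[of a b] that by (cases "a = b") auto
  consider "x < x'" | "x' < x" using le x by fastforce
  then show False
  proof cases
    case 1
    let ?A = "C \<inter> {x<..x'}" and ?B = "C \<inter> {\<sigma> x<..x'}"
    have "\<sigma> ` ?A \<subseteq> ?B"
    proof
      fix z assume "z \<in> \<sigma> ` ?A"
      then obtain a where a: "z = \<sigma> a" "a \<in> C" "x < a" "a \<le> x'" by auto
      then show "z \<in> ?B" using in_C[of a] mono_less[of x a] mono_le[of a x'] x x' le by simp
    qed
    moreover have "inj_on \<sigma> ?A" using bij by (meson bij_betw_imp_inj_on inj_on_subset inf_le1)
    ultimately have "card ?A \<le> card ?B" by (intro card_inj_on_le[of \<sigma>]) auto
    moreover have "\<sigma> x \<in> ?A" "\<sigma> x \<notin> ?B"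
      using x in_C[of x] mono_less[of x x'] 1 x' le by auto
    then have "?B \<subset> ?A" using x by auto
    then have "card ?B < card ?A" by (intro psubset_card_mono) auto
    ultimately show False by simp
  next
    case 2
    let ?A = "C \<inter> {x'<..x}" and ?B = "C \<inter> {x'<..\<sigma> x}"
    have "?B \<subseteq> \<sigma> ` ?A"
    proof
      fix b assume b: "b \<in> ?B"
      then have "b \<in> \<sigma> ` C" using bij by (simp add: bij_betw_def)
      then obtain a where a: "b = \<sigma> a" "a \<in> C" by blast
      have "x' < a" using mono_le[of a x'] a x' b le by (cases "a \<le> x'") auto
      moreover have "a \<le> x" using mono_less[of x a] a x b by (cases "x < a") auto
      ultimately show "b \<in> \<sigma> ` ?A" using a by auto
    qed
    then have "card ?B \<le> card ?A" by (intro surj_card_le) auto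
    have "\<sigma> x \<in> ?B" "\<sigma> x \<notin> ?A" using x in_C[of x] 2 by auto
    moreover have "?A \<subseteq> ?B" using x by auto
    ultimately have "?A \<subset> ?B" by blast
    then have "card ?A < card ?B" by (intro psubset_card_mono) auto
    with \<open>card ?B \<le> card ?A\<close> show False by simp
  qed
qed

text \<open>
  The linear functional with value \<open>1\<close> on all simple roots.
\<close>

definition height :: "nat \<Rightarrow> weight \<Rightarrow> complex" where
  "height n v = (case v of (c, a, b) \<Rightarrow> of_nat n * a - (\<Sum>i=1..n. of_nat i * c i))"

lemma height_add: "height n (v + w) = height n v + height n w"
  by (simp add: height_def algebra_simps sum.distrib split: prod.splits)

lemma height_scale: "height n (wscale z v) = z * height n v"
  by (simp add: height_def wscale_def algebra_simps sum_distrib_left split: prod.splits)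

lemma height_diff: "height n (v - w) = height n v - height n w"
  using height_add[of n "v - w" w] by simp

lemma height_zero: "height n 0 = 0"
  using height_diff[of n 0 0] by simp

lemma height_sum: "height n (sum f I) = (\<Sum>i\<in>I. height n (f i))"
  by (induction I rule: infinite_finite_induct) (simp_all add: height_zero height_add)

lemma height_sum_list: "height n (sum_list xs) = (\<Sum>x\<leftarrow>xs. height n x)"
  by (induction xs) (simp_all add: height_zero height_add)

lemma height_ext_eps:
  assumes n: "n > 0"
  shows "height n (ext_eps n l) = - of_int l"
proof -
  let ?i = "residue n l"
  have "height n (ext_eps n l) = - (of_nat n * of_int ((l - 1) div int n)) -
      (\<Sum>i=1..n. of_nat i * (if i = ?i then 1 else 0))"
    by (simp add: ext_eps_def eps_def wscale_def delta_def height_def)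
  also have "(\<Sum>i=1..n. of_nat i * (if i = ?i then 1 else 0 :: complex)) = of_nat ?i"
    using residue_range[OF n, of l] by (simp add: if_distrib cong: if_cong)
  also have "(of_nat ?i :: complex) = of_int (int ?i)" by simp
  also have "\<dots> = of_int (l - int n * ((l - 1) div int n))" unfolding int_residue[OF n] by simp
  finally show ?thesis by simp
qed

context dominant_weight
begin

text \<open>
  If the coordinates of a point of the orbit decrease along each class, the index permutation \<open>\<sigma>\<close> is an
  order automorphism of each class, so it moves all of its elements in the same direction. As \<open>y\<close>
  decreases too, the coordinates would all change with the same sign, contrary to the invariance of
  their sum. Hence \<open>\<sigma>\<close> is the identity, and coordinates and norm determine the point.
\<close>

lemma orbit_dominant_unique:
  assumes ss: "set ss \<subseteq> refl n ` int_roots n \<Lambda>"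
    and dom: "\<And>l r m. l < r \<Longrightarrow>
      coord n (word_prod n ss v0) l - coord n (word_prod n ss v0) r = of_int m \<Longrightarrow> m > 0"
  shows "word_prod n ss v0 = v0"
proof -
  let ?u = "word_prod n ss v0"
  obtain \<sigma> where \<sigma>: "bij \<sigma>" "coord n ?u = y \<circ> \<sigma>"
    using word_permutes[OF ss] v0_in by blast
  define \<beta> where "\<beta> = ?u - v0"
  have \<beta>: "\<beta> \<in> lattice_weights" using orbit_in_lattice[OF ss] by (simp add: \<beta>_def)
  have coord_\<beta>: "coord n \<beta> j = y (\<sigma> j) - y j" for j
    using \<sigma>(2) by (simp add: \<beta>_def coord_diff)
  have linked_\<sigma>: "linked (\<sigma> j) j" for j
    using coord_lattice(1)[OF n0 \<beta>, of j] coord_\<beta> by (simp add: linked_def)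
  have sum0: "(\<Sum>j\<in>link_class x. Re (coord n \<beta> (int j))) = 0" for x
    using orbit_class_sum[OF ss, of x] by (simp add: \<beta>_def flip: Re_sum)
  have finite: "finite (link_class x)" for x by (simp add: link_class_def)
  have in_class: "residue n x \<in> link_class x" for x
    unfolding residue_in_link_class by (rule exI[of _ 0]) (simp add: linked_def)
  have neg: "Re (coord n \<beta> j) < 0" if "\<sigma> j > j" for j
  proof -
    obtain m where m: "y j - y (\<sigma> j) = of_int m"
      using linked_\<sigma>[of j] linked_sym[of j "\<sigma> j"] by (auto simp: linked_def elim: Ints_cases)
    then have "m > 0" using y_decreasing[OF that] by blast
    moreover have "coord n \<beta> j = - of_int m" using m by (simp add: coord_\<beta> flip: m)
    ultimately show ?thesis by simp
  qed
  have pos: "Re (coord n \<beta> j) > 0" if "\<sigma> j < j" for j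
  proof -
    obtain m where m: "y (\<sigma> j) - y j = of_int m"
      using linked_\<sigma>[of j] by (auto simp: linked_def elim: Ints_cases)
    then have "m > 0" using y_decreasing[OF that] by blast
    then show ?thesis using m by (simp add: coord_\<beta>)
  qed
  have not_up: "\<not> \<sigma> x > x" for x
  proof
    assume up: "\<sigma> x > x"
    define C where "C = {j. linked j x}"
    have "bij_betw \<sigma> C C"
    proof (rule bij_betw_imageI)
      show "inj_on \<sigma> C" using \<sigma>(1) by (meson bij_is_inj inj_on_subset subset_UNIV)
      have "linked (\<sigma> j) x \<longleftrightarrow> linked j x" for j
        by (rule linked_cong[OF linked_\<sigma>])
      then have iff: "\<sigma> j \<in> C \<longleftrightarrow> j \<in> C" for j by (simp add: C_def)
      show "\<sigma> ` C = C"
      proof (intro equalityI subsetI)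
        fix j assume "j \<in> \<sigma> ` C"
        then show "j \<in> C" using iff by auto
      next
        fix j assume j: "j \<in> C"
        let ?i = "inv_into UNIV \<sigma> j"
        have i: "\<sigma> ?i = j" using \<sigma>(1) by (simp add: bij_is_surj surj_f_inv_f)
        then show "j \<in> \<sigma> ` C" using iff[of ?i] j image_eqI[of j \<sigma> ?i C] by simp
      qed
    qed
    moreover have "strict_mono_on C \<sigma>"
    proof (rule strict_mono_onI)
      fix a b assume ab: "a \<in> C" "b \<in> C" "a < b"
      have "linked (\<sigma> a) (\<sigma> b)"
        using ab linked_cong[OF linked_\<sigma>[of a]] linked_cong[OF linked_\<sigma>[of b]]
          linked_cong[of b x a] linked_sym unfolding C_def by auto
      then obtain m where m: "y (\<sigma> a) - y (\<sigma> b) = of_int m"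
        by (auto simp: linked_def elim: Ints_cases)
      then have m0: "m > 0" using dom[OF ab(3)] \<sigma>(2) by simp
      have "y (\<sigma> b) - y (\<sigma> a) = of_int (- m)" by (simp flip: m)
      then have "\<not> \<sigma> b < \<sigma> a" using y_decreasing[of "\<sigma> b" "\<sigma> a" "- m"] m0 by linarith
      moreover have "\<sigma> a \<noteq> \<sigma> b" using m m0 by auto
      ultimately show "\<sigma> a < \<sigma> b" by simp
    qed
    moreover have "x \<in> C" by (simp add: C_def linked_def)
    ultimately have all_up: "\<sigma> j > j" if "linked j x" for j
      using order_automorphism_shift[of \<sigma> C x j] up that by (simp add: C_def)
    have "Re (coord n \<beta> (int j)) < 0" if "j \<in> link_class x" for j
    proof -
      obtain k where "linked (int j + int n * k) x" using \<open>j \<in> link_class x\<close> by (auto simp: link_class_def)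
      then have "Re (coord n \<beta> (int j + int n * k)) < 0" using neg all_up by blast
      then show ?thesis by (simp add: coord_lattice(2)[OF n0 \<beta>])
    qed
    then have "(\<Sum>j\<in>link_class x. Re (coord n \<beta> (int j))) < (\<Sum>j\<in>link_class x. 0)"
      using finite in_class by (intro sum_strict_mono) auto
    then show False using sum0[of x] by simp
  qed
  then have nonneg: "Re (coord n \<beta> j) \<ge> 0" for j
    using pos[of j] coord_\<beta>[of j] not_up[of j] by (cases "\<sigma> j = j") (auto simp: not_less less_le)
  have "\<sigma> x = x" for x
  proof (rule ccontr)
    assume "\<sigma> x \<noteq> x"
    then have less: "\<sigma> x < x" using not_up[of x] by simp
    have "Re (coord n \<beta> (int (residue n x))) = 0"
      using sum0[of x] nonneg in_class[of x] finite[of x] by (simp add: sum_nonneg_eq_0_iff)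
    moreover have "coord n \<beta> (int (residue n x)) = coord n \<beta> x"
      unfolding int_residue[OF n0] by (rule coord_lattice(2)[OF n0 \<beta>])
    ultimately have "Re (coord n \<beta> x) = 0" by simp
    then show False using pos[OF less] by simp
  qed
  then have "coord n v0 = coord n ?u" using \<sigma>(2) by (simp add: fun_eq_iff)
  moreover have "?u \<in> hdual n" using word_in_Bij[OF ss] v0_in Bij_imp_funcset by blast
  ultimately show ?thesis
    using weight_eqI[OF n0 v0_in, of ?u] word_norm[OF ss v0_in] kappa_nz level_v0 by simp
qed

text \<open>
  The index permutation is trivial, so weights of nonzero level are fixed by \<open>weight_eqI\<close>; any weight of
  level zero is a difference of two weights of nonzero level.
\<close>

lemma word_stabilizer:
  assumes ss: "set ss \<subseteq> refl n ` int_roots n \<Lambda>" and fix_v0: "word_prod n ss v0 = v0"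
  shows "word_prod n ss = \<one>\<^bsub>BijGroup (hdual n)\<^esub>"
proof -
  let ?w = "word_prod n ss"
  have w: "?w \<in> Bij (hdual n)" by (rule word_in_Bij[OF ss])
  have closed: "?w v \<in> hdual n" if "v \<in> hdual n" for v using w that Bij_imp_funcset by blast
  obtain \<sigma> where \<sigma>: "\<And>v. v \<in> hdual n \<Longrightarrow> coord n (?w v) = coord n v \<circ> \<sigma>"
    using word_permutes[OF ss] by blast
  have "y (\<sigma> j) = y j" for j using \<sigma>[OF v0_in] fix_v0 by (metis comp_apply)
  then have "\<sigma> j = j" for j by (simp add: y_eq_iff)
  then have \<sigma>_id: "\<sigma> = id" by auto
  have nonzero_level: "?w v = v" if v: "v \<in> hdual n" "pairing n v delta \<noteq> 0" for v
    using weight_eqI[OF n0 v(1) closed[OF v(1)]] \<sigma>[OF v(1)] \<sigma>_id word_norm[OF ss v(1)] v(2) by simp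
  have "?w v = v" if v: "v \<in> hdual n" for v
  proof (cases "pairing n v delta = 0")
    case True
    have "?w (v + v0) = v + v0"
      using True kappa_nz by (intro nonzero_level hdual_add v v0_in) (simp add: pairing_add_left level_v0)
    then show ?thesis using word_additive[OF ss v v0_in] fix_v0 by simp
  next
    case False
    then show ?thesis using nonzero_level v by simp
  qed
  then show ?thesis
    using w one_in_Bij[of "hdual n"] BijGroup_one_apply[of _ "hdual n"] Bij_imp_extensional
    by (intro extensionalityI[of _ "hdual n"]) auto
qed

lemma swap_linked:
  assumes "a mod int n \<noteq> b mod int n" and "linked a b"
  shows "linked (swap_index n a b j) j"
proof (cases rule: congruence_cases[of j a n _ b])
  case (first k)
  then show ?thesis using assms linked_sym[of a b] by (simp add: swap_index_apply linked_shift)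
next
  case (second k)
  then show ?thesis using assms by (simp add: swap_index_apply linked_shift)
next
  case neither
  then show ?thesis by (simp add: swap_index_apply linked_def)
qed

end

section \<open>Generation by the base and boundedness of the orbit\<close>

context dominant_weight
begin

text \<open>
  This is \<open>s\<^sub>\<alpha> s\<^sub>\<beta> s\<^sub>\<alpha> = s\<^sub>\<gamma>\<close> with \<open>\<gamma> = s\<^sub>\<alpha> \<beta>\<close>.
\<close>

lemma reflect_conj:
  assumes ab: "a mod int n \<noteq> b mod int n" and lr: "l mod int n \<noteq> r mod int n"
  defines "l' \<equiv> swap_index n a b l" and "r' \<equiv> swap_index n a b r"
  assumes v: "v \<in> hdual n"
  shows "reflect n a b (reflect n l r (reflect n a b v)) = reflect n l' r' v"
proof -
  let ?s = "reflect n a b" and ?\<beta> = "ext_eps n l - ext_eps n r"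
  let ?u = "?s v"
  have u: "?u \<in> hdual n" by (rule refl_in_hdual[OF n0 ab v])
  have lr': "l' mod int n \<noteq> r' mod int n"
    unfolding l'_def r'_def by (rule swap_index_incongruent[OF n0 ab lr])
  have image: "?s ?\<beta> = ext_eps n l' - ext_eps n r'"
  proof -
    have "ext_eps n l' - ext_eps n r' = ?\<beta> - wscale ((coord n (ext_eps n l) a - coord n (ext_eps n l) b)
        - (coord n (ext_eps n r) a - coord n (ext_eps n r) b)) (ext_eps n a - ext_eps n b)"
      unfolding l'_def r'_def ext_eps_swap_index[OF n0 ab] by (simp only: wv.scale_left_diff_distrib) simp
    also have "(coord n (ext_eps n l) a - coord n (ext_eps n l) b)
        - (coord n (ext_eps n r) a - coord n (ext_eps n r) b) = coord n ?\<beta> a - coord n ?\<beta> b"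
      by (simp add: coord_diff)
    finally show ?thesis unfolding refl_ext_eps[OF n0 ab ext_eps_diff_in_hdual[OF n0]] by simp
  qed
  have scale: "?s (wscale z w) = wscale z (?s w)" if "w \<in> hdual n" for z w
    unfolding refl_ext_eps[OF n0 ab that] refl_ext_eps[OF n0 ab hdual_scale[OF that]]
    by (simp add: coord_scale wv.scale_right_diff_distrib flip: right_diff_distrib)
  have "?s (reflect n l r ?u) = ?s (?u + wscale (- (coord n ?u l - coord n ?u r)) ?\<beta>)"
    unfolding refl_ext_eps[OF n0 lr u] by (simp only: wv.scale_minus_left add_uminus_conv_diff)
  also have "\<dots> = ?s ?u + ?s (wscale (- (coord n ?u l - coord n ?u r)) ?\<beta>)"
    by (intro refl_add n0 ab u hdual_scale ext_eps_diff_in_hdual)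
  also have "\<dots> = v + wscale (- (coord n ?u l - coord n ?u r)) (ext_eps n l' - ext_eps n r')"
    unfolding scale[OF ext_eps_diff_in_hdual[OF n0]] image refl_refl[OF n0 ab v] ..
  also have "\<dots> = reflect n l' r' v"
    unfolding refl_ext_eps[OF n0 lr' v] unfolding coord_refl[OF n0 ab v] l'_def r'_def
    by (simp only: wv.scale_minus_left add_uminus_conv_diff)
  finally show ?thesis .
qed

text \<open>
  Suppose \<open>\<alpha> = E\<^sub>l - E\<^sub>r\<close> is a sum of at least two positive integral roots. As \<open>(\<alpha>, \<alpha>) > 0\<close>, some
  summand \<open>E\<^sub>p - E\<^sub>q\<close> has a positive product with \<open>\<alpha>\<close>. Up to translation this means \<open>p = l\<close> or \<open>q = r\<close>,
  and since the summand has smaller height, its other index lies strictly between \<open>l\<close> and \<open>r\<close> and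
  is linked to \<open>l\<close>.
\<close>

lemma int_baseI:
  assumes lr: "l < r" "l mod int n \<noteq> r mod int n" "linked l r"
    and none: "\<And>m. l < m \<Longrightarrow> m < r \<Longrightarrow> \<not> linked m l"
  shows "ext_eps n l - ext_eps n r \<in> int_base n \<Lambda>"
  unfolding int_base_def
proof (intro CollectI conjI notI)
  show "ext_eps n l - ext_eps n r \<in> int_roots n \<Lambda>" unfolding int_roots_eq using lr by blast
next
  assume "\<exists>\<beta>s. length \<beta>s \<ge> 2 \<and> set \<beta>s \<subseteq> int_roots n \<Lambda> \<and> sum_list \<beta>s = ext_eps n l - ext_eps n r"
  then obtain \<beta>s where \<beta>s: "length \<beta>s \<ge> 2" "set \<beta>s \<subseteq> int_roots n \<Lambda>"
    "sum_list \<beta>s = ext_eps n l - ext_eps n r" by blast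
  define D where "D v = Re (coord n v l - coord n v r)" for v
  have D_sum: "D (sum_list xs) = (\<Sum>x\<leftarrow>xs. D x)" for xs
    by (induction xs) (simp_all add: D_def coord_zero coord_add)
  have D_root: "D (ext_eps n p - ext_eps n q) =
      ((if l mod int n = p mod int n then 1 else 0) - (if l mod int n = q mod int n then 1 else 0)) -
      ((if r mod int n = p mod int n then 1 else 0) - (if r mod int n = q mod int n then 1 else 0))" for p q
    by (simp add: D_def coord_diff coord_ext_eps[OF n0])
  have "D (sum_list \<beta>s) = 2" using lr(2) unfolding \<beta>s(3) D_root by simp
  then have "(\<Sum>x\<leftarrow>\<beta>s. D x) > 0" by (simp add: D_sum)
  moreover have "(\<Sum>x\<leftarrow>\<beta>s. D x) \<le> 0" if "\<And>x. x \<in> set \<beta>s \<Longrightarrow> D x \<le> 0"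
    using that by (intro sum_list_nonpos) auto
  ultimately obtain \<beta> where \<beta>: "\<beta> \<in> set \<beta>s" "D \<beta> > 0" by (meson not_le)
  obtain p q where pq: "\<beta> = ext_eps n p - ext_eps n q" "p < q" "linked p q"
    using \<beta>(1) \<beta>s(2) unfolding int_roots_eq by blast
  have height_root: "Re (height n x) \<ge> 1" if x: "x \<in> set \<beta>s" for x
  proof -
    obtain p q where "x = ext_eps n p - ext_eps n q" "p < q"
      using x \<beta>s(2) unfolding int_roots_eq by blast
    then show ?thesis by (simp add: height_diff height_ext_eps[OF n0])
  qed
  have q_less: "q - p < r - l"
  proof -
    obtain xs zs where split: "\<beta>s = xs @ \<beta> # zs" using split_list[OF \<beta>(1)] by blast
    have ge: "(\<Sum>x\<leftarrow>ys. Re (height n x)) \<ge> real (length ys)" if "set ys \<subseteq> set \<beta>s" for ys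
      using that
    proof (induction ys)
      case (Cons x ys)
      then show ?case using height_root[of x] by simp
    qed simp
    have Re_list: "Re (\<Sum>x\<leftarrow>ys. height n x) = (\<Sum>x\<leftarrow>ys. Re (height n x))" for ys
      by (induction ys) simp_all
    have "Re (height n (sum_list \<beta>s)) = real_of_int (r - l)"
      unfolding \<beta>s(3) by (simp add: height_diff height_ext_eps[OF n0])
    then have "real_of_int (r - l) = (\<Sum>x\<leftarrow>xs. Re (height n x)) + Re (height n \<beta>) + (\<Sum>x\<leftarrow>zs. Re (height n x))"
      unfolding height_sum_list Re_list split by simp
    moreover have "set xs \<subseteq> set \<beta>s" "set zs \<subseteq> set \<beta>s" unfolding split by auto
    then have "(\<Sum>x\<leftarrow>xs. Re (height n x)) \<ge> real (length xs)" "(\<Sum>x\<leftarrow>zs. Re (height n x)) \<ge> real (length zs)"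
      by (simp_all add: ge)
    ultimately have "real_of_int (r - l) \<ge> real (length xs + length zs) + Re (height n \<beta>)" by simp
    moreover have "length xs + length zs \<ge> 1" using \<beta>s(1) split by simp
    then have "real (length xs + length zs) \<ge> 1" by linarith
    moreover have "Re (height n \<beta>) = real_of_int (q - p)"
      by (simp add: pq(1) height_diff height_ext_eps[OF n0])
    ultimately show ?thesis by linarith
  qed
  have "l mod int n = p mod int n \<or> r mod int n = q mod int n"
    using \<beta>(2) unfolding pq(1) D_root by (simp split: if_splits)
  then show False
  proof
    assume cong: "l mod int n = p mod int n"
    obtain k where k: "l = p + int n * k" by (rule mod_eqE[OF cong[symmetric]])
    have "linked (q + int n * k) l"
      unfolding k linked_shift using pq(3) linked_sym[of p q] by simp
    then show False using none[of "q + int n * k"] pq(2) q_less k by simp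
  next
    assume cong: "r mod int n = q mod int n"
    obtain k where k: "r = q + int n * k" by (rule mod_eqE[OF cong[symmetric]])
    have "linked (p + int n * k) r" unfolding k linked_shift by (rule pq(3))
    moreover have "linked r l" using lr(3) linked_sym[of l r] by simp
    ultimately have "linked (p + int n * k) l" by (rule linked_trans)
    then show False using none[of "p + int n * k"] pq(2) q_less k by simp
  qed
qed

abbreviation base_words :: "(weight \<Rightarrow> weight) set" where
  "base_words \<equiv> {word_prod n ss | ss. set ss \<subseteq> refl n ` int_base n \<Lambda>}"

lemma int_base_subset: "refl n ` int_base n \<Lambda> \<subseteq> refl n ` int_roots n \<Lambda>"
  by (auto simp: int_base_def)

lemma word_append:
  assumes "set ss \<subseteq> refl n ` int_roots n \<Lambda>" "set ts \<subseteq> refl n ` int_roots n \<Lambda>"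
  shows "word_prod n (ss @ ts) = word_prod n ss \<otimes>\<^bsub>BijGroup (hdual n)\<^esub> word_prod n ts"
  using assms(1)
proof (induction ss)
  case Nil
  have "word_prod n ts \<in> carrier (BijGroup (hdual n))"
    using word_in_Bij[OF assms(2)] by (simp add: BijGroup_def)
  from monoid.l_one[OF group.is_monoid[OF group_BijGroup] this] show ?case by simp
next
  case (Cons s ss)
  obtain l r where "s = reflect n l r" "l mod int n \<noteq> r mod int n" using word_headE[OF Cons.prems] by blast
  then have "s \<in> carrier (BijGroup (hdual n))" using refl_in_Bij[OF n0] by (simp add: BijGroup_def)
  moreover have "word_prod n ss \<in> carrier (BijGroup (hdual n))" "word_prod n ts \<in> carrier (BijGroup (hdual n))"
    using word_in_Bij[OF assms(2)] word_in_Bij[of ss] Cons.prems by (simp_all add: BijGroup_def)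
  ultimately have "s \<otimes>\<^bsub>BijGroup (hdual n)\<^esub> word_prod n ss \<otimes>\<^bsub>BijGroup (hdual n)\<^esub> word_prod n ts =
      s \<otimes>\<^bsub>BijGroup (hdual n)\<^esub> (word_prod n ss \<otimes>\<^bsub>BijGroup (hdual n)\<^esub> word_prod n ts)"
    by (rule monoid.m_assoc[OF group.is_monoid[OF group_BijGroup]])
  then show ?case using Cons by simp
qed

lemma base_words_mult:
  assumes "f \<in> base_words" "g \<in> base_words"
  shows "f \<otimes>\<^bsub>BijGroup (hdual n)\<^esub> g \<in> base_words"
proof -
  obtain ss ts where "set ss \<subseteq> refl n ` int_base n \<Lambda>" "f = word_prod n ss"
    "set ts \<subseteq> refl n ` int_base n \<Lambda>" "g = word_prod n ts" using assms by blast
  then show ?thesis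
    using word_append[of ss ts] int_base_subset by (intro CollectI exI[of _ "ss @ ts"]) auto
qed

lemma base_word_single:
  assumes "s \<in> refl n ` int_base n \<Lambda>"
  shows "s \<in> base_words"
proof -
  have s: "s \<in> refl n ` int_roots n \<Lambda>" using assms int_base_subset by blast
  then obtain l r where "s = reflect n l r" "l mod int n \<noteq> r mod int n" by (rule int_reflE)
  then have "s \<in> carrier (BijGroup (hdual n))" using refl_in_Bij[OF n0] by (simp add: BijGroup_def)
  from monoid.r_one[OF group.is_monoid[OF group_BijGroup] this] have "s = word_prod n [s]" by simp
  then show ?thesis using assms by (intro CollectI exI[of _ "[s]"]) simp
qed

text \<open>
  Induction on \<open>\<bar>r - l\<bar>\<close>. If the root is not in the base, some linked index \<open>m\<close> lies strictly between \<open>l\<close>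
  and \<open>r\<close>. Conjugation by the reflection in \<open>E\<^sub>l - E\<^sub>m\<close>, or in \<open>E\<^sub>m - E\<^sub>r\<close> if \<open>m\<close> is congruent to \<open>l\<close>, turns
  the reflection into one with a smaller distance of the indices.
\<close>

lemma reflect_in_base_words:
  assumes "l \<noteq> r" "l mod int n \<noteq> r mod int n" "linked l r"
  shows "reflect n l r \<in> base_words"
  using assms
proof (induction "nat \<bar>r - l\<bar>" arbitrary: l r rule: less_induct)
  case less
  have wlog: "reflect n l r \<in> base_words"
    if lr: "l < r" "l mod int n \<noteq> r mod int n" "linked l r"
      and IH: "\<And>a b. nat \<bar>b - a\<bar> < nat \<bar>r - l\<bar> \<Longrightarrow> a \<noteq> b \<Longrightarrow> a mod int n \<noteq> b mod int n \<Longrightarrow> linked a b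
        \<Longrightarrow> reflect n a b \<in> base_words" for l r
  proof (cases "ext_eps n l - ext_eps n r \<in> int_base n \<Lambda>")
    case True
    then show ?thesis by (intro base_word_single) simp
  next
    case False
    then obtain m where m: "l < m" "m < r" "linked m l" using int_baseI[OF lr] by blast
    have conj: "reflect n l r \<in> base_words"
      if ab: "a mod int n \<noteq> b mod int n" "linked a b" "nat \<bar>b - a\<bar> < nat \<bar>r - l\<bar>"
        and closer: "nat \<bar>swap_index n a b r - swap_index n a b l\<bar> < nat \<bar>r - l\<bar>" for a b
    proof -
      let ?l = "swap_index n a b l" and ?r = "swap_index n a b r"
      let ?s = "reflect n a b" and ?t = "reflect n ?l ?r"
      have neq: "?l mod int n \<noteq> ?r mod int n" by (rule swap_index_incongruent[OF n0 ab(1) lr(2)])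
      have s: "?s \<in> base_words" using IH[OF ab(3)] ab by blast
      have "?l \<noteq> ?r" using neq by auto
      moreover have "linked ?l ?r"
        using linked_cong[OF swap_linked[OF ab(1,2), of l]] linked_cong[OF swap_linked[OF ab(1,2), of r]]
          lr(3) linked_sym[of l ?r] linked_sym[of l r] by simp
      ultimately have t: "?t \<in> base_words" using IH[OF closer _ neq] by blast
      have sB: "?s \<in> Bij (hdual n)" "?t \<in> Bij (hdual n)" "reflect n l r \<in> Bij (hdual n)"
        using refl_in_Bij[OF n0] ab(1) neq lr(2) by blast+
      have "?s \<otimes>\<^bsub>BijGroup (hdual n)\<^esub> (?t \<otimes>\<^bsub>BijGroup (hdual n)\<^esub> ?s) = reflect n l r"
      proof (rule extensionalityI[of _ "hdual n"])
        show "?s \<otimes>\<^bsub>BijGroup (hdual n)\<^esub> (?t \<otimes>\<^bsub>BijGroup (hdual n)\<^esub> ?s) \<in> extensional (hdual n)"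
          using sB by (intro Bij_imp_extensional mult_in_Bij)
        show "reflect n l r \<in> extensional (hdual n)" using sB(3) by (rule Bij_imp_extensional)
        fix v assume v: "v \<in> hdual n"
        have "?s v \<in> hdual n" using refl_in_hdual[OF n0 ab(1) v] .
        then show "(?s \<otimes>\<^bsub>BijGroup (hdual n)\<^esub> (?t \<otimes>\<^bsub>BijGroup (hdual n)\<^esub> ?s)) v = reflect n l r v"
          using reflect_conj[OF ab(1) neq v] v sB mult_in_Bij[OF sB(2) sB(1)]
          by (simp add: BijGroup_mult_apply swap_index_invol[OF ab(1)])
      qed
      then show ?thesis using base_words_mult[OF s base_words_mult[OF t s]] by simp
    qed
    show ?thesis
    proof (cases "m mod int n = l mod int n")
      case False
      then show ?thesis
        using m lr linked_sym[of l m] by (intro conj[of l m]) (auto simp: swap_index_def)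
    next
      case True
      then have "m mod int n \<noteq> r mod int n" using lr(2) by simp
      moreover have "linked m r" by (rule linked_trans[OF m(3) lr(3)])
      ultimately show ?thesis
        using m lr True by (intro conj[of m r]) (auto simp: swap_index_def)
    qed
  qed
  show ?case
  proof (cases "l < r")
    case True
    then show ?thesis using less.prems(2,3) by (rule wlog) (rule less.hyps)
  next
    case False
    then have "r < l" using less.prems(1) by simp
    moreover have "r mod int n \<noteq> l mod int n" "linked r l"
      using less.prems(2,3) linked_sym[of l r] by simp_all
    ultimately have "reflect n r l \<in> base_words"
      by (rule wlog) (rule less.hyps, simp_all add: abs_minus_commute)
    then show ?thesis unfolding reflect_sym[OF less.prems(2)] .
  qed
qed

lemma int_weyl_base_word:
  assumes "w \<in> int_weyl n \<Lambda>"
  shows "w \<in> base_words"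
  using assms unfolding int_weyl_def
proof (induction rule: generate.induct)
  case one
  show ?case by (intro CollectI exI[of _ "[]"]) simp
next
  case (incl h)
  then obtain l r where "h = reflect n l r" "l < r" "l mod int n \<noteq> r mod int n" "linked l r"
    by (rule int_reflE)
  then show ?case using reflect_in_base_words[of l r] by simp
next
  case (inv h)
  then obtain l r where h: "h = reflect n l r" "l < r" "l mod int n \<noteq> r mod int n" "linked l r"
    by (rule int_reflE)
  have hB: "h \<in> Bij (hdual n)" using refl_in_Bij[OF n0] h by simp
  have "h \<otimes>\<^bsub>BijGroup (hdual n)\<^esub> h = \<one>\<^bsub>BijGroup (hdual n)\<^esub>"
  proof (rule extensionalityI[of _ "hdual n"])
    fix v assume v: "v \<in> hdual n"
    show "(h \<otimes>\<^bsub>BijGroup (hdual n)\<^esub> h) v = \<one>\<^bsub>BijGroup (hdual n)\<^esub> v"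
      using hB v refl_refl[OF n0 h(3) v] by (simp add: BijGroup_mult_apply BijGroup_one_apply flip: h(1))
  qed (use hB in \<open>auto intro: Bij_imp_extensional mult_in_Bij one_in_Bij\<close>)
  then have "inv\<^bsub>BijGroup (hdual n)\<^esub> h = h"
    using hB by (intro group.inv_equality[OF group_BijGroup]) (simp_all add: BijGroup_def)
  then show ?case using reflect_in_base_words[of l r] h by simp
next
  case (eng h1 h2)
  then show ?case using base_words_mult by blast
qed

lemma int_weyl_word:
  assumes "w \<in> int_weyl n \<Lambda>"
  obtains ss where "set ss \<subseteq> refl n ` int_roots n \<Lambda>" "w = word_prod n ss"
  using int_weyl_base_word[OF assms] int_base_subset by blast

lemma int_weyl_sign:
  assumes "w \<in> int_weyl n \<Lambda>" and "set ss \<subseteq> refl n ` int_roots n \<Lambda>" "w = word_prod n ss"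
  shows "even (coxeter_length n \<Lambda> w) \<longleftrightarrow> even (length ss)"
proof -
  let ?P = "\<lambda>k. \<exists>ss. length ss = k \<and> set ss \<subseteq> refl n ` int_base n \<Lambda> \<and> w = word_prod n ss"
  have "\<exists>k. ?P k" using int_weyl_base_word[OF assms(1)] by blast
  then have "?P (coxeter_length n \<Lambda> w)" unfolding coxeter_length_def by (rule LeastI_ex)
  then obtain ts where "length ts = coxeter_length n \<Lambda> w" "set ts \<subseteq> refl n ` int_base n \<Lambda>" "w = word_prod n ts"
    by blast
  then show ?thesis using word_length_parity[of ts ss] assms int_base_subset by auto
qed

lemma int_weyl_reflect:
  assumes w: "w \<in> int_weyl n \<Lambda>" and lr: "l mod int n \<noteq> r mod int n" "linked l r"
  defines "w' \<equiv> reflect n l r \<otimes>\<^bsub>BijGroup (hdual n)\<^esub> w"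
  shows "w' \<in> int_weyl n \<Lambda>" "w' v0 = reflect n l r (w v0)"
    "(-1 :: int) ^ coxeter_length n \<Lambda> w' = - ((-1) ^ coxeter_length n \<Lambda> w)"
    "reflect n l r \<otimes>\<^bsub>BijGroup (hdual n)\<^esub> w' = w"
proof -
  obtain ss where ss: "set ss \<subseteq> refl n ` int_roots n \<Lambda>" "w = word_prod n ss"
    by (rule int_weyl_word[OF w])
  have "l \<noteq> r" using lr by auto
  then have s: "reflect n l r \<in> refl n ` int_roots n \<Lambda>" using int_reflI lr by blast
  let ?s = "reflect n l r"
  have wB: "w \<in> Bij (hdual n)" using word_in_Bij[OF ss(1)] ss(2) by simp
  have sB: "?s \<in> Bij (hdual n)" by (rule refl_in_Bij[OF n0 lr(1)])
  show w': "w' \<in> int_weyl n \<Lambda>"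
    using w s unfolding w'_def int_weyl_def by (intro generate.eng[OF generate.incl])
  show "w' v0 = reflect n l r (w v0)"
    unfolding w'_def by (rule BijGroup_mult_apply[OF sB wB v0_in])
  have set: "set (?s # ss) \<subseteq> refl n ` int_roots n \<Lambda>" using s ss(1) by simp
  have "even (coxeter_length n \<Lambda> w') \<longleftrightarrow> even (length (?s # ss))"
    by (rule int_weyl_sign[OF w' set]) (simp add: w'_def ss(2))
  moreover have "even (coxeter_length n \<Lambda> w) \<longleftrightarrow> even (length ss)"
    by (rule int_weyl_sign[OF w ss])
  ultimately show "(-1 :: int) ^ coxeter_length n \<Lambda> w' = - ((-1) ^ coxeter_length n \<Lambda> w)"
    by (simp add: minus_one_power_iff)
  show "?s \<otimes>\<^bsub>BijGroup (hdual n)\<^esub> w' = w"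
  proof (rule extensionalityI[of _ "hdual n"])
    fix v assume v: "v \<in> hdual n"
    then have "w v \<in> hdual n" using wB Bij_imp_funcset by blast
    then show "(?s \<otimes>\<^bsub>BijGroup (hdual n)\<^esub> w') v = w v"
      using refl_refl[OF n0 lr(1)] sB wB v mult_in_Bij[OF sB wB] by (simp add: w'_def BijGroup_mult_apply)
  qed (use wB sB in \<open>auto simp: w'_def intro: Bij_imp_extensional mult_in_Bij\<close>)
qed

lemma int_weyl_orbit_inj:
  assumes w: "w \<in> int_weyl n \<Lambda>" "w' \<in> int_weyl n \<Lambda>" and eq: "w v0 = w' v0"
  shows "w = w'"
proof -
  interpret G: group "BijGroup (hdual n)" by (rule group_BijGroup)
  have carrier: "carrier (BijGroup (hdual n)) = Bij (hdual n)" by (simp add: BijGroup_def)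
  have sub: "refl n ` int_roots n \<Lambda> \<subseteq> carrier (BijGroup (hdual n))"
    unfolding carrier by (auto elim!: int_reflE intro: refl_in_Bij[OF n0])
  have inB: "w \<in> Bij (hdual n)" "w' \<in> Bij (hdual n)"
    using w G.generate_incl[OF sub] unfolding int_weyl_def carrier by blast+
  let ?x = "inv\<^bsub>BijGroup (hdual n)\<^esub> w \<otimes>\<^bsub>BijGroup (hdual n)\<^esub> w'"
  have "subgroup (int_weyl n \<Lambda>) (BijGroup (hdual n))"
    unfolding int_weyl_def by (rule G.generate_is_subgroup[OF sub])
  then have x: "?x \<in> int_weyl n \<Lambda>" using w by (intro subgroup.m_closed subgroup.m_inv_closed)
  have invB: "inv\<^bsub>BijGroup (hdual n)\<^esub> w \<in> Bij (hdual n)" using inB G.inv_closed unfolding carrier by blast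
  have "?x v0 = (inv\<^bsub>BijGroup (hdual n)\<^esub> w) (w v0)"
    using BijGroup_mult_apply[OF invB inB(2) v0_in] eq by simp
  also have "\<dots> = (inv\<^bsub>BijGroup (hdual n)\<^esub> w \<otimes>\<^bsub>BijGroup (hdual n)\<^esub> w) v0"
    using BijGroup_mult_apply[OF invB inB(1) v0_in] by simp
  also have "\<dots> = v0" using inB G.l_inv BijGroup_one_apply[OF v0_in] unfolding carrier by simp
  finally have "?x v0 = v0" .
  moreover obtain ss where "set ss \<subseteq> refl n ` int_roots n \<Lambda>" "?x = word_prod n ss"
    by (rule int_weyl_word[OF x])
  ultimately have "?x = \<one>\<^bsub>BijGroup (hdual n)\<^esub>" using word_stabilizer by simp
  then have "w = w \<otimes>\<^bsub>BijGroup (hdual n)\<^esub> ?x" using inB(1) G.r_one unfolding carrier by simp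
  also have "\<dots> = w'"
    using inB G.m_assoc[symmetric, of w "inv\<^bsub>BijGroup (hdual n)\<^esub> w" w'] G.r_inv G.l_one invB
    unfolding carrier by simp
  finally show ?thesis .
qed

text \<open>
  Write \<open>w (\<Lambda> + \<rho>) = \<Lambda> + \<rho> + \<beta>\<close> with \<open>\<beta> = (x, z, 0)\<close> integral, and let \<open>c\<^sub>i\<close> be the
  coefficients of \<open>\<Lambda> + \<rho>\<close> at \<open>\<epsilon>\<^sub>i\<close>. Equality of norms gives
  \<open>2 z Re \<kappa> = - \<Sum>\<^sub>i (2 Re c\<^sub>i x\<^sub>i + x\<^sub>i\<^sup>2)\<close>, which makes the height of \<open>\<beta>\<close> a polynomial of degree two in
  \<open>x\<close> with negative definite leading part.
\<close>

lemma orbit_height_bounded: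
  "\<exists>B::real. \<forall>w\<in>int_weyl n \<Lambda>. Re (height n (w v0)) \<le> B"
proof -
  obtain c a b where v0: "v0 = (c, a, b)" by (rule prod_cases3)
  have b: "b = \<kappa>" using level_v0 by (simp add: v0 pairing_delta)
  define K where "K = Re \<kappa>"
  have K: "K > 0" using level by (simp add: K_def)
  \<comment> \<open>For integral \<open>\<beta>\<close> as above, \<open>Re \<kappa>\<close> times its height is the sum over \<open>i\<close> of \<open>- e i x\<^sub>i - n x\<^sub>i\<^sup>2 / 2\<close>;
    \<open>B\<close> comes from the maxima \<open>(e i)\<^sup>2 / (2 n)\<close> of these terms over real \<open>x\<^sub>i\<close>.\<close>
  define e where "e i = real n * Re (c i) + real i * K" for i
  define B where "B = (\<Sum>i=1..n. (e i)\<^sup>2) / (2 * real n * K)"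
  have "Re (height n (w v0)) \<le> Re (height n v0) + B" if w: "w \<in> int_weyl n \<Lambda>" for w
  proof -
    obtain ss where ss: "set ss \<subseteq> refl n ` int_roots n \<Lambda>" "w = word_prod n ss"
      by (rule int_weyl_word[OF w])
    obtain c' a' where \<beta>: "w v0 - v0 = (c', a', 0)" "\<And>i. c' i \<in> \<int>" "a' \<in> \<int>"
      using orbit_in_lattice[OF ss(1)] by (auto simp: lattice_weights_def ss(2))
    have wv0: "w v0 = (\<lambda>i. c i + c' i, a + a', b)"
    proof -
      have "w v0 = (c', a', 0) + v0" unfolding \<beta>(1)[symmetric] by simp
      also have "\<dots> = (\<lambda>i. c i + c' i, a + a', b)" unfolding v0 by (simp add: fun_eq_iff add.commute)
      finally show ?thesis .
    qed
    have "pairing n (w v0) (w v0) = pairing n v0 v0" using word_norm[OF ss(1) v0_in] ss(2) by simp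
    then have "(\<Sum>i=1..n. 2 * c i * c' i + c' i * c' i) + 2 * a' * \<kappa> = 0"
      unfolding wv0 unfolding v0 pairing_def
      by (simp add: algebra_simps sum.distrib b sum_distrib_left)
    then have "Re ((\<Sum>i=1..n. 2 * c i * c' i + c' i * c' i) + 2 * a' * \<kappa>) = 0" by simp
    moreover define x where "x i = \<lfloor>Re (c' i)\<rfloor>" for i
    then have x: "c' i = of_int (x i)" for i using \<beta>(2)[of i] by (auto elim!: Ints_cases)
    moreover obtain z where z: "a' = of_int z" using \<beta>(3) by (rule Ints_cases)
    ultimately have norm: "(\<Sum>i=1..n. 2 * Re (c i) * x i + (x i)\<^sup>2) + 2 * z * K = 0"
      by (simp add: K_def power2_eq_square)
    have "Re (height n (w v0)) - Re (height n v0) = real n * z - (\<Sum>i=1..n. real i * x i)"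
      unfolding wv0 unfolding v0 height_def by (simp add: x z algebra_simps sum.distrib)
    also have "\<dots> = (\<Sum>i=1..n. - e i * x i - real n * (x i)\<^sup>2 / 2) / K"
    proof -
      have "2 * z * K = - (\<Sum>i=1..n. 2 * Re (c i) * x i + (x i)\<^sup>2)" using norm by linarith
      then have zK: "z * K = - (\<Sum>i=1..n. Re (c i) * x i + (x i)\<^sup>2 / 2)"
        by (simp add: sum.distrib sum_distrib_left[symmetric] mult.assoc flip: sum_divide_distrib)
      have "(real n * z - (\<Sum>i=1..n. real i * x i)) * K
          = real n * (z * K) - (\<Sum>i=1..n. real i * x i * K)"
        by (simp add: algebra_simps sum_distrib_left)
      also have "\<dots> = (\<Sum>i=1..n. - e i * x i - real n * (x i)\<^sup>2 / 2)"
        unfolding zK by (simp add: e_def algebra_simps sum.distrib sum_distrib_left sum_negf sum_subtractf)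
      finally show ?thesis using K by (simp add: field_simps)
    qed
    also have "\<dots> \<le> (\<Sum>i=1..n. (e i)\<^sup>2 / (2 * real n)) / K"
    proof (intro divide_right_mono sum_mono)
      fix i
      have "0 \<le> (e i + real n * x i)\<^sup>2" by simp
      then have "- e i * x i * (2 * real n) - (real n)\<^sup>2 * (x i)\<^sup>2 \<le> (e i)\<^sup>2"
        by (simp add: power2_eq_square algebra_simps)
      then have "(- e i * x i - real n * (x i)\<^sup>2 / 2) * (2 * real n) \<le> (e i)\<^sup>2"
        by (simp add: power2_eq_square algebra_simps)
      then show "- e i * x i - real n * (x i)\<^sup>2 / 2 \<le> (e i)\<^sup>2 / (2 * real n)"
        using n0 by (simp add: pos_le_divide_eq)
    qed (use K in simp)
    also have "\<dots> = B" by (simp add: B_def sum_divide_distrib)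
    finally show ?thesis by simp
  qed
  then show ?thesis by blast
qed

end

section \<open>Depth of a pattern by columns\<close>

lemma alpha_shift: "alpha n (i + int n * k) = alpha n i"
  by (simp add: alpha_def)

definition col_depth :: "nat \<Rightarrow> pattern \<Rightarrow> int \<Rightarrow> weight" where
  "col_depth n d j = (\<Sum>i\<in>{i. d i j \<noteq> 0}. wscale (of_nat (d i j)) (alpha n i))"

lemma col_finite: "gt_pattern n d \<Longrightarrow> n > 0 \<Longrightarrow> finite {i. d i j \<noteq> 0}"
proof -
  assume gt: "gt_pattern n d" and n: "n > 0"
  obtain K where K: "\<And>i j. d i j \<noteq> 0 \<Longrightarrow> i \<le> j + int K"
    using gt_bounded_support[OF gt n] by blast
  have "{i. d i j \<noteq> 0} \<subseteq> {j..j + int K}"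
    using K gt_zero[OF gt] by (auto simp: not_less[symmetric])
  then show ?thesis by (rule finite_subset) simp
qed

lemma col_depth_upto:
  assumes gt: "gt_pattern n d" and n: "n > 0" and M: "\<And>i. d i j \<noteq> 0 \<Longrightarrow> i < M"
  shows "col_depth n d j = (\<Sum>i\<in>{j..<M}. wscale (of_nat (d i j)) (alpha n i))"
  unfolding col_depth_def
proof (rule sum.mono_neutral_left)
  show "{i. d i j \<noteq> 0} \<subseteq> {j..<M}"
    using M gt_zero[OF gt] by (auto simp: not_less[symmetric])
qed auto

lemma col_depth_shift:
  assumes gt: "gt_pattern n d"
  shows "col_depth n d (j + int n * k) = col_depth n d j"
  unfolding col_depth_def
proof (rule sum.reindex_bij_witness[where i = "\<lambda>i. i + int n * k" and j = "\<lambda>i. i - int n * k"])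
  fix i assume i: "i \<in> {i. d i (j + int n * k) \<noteq> 0}"
  have "d (i - int n * k) j = d i (j + int n * k)"
    using gt_periodic[OF gt, of "i - int n * k" k j] by simp
  moreover have "alpha n (i - int n * k) = alpha n i"
    using alpha_shift[of n "i - int n * k" k] by simp
  ultimately show "i - int n * k \<in> {i. d i j \<noteq> 0}"
    "wscale (of_nat (d (i - int n * k) j)) (alpha n (i - int n * k)) =
      wscale (of_nat (d i (j + int n * k))) (alpha n i)"
    using i by simp_all
next
  fix i assume "i \<in> {i. d i j \<noteq> 0}"
  then show "i + int n * k \<in> {i. d i (j + int n * k) \<noteq> 0}" using gt_periodic[OF gt] by simp
qed auto

lemma col_depth_residue: "gt_pattern n d \<Longrightarrow> n > 0 \<Longrightarrow> col_depth n d (int (residue n j)) = col_depth n d j"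
  unfolding int_residue by (rule col_depth_shift)

text \<open>
  A fundamental domain for the translations by the period consists of the entries in the rows
  \<open>1, \<dots>, n\<close>, and also of those in the columns \<open>1, \<dots>, n\<close>.
\<close>

lemma pattern_depth_columns:
  assumes gt: "gt_pattern n d" and n: "n > 0"
  shows "pattern_depth n d = (\<Sum>j=1..n. col_depth n d (int j))"
proof -
  let ?f = "\<lambda>i j. wscale (of_nat (d i j)) (alpha n i)"
  let ?k = "\<lambda>j. - ((j - 1) div int n)"
  have rows: "{j. j \<le> i \<and> d i j \<noteq> 0} = {j. d i j \<noteq> 0}" for i
    using gt_zero[OF gt] by (auto simp: not_less[symmetric])
  have shift: "d (i + int n * k) (j + int n * k) = d i j" for i j k by (rule gt_periodic[OF gt])
  have inverse: "(residue n (int i + int n * ?k j), int (residue n j) + int n * ?k (int i + int n * ?k j)) = (i, j)"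
    if "i \<in> {1..n}" for i j
  proof -
    have "(int i + int n * ?k j - 1) div int n = (int i - 1) div int n + ?k j"
      using n div_mult_self2[of "int n" "int i - 1" "?k j"] by (simp add: algebra_simps)
    also have "(int i - 1) div int n = 0" using that by (intro div_pos_pos_trivial) auto
    finally show ?thesis
      using that unfolding int_residue[OF n] residue_shift residue_of_nat[OF that] by simp
  qed
  have "pattern_depth n d = (\<Sum>i\<in>{1..n}. \<Sum>j\<in>{j. d (int i) j \<noteq> 0}. ?f (int i) j)"
    unfolding pattern_depth_def row_sum_def rows of_nat_sum by (simp add: wv.scale_sum_left)
  also have "\<dots> = (\<Sum>(i, j)\<in>Sigma {1..n} (\<lambda>i. {j. d (int i) j \<noteq> 0}). ?f (int i) j)"
    by (rule sum.Sigma) (use gt_row_finite[OF gt] in auto)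
  also have "\<dots> = (\<Sum>(j, i)\<in>Sigma {1..n} (\<lambda>j. {i. d i (int j) \<noteq> 0}). ?f i (int j))"
  proof (rule sum.reindex_bij_witness[where
        i = "\<lambda>(j, i). (residue n i, int j + int n * ?k i)" and
        j = "\<lambda>(i, j). (residue n j, int i + int n * ?k j)"])
    fix p assume "p \<in> Sigma {1..n} (\<lambda>i. {j. d (int i) j \<noteq> 0})"
    then obtain i j where p: "p = (i, j)" and ij: "i \<in> {1..n}" "d (int i) j \<noteq> 0" by auto
    show "(case case p of (i, j) \<Rightarrow> (residue n j, int i + int n * ?k j) of
        (j, i) \<Rightarrow> (residue n i, int j + int n * ?k i)) = p"
      unfolding p prod.case by (rule inverse[OF ij(1)])
    have d: "d (int i + int n * ?k j) (int (residue n j)) = d (int i) j"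
      unfolding int_residue[OF n] by (rule shift)
    then show "(case p of (i, j) \<Rightarrow> (residue n j, int i + int n * ?k j))
        \<in> Sigma {1..n} (\<lambda>j. {i. d i (int j) \<noteq> 0})"
      unfolding p prod.case using ij residue_range[OF n, of j] by simp
    show "(case case p of (i, j) \<Rightarrow> (residue n j, int i + int n * ?k j) of
        (j, i) \<Rightarrow> ?f i (int j)) = (case p of (i, j) \<Rightarrow> ?f (int i) j)"
      unfolding p prod.case d alpha_shift ..
  next
    fix p assume "p \<in> Sigma {1..n} (\<lambda>j. {i. d i (int j) \<noteq> 0})"
    then obtain j i where p: "p = (j, i)" and ij: "j \<in> {1..n}" "d i (int j) \<noteq> 0" by auto
    show "(case case p of (j, i) \<Rightarrow> (residue n i, int j + int n * ?k i) of
        (i, j) \<Rightarrow> (residue n j, int i + int n * ?k j)) = p"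
      unfolding p prod.case by (rule inverse[OF ij(1)])
    have "d (int (residue n i)) (int j + int n * ?k i) = d i (int j)"
      unfolding int_residue[OF n] by (rule shift)
    then show "(case p of (j, i) \<Rightarrow> (residue n i, int j + int n * ?k i))
        \<in> Sigma {1..n} (\<lambda>i. {j. d (int i) j \<noteq> 0})"
      unfolding p prod.case using ij residue_range[OF n, of i] by simp
  qed
  also have "\<dots> = (\<Sum>j\<in>{1..n}. \<Sum>i\<in>{i. d i (int j) \<noteq> 0}. ?f i (int j))"
    by (rule sum.Sigma[symmetric]) (use col_finite[OF gt n] in auto)
  finally show ?thesis by (simp add: col_depth_def)
qed

lemma height_alpha: "n \<ge> 2 \<Longrightarrow> height n (alpha n i) = 1"
  by (simp add: alpha_eq_ext_eps height_diff height_ext_eps)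

lemma height_pattern_depth:
  assumes gt: "gt_pattern n d" and n: "n \<ge> 2"
  shows "height n (pattern_depth n d) = of_nat (\<Sum>j=1..n. \<Sum>i\<in>{i. d i (int j) \<noteq> 0}. d i (int j))"
  using n by (simp add: pattern_depth_columns[OF gt] col_depth_def height_sum height_scale height_alpha)

lemma gt_eqI:
  assumes n: "n > 0" and gt: "gt_pattern n d" "gt_pattern n e"
    and base: "\<And>j k. j \<in> {1..n} \<Longrightarrow> d (int j + int k) (int j) = e (int j + int k) (int j)"
  shows "d = e"
proof (intro ext)
  fix i j
  show "d i j = e i j"
  proof (cases "i < j")
    case True
    then show ?thesis using gt_zero[OF gt(1)] gt_zero[OF gt(2)] by simp
  next
    case False
    let ?k = "- ((j - 1) div int n)"
    have i: "i + int n * ?k = int (residue n j) + int (nat (i - j))"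
      unfolding int_residue[OF n] using False by simp
    have "d (i + int n * ?k) (int (residue n j)) = e (i + int n * ?k) (int (residue n j))"
      unfolding i by (rule base[OF residue_range[OF n]])
    then have "d (i + int n * ?k) (j + int n * ?k) = e (i + int n * ?k) (j + int n * ?k)"
      unfolding int_residue[OF n] .
    then show ?thesis by (simp only: gt_periodic[OF gt(1)] gt_periodic[OF gt(2)])
  qed
qed

text \<open>
  The height of the depth is the sum of the entries in the columns \<open>1, \<dots>, n\<close>. It bounds their entries and,
  as the columns decrease, also their lengths.
\<close>

lemma finite_bounded_patterns:
  assumes n: "n \<ge> 2"
  shows "finite {d. gt_pattern n d \<and> Re (height n (pattern_depth n d)) \<le> B}"
proof -
  have n0: "n > 0" using n by simp
  define N where "N = nat \<lfloor>B\<rfloor>"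
  let ?S = "{d. gt_pattern n d \<and> Re (height n (pattern_depth n d)) \<le> B}"
  let ?I = "{1..n} \<times> {..<N}"
  let ?f = "\<lambda>d. restrict (\<lambda>(j, k). d (int j + int k) (int j)) ?I"
  have col: "(\<Sum>i\<in>{i. d i (int j) \<noteq> 0}. d i (int j)) \<le> N" if d: "d \<in> ?S" and j: "j \<in> {1..n}" for d j
  proof -
    have gt: "gt_pattern n d" using d by simp
    have "(\<Sum>i\<in>{i. d i (int j) \<noteq> 0}. d i (int j)) \<le> (\<Sum>j=1..n. \<Sum>i\<in>{i. d i (int j) \<noteq> 0}. d i (int j))"
      using j by (intro member_le_sum) auto
    also have "real \<dots> \<le> B" using d by (simp add: height_pattern_depth[OF gt n] del: of_nat_sum)
    finally show ?thesis unfolding N_def by linarith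
  qed
  have le: "d i (int j) \<le> N" if d: "d \<in> ?S" and j: "j \<in> {1..n}" for d i j
  proof (cases "d i (int j) = 0")
    case False
    then have "d i (int j) \<le> (\<Sum>i\<in>{i. d i (int j) \<noteq> 0}. d i (int j))"
      using d col_finite[of n d "int j"] n0 by (intro member_le_sum) auto
    then show ?thesis using col[OF d j] by simp
  qed simp
  have zero: "d i (int j) = 0" if d: "d \<in> ?S" and j: "j \<in> {1..n}" and i: "i \<ge> int j + int N" for d i j
  proof (rule ccontr)
    assume nz: "d i (int j) \<noteq> 0"
    have gt: "gt_pattern n d" using d by simp
    have pos: "d k (int j) \<ge> 1" if "k \<in> {int j..i}" for k
      using gt_antimono[OF gt, of "int j" k i] nz that by simp
    have "i - int j + 1 = int (card {int j..i})" using i by simp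
    also have "card {int j..i} = (\<Sum>k\<in>{int j..i}. 1)" by simp
    also have "\<dots> \<le> (\<Sum>k\<in>{int j..i}. d k (int j))" by (intro sum_mono pos)
    also have "\<dots> \<le> (\<Sum>k\<in>{k. d k (int j) \<noteq> 0}. d k (int j))"
    proof (rule sum_mono2)
      show "{int j..i} \<subseteq> {k. d k (int j) \<noteq> 0}" using pos by fastforce
    qed (use col_finite[OF gt n0] in auto)
    also have "\<dots> \<le> N" by (rule col[OF d j])
    finally show False using i by simp
  qed
  have "inj_on ?f ?S"
  proof (rule inj_onI)
    fix d e assume d: "d \<in> ?S" and e: "e \<in> ?S" and eq: "?f d = ?f e"
    have gt: "gt_pattern n d" "gt_pattern n e" using d e by simp_all
    show "d = e"
    proof (rule gt_eqI[OF n0 gt])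
      fix j k assume j: "j \<in> {1..n}"
      show "d (int j + int k) (int j) = e (int j + int k) (int j)"
      proof (cases "k < N")
        case True
        have "?f d (j, k) = ?f e (j, k)" using eq by (rule fun_cong)
        then show ?thesis using True j by simp
      next
        case False
        then show ?thesis using zero[OF d j, of "int j + int k"] zero[OF e j, of "int j + int k"] by simp
      qed
    qed
  qed
  moreover have "?f ` ?S \<subseteq> ?I \<rightarrow>\<^sub>E {..N}"
  proof (intro image_subsetI PiE_I)
    fix d p assume d: "d \<in> ?S" and p: "p \<in> ?I"
    obtain j k where "p = (j, k)" "j \<in> {1..n}" using p by blast
    then show "?f d p \<in> {..N}" using p le[OF d] by simp
  qed (simp only: restrict_apply if_False)
  then have "finite (?f ` ?S)" by (rule finite_subset) (intro finite_PiE, auto)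
  ultimately show ?thesis by (rule finite_imageD[rotated])
qed

section \<open>The sign-reversing involution\<close>

text \<open>
  Abscissa and level of the cut on path \<open>j\<close>: the translate of the point \<open>(i, h)\<close> that lies on it if \<open>j\<close> is
  congruent to \<open>l\<close> or \<open>r\<close>. Any other path is cut at its starting abscissa, where nothing changes.
\<close>

definition swap_col :: "nat \<Rightarrow> int \<Rightarrow> int \<Rightarrow> int \<Rightarrow> int \<Rightarrow> int" where
  "swap_col n l r i j = (if j mod int n = l mod int n then i + (j - l)
     else if j mod int n = r mod int n then i + (j - r) else j)"

definition swap_level :: "nat \<Rightarrow> (int \<Rightarrow> complex) \<Rightarrow> pattern \<Rightarrow> int \<Rightarrow> int \<Rightarrow> complex \<Rightarrow> int \<Rightarrow> nat" where
  "swap_level n g d l r h j = (if j mod int n = l mod int n then nat \<lfloor>Re (h + g l)\<rfloor>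
     else if j mod int n = r mod int n then nat \<lfloor>Re (h + g r)\<rfloor> else d j j)"

definition exchange :: "nat \<Rightarrow> (int \<Rightarrow> complex) \<Rightarrow> pattern \<Rightarrow> int \<Rightarrow> int \<Rightarrow> int \<times> complex \<Rightarrow> pattern" where
  "exchange n g d l r q = tail_swap (swap_index n l r) (swap_col n l r (fst q)) (swap_level n g d l r (snd q)) d"

locale crossing_pair =
  fixes n :: nat and \<kappa> :: complex and g :: "int \<Rightarrow> complex" and d :: pattern
    and l r :: int and q :: "int \<times> complex"
  assumes n: "n > 0" and gt: "gt_pattern n d" and per: "quasi_periodic n \<kappa> g" and \<kappa>: "Re \<kappa> > 0"
    and neq: "l \<noteq> r" and on_l: "on_path g d l q" and on_r: "on_path g d r q"
begin

lemma incongruent: "l mod int n \<noteq> r mod int n"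
  using congruent_paths_disjoint[OF gt per \<kappa> on_l on_r] neq by blast

abbreviation "\<tau> \<equiv> swap_index n l r"
abbreviation "thr \<equiv> swap_col n l r (fst q)"
abbreviation "T \<equiv> swap_level n g d l r (snd q)"

lemma at_l: "\<tau> (l + int n * k) = r + int n * k" "thr (l + int n * k) = fst q + int n * k" "T (l + int n * k) = T l"
  by (simp_all add: swap_index_def swap_col_def swap_level_def)

lemma at_r: "\<tau> (r + int n * k) = l + int n * k" "thr (r + int n * k) = fst q + int n * k" "T (r + int n * k) = T r"
  using incongruent by (simp_all add: swap_index_def swap_col_def swap_level_def)

lemma at_other:
  assumes "j mod int n \<noteq> l mod int n" "j mod int n \<noteq> r mod int n"
  shows "\<tau> j = j" "thr j = j" "T j = d j j"
  using assms by (simp_all add: swap_index_def swap_col_def swap_level_def)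

lemma level_l: "snd q + g l = of_nat (T l)" "d (fst q) l \<le> T l" "l < fst q \<Longrightarrow> T l \<le> d (fst q - 1) l" "l \<le> fst q"
proof -
  obtain t where t: "snd q + g l = of_nat t" "d (fst q) l \<le> t" "l < fst q \<longrightarrow> t \<le> d (fst q - 1) l"
    using on_l by (auto simp: on_path_def)
  have "T l = t" by (simp add: swap_level_def t(1))
  with t show "snd q + g l = of_nat (T l)" "d (fst q) l \<le> T l" "l < fst q \<Longrightarrow> T l \<le> d (fst q - 1) l" by auto
  show "l \<le> fst q" using on_l by (simp add: on_path_def)
qed

lemma level_r: "snd q + g r = of_nat (T r)" "d (fst q) r \<le> T r" "r < fst q \<Longrightarrow> T r \<le> d (fst q - 1) r" "r \<le> fst q"
proof -
  obtain t where t: "snd q + g r = of_nat t" "d (fst q) r \<le> t" "r < fst q \<longrightarrow> t \<le> d (fst q - 1) r"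
    using on_r by (auto simp: on_path_def)
  have "T r = t" using incongruent by (simp add: swap_level_def t(1))
  with t show "snd q + g r = of_nat (T r)" "d (fst q) r \<le> T r" "r < fst q \<Longrightarrow> T r \<le> d (fst q - 1) r" by auto
  show "r \<le> fst q" using on_r by (simp add: on_path_def)
qed

lemma difference: "g l - g r = of_nat (T l) - of_nat (T r)"
  using level_l(1) level_r(1) by (simp flip: level_l(1) level_r(1))

sublocale swap_data n d g \<tau> thr T
proof
  show "n > 0" "gt_pattern n d" by (rule n, rule gt)
  show "\<tau> (\<tau> j) = j" for j by (rule swap_index_invol[OF incongruent])
  have pred: "fst q + int n * k - 1 = (fst q - 1) + int n * k" for k by simp
  show "thr (\<tau> j) = thr j" for j
    by (rule congruence_cases[of j l n _ r]) (simp_all add: at_l at_r at_other)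
  show "j \<le> thr j" for j
    by (rule congruence_cases[of j l n _ r]) (simp_all only: at_l at_r add_le_cancel_right level_l level_r, simp add: at_other)
  show "\<exists>K. \<forall>j. thr j \<le> j + K"
  proof (intro exI allI)
    fix j
    have "fst q - l \<le> \<bar>fst q - l\<bar> + \<bar>fst q - r\<bar>" "fst q - r \<le> \<bar>fst q - l\<bar> + \<bar>fst q - r\<bar>" by linarith+
    then show "thr j \<le> j + (\<bar>fst q - l\<bar> + \<bar>fst q - r\<bar>)" by (simp add: swap_col_def)
  qed
  show "\<tau> (j + int n) = \<tau> j + int n" for j using swap_index_shift[of n l r j 1] by simp
  show "thr (j + int n) = thr j + int n" for j by (simp add: swap_col_def)
  show "T (j + int n) = T j" for j using gt_periodic[OF gt, of j 1 j] by (simp add: swap_level_def)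
  show "of_nat (T (\<tau> j)) - g (\<tau> j) = of_nat (T j) - g j" for j
    by (rule congruence_cases[of j l n _ r])
      (simp_all only: at_l at_r quasi_periodicD[OF per] level_l(1)[symmetric] level_r(1)[symmetric],
        simp_all add: at_other)
  show "d (thr j) j \<le> T j" for j
    by (rule congruence_cases[of j l n _ r]) (simp_all only: at_l at_r gt_periodic[OF gt] level_l level_r, simp add: at_other)
  show "T j \<le> d (thr j - 1) j" if "j < thr j" for j
    using that
    by (rule_tac congruence_cases[of j l n _ r])
      (simp_all only: at_l at_r gt_periodic[OF gt] pred level_l level_r add_less_cancel_right, simp add: at_other)
qed

abbreviation "d_new \<equiv> exchange n g d l r q"
abbreviation "g_new \<equiv> g \<circ> \<tau>"

lemma d_new_eq: "d_new = tail_swap \<tau> thr T d"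
  by (simp add: exchange_def)

lemma gt_exchange: "gt_pattern n d_new"
  unfolding d_new_eq by (rule gt_tail_swap)

lemma crossings_exchange: "crossings g_new d_new = crossings g d"
  unfolding d_new_eq by (rule crossings_swap)

text \<open>
  Other translates of \<open>l\<close> and \<open>r\<close> do not pass through \<open>q\<close>. So the same paths pass through \<open>q\<close> after the
  exchange, and a choice of two of them can be repeated.
\<close>

lemma on_path_exchange: "on_path g_new d_new j q \<longleftrightarrow> on_path g d j q"
proof -
  have off: "\<not> on_path g d (a + int n * k) q" if "on_path g d a q" "k \<noteq> 0" for a k
    using congruent_paths_disjoint[OF gt per \<kappa> that(1), of "a + int n * k"] that(2) n by auto
  show ?thesis
  proof (rule congruence_cases[of j l n _ r])
    fix k assume j: "j = l + int n * k"
    then show ?thesis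
      using on_l on_r off[OF on_l, of k] off[OF on_r, of k]
      unfolding d_new_eq on_path_swap j at_l by (cases "k = 0") auto
  next
    fix k assume j: "j = r + int n * k"
    then show ?thesis
      using on_l on_r off[OF on_l, of k] off[OF on_r, of k]
      unfolding d_new_eq on_path_swap j at_r by (cases "k = 0") auto
  next
    assume "j mod int n \<noteq> l mod int n" "j mod int n \<noteq> r mod int n"
    then show ?thesis unfolding d_new_eq on_path_swap by (simp add: at_other)
  qed
qed

lemma exchange_exchange: "exchange n g_new d_new l r q = d"
proof -
  have "swap_level n g_new d_new l r (snd q) j = T (\<tau> j)" for j
  proof (rule congruence_cases[of j l n _ r])
    fix k assume j: "j = l + int n * k"
    have "g_new l = g r" using at_l(1)[of 0] by simp
    moreover have "T (\<tau> j) = T r" unfolding j at_l at_r ..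
    moreover have "T r = nat \<lfloor>Re (snd q + g r)\<rfloor>" unfolding level_r(1) by simp
    ultimately show ?thesis by (simp add: swap_level_def[of n g_new] j)
  next
    fix k assume j: "j = r + int n * k"
    have "g_new r = g l" using at_r(1)[of 0] by simp
    moreover have "T (\<tau> j) = T l" unfolding j at_r at_l ..
    moreover have "T l = nat \<lfloor>Re (snd q + g l)\<rfloor>" unfolding level_l(1) by simp
    ultimately show ?thesis using incongruent by (simp add: swap_level_def[of n g_new] j)
  next
    assume j: "j mod int n \<noteq> l mod int n" "j mod int n \<noteq> r mod int n"
    have "d_new j j = d j j" using after[of j j] at_other[OF j] unfolding d_new_eq by simp
    then show ?thesis using j by (simp add: swap_level_def[of n g_new] at_other)
  qed
  then have "swap_level n g_new d_new l r (snd q) = T \<circ> \<tau>" by auto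
  then show ?thesis
    using swap_swap unfolding exchange_def[of n g_new] d_new_eq by simp
qed

text \<open>
  Before the cut all entries of column \<open>l\<close> change by \<open>g r - g l\<close> and those of column \<open>r\<close> by the opposite
  amount; the tails are only exchanged. The simple roots \<open>\<alpha>\<^sub>i\<close> from \<open>l\<close> up to the cut sum up to \<open>E\<^sub>l\<close> minus the
  vector \<open>E\<close> at the cut, and the latter cancels against the contribution of \<open>r\<close>.
\<close>

lemma pattern_depth_exchange:
  assumes n2: "n \<ge> 2"
  shows "pattern_depth n d_new = pattern_depth n d - wscale (g l - g r) (ext_eps n l - ext_eps n r)"
proof -
  let ?c = "col_depth n d" and ?c' = "col_depth n d_new"
  let ?f = "\<lambda>d j i. wscale (of_nat (d i j)) (alpha n i)"
  have cancel_four: "(A + x + D) + (C + y + B) - ((A + B) + (C + D)) = x + y" for A B C D x y :: weight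
    by (simp add: algebra_simps)
  obtain K where K: "\<And>i j. d i j \<noteq> 0 \<Longrightarrow> i \<le> j + int K"
    using gt_bounded_support[OF gt n] by blast
  obtain K' where K': "\<And>i j. d_new i j \<noteq> 0 \<Longrightarrow> i \<le> j + int K'"
    using gt_bounded_support[OF gt_exchange n] by blast
  define M where "M = max (fst q) (max l r + int K + int K' + 1)"
  have M: "fst q \<le> M" "d i l \<noteq> 0 \<Longrightarrow> i < M" "d i r \<noteq> 0 \<Longrightarrow> i < M" "d_new i l \<noteq> 0 \<Longrightarrow> i < M"
    "d_new i r \<noteq> 0 \<Longrightarrow> i < M" for i
    using K[of i l] K[of i r] K'[of i l] K'[of i r] unfolding M_def by linarith+
  have split: "(\<Sum>i\<in>{j..<M}. F i) = (\<Sum>i\<in>{j..<fst q}. F i) + (\<Sum>i\<in>{fst q..<M}. F i)"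
    if "j \<le> fst q" for j and F :: "int \<Rightarrow> weight"
    using sum.union_disjoint[of "{j..<fst q}" "{fst q..<M}" F] that M(1)
    by (simp add: ivl_disj_un ivl_disj_int)
  have head: "(\<Sum>i\<in>{j..<fst q}. ?f d_new j i) = (\<Sum>i\<in>{j..<fst q}. ?f d j i) +
      wscale (of_nat (T (\<tau> j)) - of_nat (T j)) (ext_eps n j - ext_eps n (fst q))"
    if j: "j \<le> fst q" "thr j = fst q" for j
  proof -
    have "?f d_new j i = ?f d j i + wscale (of_nat (T (\<tau> j)) - of_nat (T j)) (alpha n i)"
      if i: "i \<in> {j..<fst q}" for i
    proof -
      have "int (d_new i j) = int (d i j) + int (T (\<tau> j)) - int (T j)"
        unfolding d_new_eq using i j by (intro before) auto
      then have "(of_int (int (d_new i j)) :: complex) = of_int (int (d i j) + int (T (\<tau> j)) - int (T j))"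
        by (rule arg_cong)
      then have "(of_nat (d_new i j) :: complex) = of_nat (d i j) + (of_nat (T (\<tau> j)) - of_nat (T j))" by simp
      then show ?thesis by (simp only: wv.scale_left_distrib)
    qed
    then have "(\<Sum>i\<in>{j..<fst q}. ?f d_new j i) =
        (\<Sum>i\<in>{j..<fst q}. ?f d j i + wscale (of_nat (T (\<tau> j)) - of_nat (T j)) (alpha n i))"
      by (rule sum.cong[OF refl])
    also have "\<dots> = (\<Sum>i\<in>{j..<fst q}. ?f d j i) +
        wscale (of_nat (T (\<tau> j)) - of_nat (T j)) (alpha_seg n j (fst q))"
      by (simp only: sum.distrib wv.scale_sum_right alpha_seg_def)
    finally show ?thesis unfolding alpha_seg_eq[OF n2 j(1)] .
  qed
  have tail: "(\<Sum>i\<in>{fst q..<M}. ?f d_new j i) = (\<Sum>i\<in>{fst q..<M}. ?f d (\<tau> j) i)"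
    if j: "thr j = fst q" for j
    by (intro sum.cong refl) (use j after[of j] in \<open>simp add: d_new_eq\<close>)
  have upto: "?c l = (\<Sum>i\<in>{l..<M}. ?f d l i)" "?c r = (\<Sum>i\<in>{r..<M}. ?f d r i)"
    "?c' l = (\<Sum>i\<in>{l..<M}. ?f d_new l i)" "?c' r = (\<Sum>i\<in>{r..<M}. ?f d_new r i)"
    by (rule col_depth_upto[OF gt n] col_depth_upto[OF gt_exchange n], rule M, assumption)+
  have \<tau>: "\<tau> l = r" "\<tau> r = l" "thr l = fst q" "thr r = fst q"
    using at_l[of 0] at_r[of 0] by simp_all
  define z :: complex where "z = of_nat (T r) - of_nat (T l)"
  have z: "g l - g r = - z" "of_nat (T l) - of_nat (T r) = - z"
    using difference by (simp_all add: z_def)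
  have l: "?c' l = (\<Sum>i\<in>{l..<fst q}. ?f d l i) + wscale z (ext_eps n l - ext_eps n (fst q)) +
      (\<Sum>i\<in>{fst q..<M}. ?f d r i)"
    unfolding upto(3) split[OF level_l(4)] head[OF level_l(4) \<tau>(3)] tail[OF \<tau>(3)] \<tau> z_def ..
  have r: "?c' r = (\<Sum>i\<in>{r..<fst q}. ?f d r i) + wscale (- z) (ext_eps n r - ext_eps n (fst q)) +
      (\<Sum>i\<in>{fst q..<M}. ?f d l i)"
    unfolding upto(4) split[OF level_r(4)] head[OF level_r(4) \<tau>(4)] tail[OF \<tau>(4)] \<tau> z(2) ..
  have "?c' l + ?c' r - (?c l + ?c r) =
      wscale z (ext_eps n l - ext_eps n (fst q)) + wscale (- z) (ext_eps n r - ext_eps n (fst q))"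
    unfolding l r unfolding upto(1,2) split[OF level_l(4)] split[OF level_r(4)] by (rule cancel_four)
  also have "\<dots> = wscale z (ext_eps n l - ext_eps n r)"
    by (simp add: wv.scale_right_diff_distrib)
  finally have two: "?c' l + ?c' r - (?c l + ?c r) = wscale z (ext_eps n l - ext_eps n r)" .
  have other: "?c' j = ?c j" if j: "j mod int n \<noteq> l mod int n" "j mod int n \<noteq> r mod int n" for j
  proof -
    have "d_new i j = d i j" for i
      using at_other[OF j] after[of j i] gt_zero[OF gt, of i j] unfolding d_new_eq
      by (cases "i < j") (simp_all add: tail_swap_def)
    then show ?thesis by (simp add: col_depth_def)
  qed
  have res: "residue n l \<noteq> residue n r" "residue n l \<in> {1..n}" "residue n r \<in> {1..n}"
    using incongruent residue_eq_iff[OF n] residue_range[OF n] by blast+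
  have "pattern_depth n d_new - pattern_depth n d = (\<Sum>j=1..n. ?c' (int j) - ?c (int j))"
    unfolding pattern_depth_columns[OF gt n] pattern_depth_columns[OF gt_exchange n] by (rule sum_subtractf[symmetric])
  also have "\<dots> = (\<Sum>j\<in>{residue n l, residue n r}. ?c' (int j) - ?c (int j))"
  proof (rule sum.mono_neutral_right)
    show "\<forall>j\<in>{1..n} - {residue n l, residue n r}. ?c' (int j) - ?c (int j) = 0"
    proof
      fix j assume j: "j \<in> {1..n} - {residue n l, residue n r}"
      then have "residue n (int j) \<noteq> residue n l" "residue n (int j) \<noteq> residue n r"
        by (simp_all add: residue_of_nat)
      then have "?c' (int j) = ?c (int j)" unfolding residue_eq_iff[OF n] by (rule other)
      then show "?c' (int j) - ?c (int j) = 0" by simp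
    qed
  qed (use res in auto)
  also have "\<dots> = (?c' l - ?c l) + (?c' r - ?c r)"
    using res(1) by (simp add: col_depth_residue[OF gt n] col_depth_residue[OF gt_exchange n])
  also have "\<dots> = wscale z (ext_eps n l - ext_eps n r)" unfolding two[symmetric] by (simp add: algebra_simps)
  finally have "pattern_depth n d_new - pattern_depth n d = wscale z (ext_eps n l - ext_eps n r)" .
  then have "pattern_depth n d_new = pattern_depth n d + wscale z (ext_eps n l - ext_eps n r)"
    by (metis add.commute diff_add_cancel)
  then show ?thesis unfolding z(1) by (simp add: wv.scale_minus_left)
qed

end

context dominant_weight
begin

lemma int_weyl_in_Bij: "w \<in> int_weyl n \<Lambda> \<Longrightarrow> w \<in> Bij (hdual n)"
  using int_weyl_word[of w] word_in_Bij by metis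

lemma orbit_in_hdual: "w \<in> int_weyl n \<Lambda> \<Longrightarrow> w v0 \<in> hdual n"
  using int_weyl_in_Bij v0_in Bij_imp_funcset by blast

lemma orbit_lattice: "w \<in> int_weyl n \<Lambda> \<Longrightarrow> w v0 - v0 \<in> lattice_weights"
  using int_weyl_word[of w] orbit_in_lattice by metis

lemma orbit_quasi_periodic:
  assumes "w \<in> int_weyl n \<Lambda>"
  shows "quasi_periodic n \<kappa> (coord n (w v0))"
proof -
  have "pairing n (w v0 - v0) delta = 0"
    using orbit_lattice[OF assms] by (auto simp: lattice_weights_def pairing_delta)
  then have "pairing n (w v0) delta = \<kappa>" by (simp add: pairing_diff_left level_v0)
  then show ?thesis using coord_quasi_periodic[OF n0, of "w v0"] by simp
qed

lemma orbit_linked: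
  assumes w: "w \<in> int_weyl n \<Lambda>" and "coord n (w v0) l - coord n (w v0) r \<in> \<int>"
  shows "linked l r"
proof -
  have "coord n (w v0 - v0) l - coord n (w v0 - v0) r \<in> \<int>"
    using coord_lattice(1)[OF n0 orbit_lattice[OF w], of l] coord_lattice(1)[OF n0 orbit_lattice[OF w], of r]
    by (rule Ints_diff)
  from Ints_diff[OF assms(2) this] show ?thesis by (simp add: linked_def coord_diff)
qed

text \<open>
  Permitted patterns carry inequalities for incongruent \<open>l\<close> and \<open>r\<close> only; paths with congruent indices do
  not meet by \<open>congruent_paths_disjoint\<close>.
\<close>

lemma permitted_iff_no_crossings:
  "permitted n \<Lambda> = {d. gt_pattern n d \<and> crossings y d = {}}"
proof -
  have yy: "yy n \<Lambda> l - yy n \<Lambda> r = y l - y r" for l r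
    using yy_diff_coord[OF n] by (simp add: v0_def)
  show ?thesis
  proof (intro Set.set_eqI iffI)
    fix d assume d: "d \<in> permitted n \<Lambda>"
    then have gt: "gt_pattern n d" by (simp add: permitted_def)
    have perm: "int (d i l) \<le> int (d (i + 1) r) + m - 1"
      if "l < r" "l mod int n \<noteq> r mod int n" "y l - y r = of_int m" "r - 1 \<le> i" for l r i m
      using d that unfolding permitted_def yy by blast
    have no: False if lr: "l < r" and on: "on_path y d l q" "on_path y d r q" for l r q
    proof -
      have neq: "l mod int n \<noteq> r mod int n"
        using congruent_paths_disjoint[OF gt y_periodic level on] lr by auto
      obtain i h where q: "q = (i, h)" by (cases q)
      obtain t where t: "h + y l = of_nat t" "l < i \<longrightarrow> t \<le> d (i - 1) l"
        using on(1) by (auto simp: on_path_def q)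
      obtain s where s: "h + y r = of_nat s" "d i r \<le> s" "r \<le> i"
        using on(2) by (auto simp: on_path_def q)
      have "y l - y r = of_int (int t - int s)"
        using t(1) s(1) by (simp flip: t(1) s(1))
      then have "int (d (i - 1) l) \<le> int (d (i - 1 + 1) r) + (int t - int s) - 1"
        using s(3) by (intro perm[OF lr neq]) auto
      then show False using t(2) s(2,3) lr by simp
    qed
    have "crossings y d = {}"
    proof (rule equals0I)
      fix q assume "q \<in> crossings y d"
      then obtain a b where ab: "a \<noteq> b" "on_path y d a q" "on_path y d b q"
        unfolding crossings_def by blast
      then consider "a < b" | "b < a" by linarith
      then show False
      proof cases
        case 1
        then show False using ab(2,3) by (rule no)
      next
        case 2
        then show False using ab(3,2) by (rule no)
      qed
    qed
    with gt show "d \<in> {d. gt_pattern n d \<and> crossings y d = {}}" by simp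
  next
    fix d assume "d \<in> {d. gt_pattern n d \<and> crossings y d = {}}"
    then show "d \<in> permitted n \<Lambda>"
      unfolding permitted_def yy using no_crossings_imp_less[of n d y] by blast
  qed
qed

lemma no_crossings_imp_one:
  assumes w: "w \<in> int_weyl n \<Lambda>" and gt: "gt_pattern n d" and none: "crossings (coord n (w v0)) d = {}"
  shows "w = \<one>\<^bsub>BijGroup (hdual n)\<^esub>"
proof -
  obtain ss where ss: "set ss \<subseteq> refl n ` int_roots n \<Lambda>" "w = word_prod n ss"
    by (rule int_weyl_word[OF w])
  have "w v0 = v0"
    using orbit_dominant_unique[OF ss(1)] no_crossings_imp_decreasing[OF gt n0 none] unfolding ss(2) by blast
  then show ?thesis using word_stabilizer[OF ss(1)] ss(2) by simp
qed

definition configs :: "weight \<Rightarrow> (pattern \<times> (weight \<Rightarrow> weight)) set" where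
  "configs \<nu> = {(d, w). gt_pattern n d \<and> w \<in> int_weyl n \<Lambda> \<and> w v0 - pattern_depth n d = \<nu>}"

lemma finite_configs: "finite (configs \<nu>)"
proof -
  obtain B where B: "\<And>w. w \<in> int_weyl n \<Lambda> \<Longrightarrow> Re (height n (w v0)) \<le> B"
    using orbit_height_bounded by blast
  let ?D = "{d. gt_pattern n d \<and> Re (height n (pattern_depth n d)) \<le> B - Re (height n \<nu>)}"
  have "inj_on fst (configs \<nu>)"
  proof (rule inj_onI)
    fix x x' assume x: "x \<in> configs \<nu>" "x' \<in> configs \<nu>" "fst x = fst x'"
    obtain d w w' where eq: "x = (d, w)" "x' = (d, w')" using x(3) by (cases x, cases x') auto
    have w: "w \<in> int_weyl n \<Lambda>" "w' \<in> int_weyl n \<Lambda>" using x by (simp_all add: configs_def eq)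
    have "w v0 = \<nu> + pattern_depth n d" "w' v0 = \<nu> + pattern_depth n d"
      using x by (auto simp: configs_def eq)
    then have "w = w'" by (intro int_weyl_orbit_inj[OF w]) simp
    then show "x = x'" by (simp add: eq)
  qed
  moreover have "fst ` configs \<nu> \<subseteq> ?D"
  proof (intro image_subsetI)
    fix x assume "x \<in> configs \<nu>"
    then obtain d w where x: "x = (d, w)" "gt_pattern n d" "w \<in> int_weyl n \<Lambda>" "w v0 - pattern_depth n d = \<nu>"
      by (auto simp: configs_def)
    have "height n \<nu> = height n (w v0) - height n (pattern_depth n d)"
      unfolding x(4)[symmetric] by (rule height_diff)
    then show "fst x \<in> ?D" using x B[OF x(3)] by simp
  qed
  then have "finite (fst ` configs \<nu>)" using finite_bounded_patterns[OF n] by (rule finite_subset)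
  ultimately show ?thesis by (rule finite_imageD[rotated])
qed

definition weyl_sign :: "(weight \<Rightarrow> weight) \<Rightarrow> int" where
  "weyl_sign w = (-1) ^ coxeter_length n \<Lambda> w"

text \<open>
  The choices depend only on the set of meeting points and on the set of paths through the chosen one,
  both of which are preserved by the exchange.
\<close>

definition crossing_point :: "(int \<Rightarrow> complex) \<Rightarrow> pattern \<Rightarrow> int \<times> complex" where
  "crossing_point g d = (SOME q. q \<in> crossings g d)"

definition crossing_indices :: "(int \<Rightarrow> complex) \<Rightarrow> pattern \<Rightarrow> int \<times> int" where
  "crossing_indices g d = (SOME p. fst p \<noteq> snd p \<and> on_path g d (fst p) (crossing_point g d) \<and>
     on_path g d (snd p) (crossing_point g d))"

definition flip_config :: "pattern \<times> (weight \<Rightarrow> weight) \<Rightarrow> pattern \<times> (weight \<Rightarrow> weight)" where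
  "flip_config = (\<lambda>(d, w). let g = coord n (w v0); (l, r) = crossing_indices g d in
     (exchange n g d l r (crossing_point g d), reflect n l r \<otimes>\<^bsub>BijGroup (hdual n)\<^esub> w))"

text \<open>
  With \<open>g\<close> the coordinates of \<open>w (\<Lambda> + \<rho>)\<close>, both \<open>w (\<Lambda> + \<rho>)\<close> and the depth of the pattern change by
  \<open>(g l - g r) (E\<^sub>l - E\<^sub>r)\<close>, so the weight of the pair is preserved. Meeting paths have ends that
  differ by an integer, so the reflection is integral.
\<close>

lemma flip_config:
  assumes c: "(d, w) \<in> configs \<nu>" and cross: "crossings (coord n (w v0)) d \<noteq> {}"
    and flip: "flip_config (d, w) = (d', w')"
  shows "(d', w') \<in> configs \<nu>" "crossings (coord n (w' v0)) d' \<noteq> {}"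
    "weyl_sign w' = - weyl_sign w" "flip_config (d', w') = (d, w)"
proof -
  define g where "g = coord n (w v0)"
  define q where "q = crossing_point g d"
  obtain l r where lr: "crossing_indices g d = (l, r)" by (cases "crossing_indices g d")
  have gt: "gt_pattern n d" and w: "w \<in> int_weyl n \<Lambda>" and \<nu>: "w v0 - pattern_depth n d = \<nu>"
    using c by (simp_all add: configs_def)
  have per: "quasi_periodic n \<kappa> g" unfolding g_def by (rule orbit_quasi_periodic[OF w])
  obtain q0 where "q0 \<in> crossings g d" using cross unfolding g_def by blast
  then have "q \<in> crossings g d" unfolding q_def crossing_point_def by (rule someI)
  then obtain a b where "a \<noteq> b" "on_path g d a q" "on_path g d b q" unfolding crossings_def by blast
  then have ex: "\<exists>p. fst p \<noteq> snd p \<and> on_path g d (fst p) q \<and> on_path g d (snd p) q"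
    by (intro exI[of _ "(a, b)"]) simp
  have pair: "l \<noteq> r" "on_path g d l q" "on_path g d r q"
    using someI_ex[OF ex] lr unfolding crossing_indices_def q_def[symmetric] by simp_all
  interpret X: crossing_pair n \<kappa> g d l r q
    by unfold_locales (rule n0 gt per level pair)+
  have d': "d' = exchange n g d l r q" and w': "w' = reflect n l r \<otimes>\<^bsub>BijGroup (hdual n)\<^esub> w"
    using flip by (simp_all add: flip_config_def lr q_def flip: g_def)
  have "g l - g r \<in> \<int>" unfolding X.difference by simp
  then have linked: "linked l r" using orbit_linked[OF w] by (simp add: g_def)
  note reflect = int_weyl_reflect[OF w X.incongruent linked, folded w']
  have coord': "coord n (w' v0) = g \<circ> swap_index n l r"
    unfolding reflect(2) g_def using coord_refl[OF n0 X.incongruent orbit_in_hdual[OF w]] by auto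
  have "w' v0 = w v0 - wscale (g l - g r) (ext_eps n l - ext_eps n r)"
    unfolding reflect(2) refl_ext_eps[OF n0 X.incongruent orbit_in_hdual[OF w]] g_def ..
  moreover have "pattern_depth n d' = pattern_depth n d - wscale (g l - g r) (ext_eps n l - ext_eps n r)"
    unfolding d' by (rule X.pattern_depth_exchange[OF n])
  ultimately have "w' v0 - pattern_depth n d' = \<nu>" using \<nu> by simp
  moreover have "gt_pattern n d'" unfolding d' by (rule X.gt_exchange)
  ultimately show "(d', w') \<in> configs \<nu>" using reflect(1) by (simp add: configs_def)
  have cross': "crossings (coord n (w' v0)) d' = crossings g d"
    unfolding coord' d' by (rule X.crossings_exchange)
  then show "crossings (coord n (w' v0)) d' \<noteq> {}" using cross by (simp add: g_def)
  show "weyl_sign w' = - weyl_sign w" unfolding weyl_sign_def by (rule reflect(3))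
  have q': "crossing_point (coord n (w' v0)) d' = q"
    unfolding crossing_point_def cross' q_def ..
  have "on_path (coord n (w' v0)) d' j q \<longleftrightarrow> on_path g d j q" for j
    unfolding coord' d' by (rule X.on_path_exchange)
  then have lr': "crossing_indices (coord n (w' v0)) d' = (l, r)"
    unfolding lr[symmetric] crossing_indices_def q' q_def[symmetric] by simp
  have "exchange n (coord n (w' v0)) d' l r q = d"
    unfolding coord' d' by (rule X.exchange_exchange)
  then show "flip_config (d', w') = (d, w)"
    by (simp add: flip_config_def lr' q' reflect(4))
qed

text \<open>
  The involution cancels all pairs whose paths meet; the others have \<open>w = 1\<close> and a permitted pattern.
\<close>

lemma signed_count:
  "(\<Sum>(d, w)\<in>configs \<nu>. weyl_sign w) = int (card {d \<in> permitted n \<Lambda>. v0 - pattern_depth n d = \<nu>})"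
proof -
  let ?S = "configs \<nu>"
  let ?one = "\<one>\<^bsub>BijGroup (hdual n)\<^esub>"
  define X where "X = {c \<in> ?S. crossings (coord n (snd c v0)) (fst c) \<noteq> {}}"
  define Y where "Y = {c \<in> ?S. crossings (coord n (snd c v0)) (fst c) = {}}"
  let ?s = "\<lambda>c. weyl_sign (snd c)"
  have one: "?one \<in> int_weyl n \<Lambda>" "?one v0 = v0"
    using v0_in by (simp_all add: int_weyl_def generate.one BijGroup_one_apply)
  have flip: "flip_config c \<in> X \<and> flip_config (flip_config c) = c \<and> ?s (flip_config c) = - ?s c"
    if "c \<in> X" for c
  proof -
    obtain d w where c: "c = (d, w)" by (cases c)
    obtain d' w' where c': "flip_config (d, w) = (d', w')" by (cases "flip_config (d, w)")
    have "(d, w) \<in> ?S" "crossings (coord n (w v0)) d \<noteq> {}" using that by (simp_all add: X_def c)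
    from flip_config[OF this c'] show ?thesis unfolding c c' by (simp add: X_def)
  qed
  have "sum ?s X = (\<Sum>c\<in>X. ?s (flip_config c))"
    by (rule sum.reindex_bij_witness[where i = flip_config and j = flip_config]) (use flip in auto)
  also have "\<dots> = - sum ?s X" using flip by (simp flip: sum_negf)
  finally have "sum ?s X = 0" by simp
  moreover have "sum ?s ?S = sum ?s X + sum ?s Y"
  proof -
    have "?S = X \<union> Y" "X \<inter> Y = {}" by (auto simp: X_def Y_def)
    moreover have "finite X" "finite Y" using finite_configs by (simp_all add: X_def Y_def)
    ultimately show ?thesis by (simp add: sum.union_disjoint)
  qed
  moreover have "Y = (\<lambda>d. (d, ?one)) ` {d \<in> permitted n \<Lambda>. v0 - pattern_depth n d = \<nu>}"
  proof (intro equalityI subsetI)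
    fix c assume c: "c \<in> Y"
    obtain d w where dw: "c = (d, w)" by (cases c)
    have "w = ?one" using c no_crossings_imp_one by (auto simp: Y_def configs_def dw)
    then show "c \<in> (\<lambda>d. (d, ?one)) ` {d \<in> permitted n \<Lambda>. v0 - pattern_depth n d = \<nu>}"
      using c one(2) by (auto simp: Y_def configs_def dw permitted_iff_no_crossings)
  next
    fix c assume "c \<in> (\<lambda>d. (d, ?one)) ` {d \<in> permitted n \<Lambda>. v0 - pattern_depth n d = \<nu>}"
    then show "c \<in> Y" using one by (auto simp: Y_def configs_def permitted_iff_no_crossings)
  qed
  moreover have "?s (d, ?one) = 1" for d :: pattern
    using int_weyl_sign[OF one(1), of "[]"] by (simp add: weyl_sign_def)
  ultimately show ?thesis
    by (simp add: case_prod_beta' sum.reindex inj_on_def)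
qed

end

section \<open>Generating functions of formal exponentials\<close>

definition gen_fun :: "'a set \<Rightarrow> ('a \<Rightarrow> weight) \<Rightarrow> ('a \<Rightarrow> int) \<Rightarrow> fchar" where
  "gen_fun X \<phi> s = (\<lambda>\<nu>. \<Sum>x\<in>{x \<in> X. \<phi> x = \<nu>}. s x)"

lemma fsum_eq_gen_fun:
  assumes "\<And>i. i \<in> I \<Longrightarrow> s i \<noteq> 0"
  shows "fsum (\<lambda>i \<nu>. s i * fexp (\<phi> i) \<nu>) I = gen_fun I \<phi> s"
proof
  fix \<nu>
  have "{i \<in> I. s i * fexp (\<phi> i) \<nu> \<noteq> 0} = {i \<in> I. \<phi> i = \<nu>}"
    using assms by (auto simp: fexp_def)
  then show "fsum (\<lambda>i \<nu>. s i * fexp (\<phi> i) \<nu>) I \<nu> = gen_fun I \<phi> s \<nu>"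
    by (simp add: fsum_def gen_fun_def fexp_def)
qed

lemma gen_fun_bij:
  assumes bij: "bij_betw h X Y" and \<phi>: "\<And>x. x \<in> X \<Longrightarrow> \<psi> (h x) = \<phi> x"
    and s: "\<And>x. x \<in> X \<Longrightarrow> t (h x) = s x"
  shows "gen_fun X \<phi> s = gen_fun Y \<psi> t"
proof
  fix \<nu>
  have "bij_betw h {x \<in> X. \<phi> x = \<nu>} {y \<in> Y. \<psi> y = \<nu>}"
  proof (rule bij_betw_imageI)
    show "inj_on h {x \<in> X. \<phi> x = \<nu>}"
      by (rule inj_on_subset[OF bij_betw_imp_inj_on[OF bij]]) auto
    show "h ` {x \<in> X. \<phi> x = \<nu>} = {y \<in> Y. \<psi> y = \<nu>}"
      using bij_betw_imp_surj_on[OF bij] \<phi> by auto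
  qed
  then have "(\<Sum>x\<in>{x \<in> X. \<phi> x = \<nu>}. t (h x)) = (\<Sum>y\<in>{y \<in> Y. \<psi> y = \<nu>}. t y)"
    by (rule sum.reindex_bij_betw)
  then show "gen_fun X \<phi> s \<nu> = gen_fun Y \<psi> t \<nu>" using s by (simp add: gen_fun_def)
qed

lemma gen_fun_mult:
  assumes fin: "\<And>\<nu>. finite {p \<in> X \<times> Y. \<phi> (fst p) + \<psi> (snd p) = \<nu>}"
  shows "gen_fun X \<phi> s \<star> gen_fun Y \<psi> t =
    gen_fun (X \<times> Y) (\<lambda>p. \<phi> (fst p) + \<psi> (snd p)) (\<lambda>p. s (fst p) * t (snd p))"
proof
  fix \<nu>
  define P where "P = {p \<in> X \<times> Y. \<phi> (fst p) + \<psi> (snd p) = \<nu>}"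
  define M where "M = (\<lambda>p. \<phi> (fst p)) ` P"
  let ?f = "\<lambda>\<mu>. gen_fun X \<phi> s \<mu> * gen_fun Y \<psi> t (\<nu> - \<mu>)"
  have finP: "finite P" unfolding P_def by (rule fin)
  have fibre: "{x \<in> X. \<phi> x = \<mu>} \<times> {y \<in> Y. \<psi> y = \<nu> - \<mu>} = {p \<in> P. \<phi> (fst p) = \<mu>}" for \<mu>
    by (auto simp: P_def algebra_simps)
  have prod: "?f \<mu> = (\<Sum>p\<in>{p \<in> P. \<phi> (fst p) = \<mu>}. s (fst p) * t (snd p))" for \<mu>
    unfolding gen_fun_def sum_product sum.cartesian_product fibre by (simp add: case_prod_beta')
  have "(gen_fun X \<phi> s \<star> gen_fun Y \<psi> t) \<nu> = Sum_any ?f" by (simp add: fmult_def)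
  also have "\<dots> = sum ?f M"
  proof (rule Sum_any.expand_superset)
    show "finite M" using finP by (simp add: M_def)
    show "{\<mu>. ?f \<mu> \<noteq> 0} \<subseteq> M"
    proof
      fix \<mu> assume "\<mu> \<in> {\<mu>. ?f \<mu> \<noteq> 0}"
      then have "{p \<in> P. \<phi> (fst p) = \<mu>} \<noteq> {}" unfolding prod by fastforce
      then obtain p where "p \<in> P" "\<mu> = \<phi> (fst p)" by blast
      then show "\<mu> \<in> M" unfolding M_def by (rule image_eqI[rotated])
    qed
  qed
  also have "\<dots> = (\<Sum>p\<in>P. s (fst p) * t (snd p))"
    unfolding prod using finP by (intro sum.group) (auto simp: M_def)
  finally show "(gen_fun X \<phi> s \<star> gen_fun Y \<psi> t) \<nu> =
      gen_fun (X \<times> Y) (\<lambda>p. \<phi> (fst p) + \<psi> (snd p)) (\<lambda>p. s (fst p) * t (snd p)) \<nu>"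
    by (simp add: gen_fun_def P_def)
qed

lemma fexp_fmult: "(fexp \<Lambda> \<star> F) \<nu> = F (\<nu> - \<Lambda>)"
proof -
  have "(fexp \<Lambda> \<star> F) \<nu> = Sum_any (\<lambda>\<mu>. fexp \<Lambda> \<mu> * F (\<nu> - \<mu>))" by (simp add: fmult_def)
  also have "\<dots> = (\<Sum>\<mu>\<in>{\<Lambda>}. fexp \<Lambda> \<mu> * F (\<nu> - \<mu>))"
    by (rule Sum_any.expand_superset) (auto simp: fexp_def)
  finally show ?thesis by (simp add: fexp_def)
qed

lemma wscale_of_nat_inj:
  "\<alpha> \<noteq> 0 \<Longrightarrow> wscale (of_nat k) \<alpha> = wscale (of_nat k') \<alpha> \<longleftrightarrow> k = k'"
  using wv.scale_right_imp_eq[of \<alpha> "of_nat k" "of_nat k'"] by auto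

lemma geom_apply:
  assumes "\<alpha> \<noteq> 0"
  shows "geom \<alpha> \<nu> = (if \<exists>k. \<nu> = - wscale (of_nat k) \<alpha> then 1 else 0)"
proof (cases "\<exists>k. \<nu> = - wscale (of_nat k) \<alpha>")
  case True
  then obtain k where k: "\<nu> = - wscale (of_nat k) \<alpha>" by blast
  have "{i. fexp (- wscale (of_nat i) \<alpha>) \<nu> \<noteq> 0} = {k}"
    using wscale_of_nat_inj[OF assms] by (auto simp: fexp_def k)
  then show ?thesis using k by (auto simp: geom_def fsum_def fexp_def)
next
  case False
  then have "{i. fexp (- wscale (of_nat i) \<alpha>) \<nu> \<noteq> 0} = {}" by (auto simp: fexp_def)
  then show ?thesis using False by (auto simp: geom_def fsum_def)
qed

definition multiplicities :: "'i set \<Rightarrow> ('i \<Rightarrow> nat) set" where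
  "multiplicities I = {m. finite {i. m i \<noteq> 0} \<and> {i. m i \<noteq> 0} \<subseteq> I}"

lemma multiplicities_outside: "m \<in> multiplicities I \<Longrightarrow> i \<notin> I \<Longrightarrow> m i = 0"
  by (auto simp: multiplicities_def)

definition total_weight :: "('i \<Rightarrow> weight) \<Rightarrow> ('i \<Rightarrow> nat) \<Rightarrow> weight" where
  "total_weight a m = (\<Sum>i\<in>{i. m i \<noteq> 0}. wscale (of_nat (m i)) (a i))"

lemma total_weight_superset:
  assumes "finite A" "{i. m i \<noteq> 0} \<subseteq> A"
  shows "total_weight a m = (\<Sum>i\<in>A. wscale (of_nat (m i)) (a i))"
  unfolding total_weight_def using assms by (intro sum.mono_neutral_left) auto

lemma total_weight_cong:
  "(\<And>i. m i \<noteq> 0 \<Longrightarrow> a i = b i) \<Longrightarrow> total_weight a m = total_weight b m"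
  unfolding total_weight_def by (rule sum.cong) simp_all

text \<open>
  A term of the expanded product chooses an exponent \<open>- k \<alpha>\<close> from each factor; as the roots are nonzero,
  it is the same as a choice of the multiplicities \<open>k\<close>.
\<close>

lemma fprod_geom:
  fixes a :: "'i \<Rightarrow> weight"
  assumes nz: "\<And>i. i \<in> I \<Longrightarrow> a i \<noteq> 0"
  shows "fprod (\<lambda>i. geom (a i)) I = gen_fun (multiplicities I) (\<lambda>m. - total_weight a m) (\<lambda>_. 1)"
proof
  fix \<nu>
  let ?L = "Poly_Mapping.lookup" and ?K = "Poly_Mapping.keys"
  let ?F = "\<lambda>\<mu>. if (\<Sum>i\<in>?K \<mu>. ?L \<mu> i) = \<nu> then (\<Prod>i\<in>?K \<mu>. geom (a i) (?L \<mu> i)) else 0"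
  define A where "A = {\<mu> :: 'i \<Rightarrow>\<^sub>0 weight. ?K \<mu> \<subseteq> I \<and> (\<Sum>i\<in>?K \<mu>. ?L \<mu> i) = \<nu> \<and>
    (\<forall>i\<in>?K \<mu>. \<exists>k::nat. ?L \<mu> i = - wscale (of_nat k) (a i))}"
  define S where "S = {m \<in> multiplicities I. - total_weight a m = \<nu>}"
  have geom01: "geom (a i) \<mu> = (if \<exists>k::nat. \<mu> = - wscale (of_nat k) (a i) then 1 else 0)" if "i \<in> I" for i \<mu>
    by (rule geom_apply[OF nz[OF that]])
  have F_on: "?F \<mu> = 1" if "\<mu> \<in> A" for \<mu>
  proof -
    have "(\<Prod>i\<in>?K \<mu>. geom (a i) (?L \<mu> i)) = (\<Prod>i\<in>?K \<mu>. 1)"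
    proof (rule prod.cong[OF refl])
      fix i assume i: "i \<in> ?K \<mu>"
      then have "i \<in> I" "\<exists>k::nat. ?L \<mu> i = - wscale (of_nat k) (a i)" using that by (auto simp: A_def)
      then show "geom (a i) (?L \<mu> i) = 1" using geom01[of i "?L \<mu> i"] by simp
    qed
    then show ?thesis using that by (simp add: A_def)
  qed
  have support: "{\<mu> \<in> {\<mu>. ?K \<mu> \<subseteq> I}. ?F \<mu> \<noteq> 0} = A"
  proof (intro Set.set_eqI iffI)
    fix \<mu> assume "\<mu> \<in> {\<mu> \<in> {\<mu>. ?K \<mu> \<subseteq> I}. ?F \<mu> \<noteq> 0}"
    then have K: "?K \<mu> \<subseteq> I" and F: "?F \<mu> \<noteq> 0" by blast+
    have "(\<Sum>i\<in>?K \<mu>. ?L \<mu> i) = \<nu>" using F by meson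
    with K F have \<mu>: "?K \<mu> \<subseteq> I" "(\<Sum>i\<in>?K \<mu>. ?L \<mu> i) = \<nu>" "(\<Prod>i\<in>?K \<mu>. geom (a i) (?L \<mu> i)) \<noteq> 0"
      by simp_all
    have "\<exists>k::nat. ?L \<mu> i = - wscale (of_nat k) (a i)" if i: "i \<in> ?K \<mu>" for i
    proof (rule ccontr)
      assume "\<not> ?thesis"
      then have "geom (a i) (?L \<mu> i) = 0" using geom01[of i "?L \<mu> i"] \<mu>(1) i by (simp add: subsetD)
      then show False using \<mu>(3) i by (simp add: prod_zero_iff)
    qed
    then show "\<mu> \<in> A" using \<mu> by (simp add: A_def)
  next
    fix \<mu> assume "\<mu> \<in> A"
    with F_on[OF this] show "\<mu> \<in> {\<mu> \<in> {\<mu>. ?K \<mu> \<subseteq> I}. ?F \<mu> \<noteq> 0}" by (simp add: A_def)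
  qed
  define \<Phi> where "\<Phi> m = Abs_poly_mapping (\<lambda>i. - wscale (of_nat (m i)) (a i))" for m
  have lookup: "?L (\<Phi> m) i = - wscale (of_nat (m i)) (a i)" if "m \<in> multiplicities I" for m i
  proof -
    have "{i. - wscale (of_nat (m i)) (a i) \<noteq> 0} \<subseteq> {i. m i \<noteq> 0}" by auto
    then have "finite {i. - wscale (of_nat (m i)) (a i) \<noteq> 0}"
      using that by (auto simp: multiplicities_def intro: finite_subset)
    then show ?thesis by (simp add: \<Phi>_def Abs_poly_mapping_inverse)
  qed
  have keys: "?K (\<Phi> m) = {i. m i \<noteq> 0}" if m: "m \<in> multiplicities I" for m
  proof -
    have "a i \<noteq> 0" if "m i \<noteq> 0" for i using m that nz by (auto simp: multiplicities_def)
    then show ?thesis by (auto simp: in_keys_iff lookup[OF m])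
  qed
  have sum_eq: "(\<Sum>i\<in>?K (\<Phi> m). ?L (\<Phi> m) i) = - total_weight a m" if m: "m \<in> multiplicities I" for m
    unfolding keys[OF m] lookup[OF m] by (simp add: total_weight_def sum_negf)
  have "bij_betw \<Phi> S A"
  proof (rule bij_betw_imageI)
    show "inj_on \<Phi> S"
    proof (rule inj_onI)
      fix m m' assume m: "m \<in> S" "m' \<in> S" and eq: "\<Phi> m = \<Phi> m'"
      have mm: "m \<in> multiplicities I" "m' \<in> multiplicities I" using m by (simp_all add: S_def)
      show "m = m'"
      proof
        fix i
        show "m i = m' i"
        proof (cases "i \<in> I")
          case True
          have "wscale (of_nat (m i)) (a i) = wscale (of_nat (m' i)) (a i)"
            using lookup[OF mm(1), of i] lookup[OF mm(2), of i] unfolding eq by (simp only: neg_equal_iff_equal)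
          then show ?thesis using wscale_of_nat_inj[OF nz[OF True]] by simp
        next
          case False
          then show ?thesis using multiplicities_outside[OF mm(1)] multiplicities_outside[OF mm(2)] by simp
        qed
      qed
    qed
    show "\<Phi> ` S = A"
    proof (intro equalityI subsetI)
      fix \<mu> assume "\<mu> \<in> \<Phi> ` S"
      then obtain m where m: "m \<in> multiplicities I" "- total_weight a m = \<nu>" "\<mu> = \<Phi> m"
        by (auto simp: S_def)
      show "\<mu> \<in> A"
        unfolding A_def m(3) mem_Collect_eq sum_eq[OF m(1)]
      proof (intro conjI ballI)
        show "?K (\<Phi> m) \<subseteq> I" unfolding keys[OF m(1)] using m(1) by (simp add: multiplicities_def)
        show "- total_weight a m = \<nu>" by (rule m(2))
        show "\<exists>k::nat. ?L (\<Phi> m) i = - wscale (of_nat k) (a i)" for i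
          unfolding lookup[OF m(1)] by blast
      qed
    next
      fix \<mu> assume \<mu>: "\<mu> \<in> A"
      define m where "m i = (if i \<in> ?K \<mu> then SOME k::nat. ?L \<mu> i = - wscale (of_nat k) (a i) else 0)" for i
      have look: "?L \<mu> i = - wscale (of_nat (m i)) (a i)" for i
      proof (cases "i \<in> ?K \<mu>")
        case True
        then have "\<exists>k::nat. ?L \<mu> i = - wscale (of_nat k) (a i)" using \<mu> by (simp add: A_def)
        from someI_ex[OF this] show ?thesis using True by (simp add: m_def)
      next
        case False
        then show ?thesis by (simp add: m_def in_keys_iff)
      qed
      have "{i. m i \<noteq> 0} \<subseteq> ?K \<mu>" by (auto simp: m_def)
      moreover have "?K \<mu> \<subseteq> I" using \<mu> by (simp add: A_def)
      ultimately have mm: "m \<in> multiplicities I"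
        using finite_subset[OF _ finite_keys] unfolding multiplicities_def by blast
      have "\<mu> = \<Phi> m" by (rule poly_mapping_eqI) (simp add: look lookup[OF mm])
      moreover have "m \<in> S" using \<mu> sum_eq[OF mm] mm \<open>\<mu> = \<Phi> m\<close> by (simp add: S_def A_def)
      ultimately show "\<mu> \<in> \<Phi> ` S" by blast
    qed
  qed
  then have card: "card A = card S" by (simp add: bij_betw_same_card)
  have "fprod (\<lambda>i. geom (a i)) I \<nu> = (\<Sum>\<mu>\<in>A. ?F \<mu>)"
    unfolding fprod_def fsum_def support[symmetric] by (simp add: case_prod_beta')
  also have "\<dots> = int (card A)" using F_on by simp
  finally show "fprod (\<lambda>i. geom (a i)) I \<nu> = gen_fun (multiplicities I) (\<lambda>m. - total_weight a m) (\<lambda>_. 1) \<nu>"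
    by (simp add: card gen_fun_def S_def)
qed

definition pull_back :: "'i set \<Rightarrow> ('i \<Rightarrow> 'j) \<Rightarrow> ('j \<Rightarrow> nat) \<Rightarrow> 'i \<Rightarrow> nat" where
  "pull_back I h m i = (if i \<in> I then m (h i) else 0)"

lemma pull_back_support:
  assumes "bij_betw h I J"
  shows "bij_betw h {i. pull_back I h m i \<noteq> 0} {j \<in> J. m j \<noteq> 0}"
proof -
  have support: "{i. pull_back I h m i \<noteq> 0} = {i \<in> I. m (h i) \<noteq> 0}" by (auto simp: pull_back_def)
  show ?thesis
    unfolding support
  proof (rule bij_betw_imageI)
    show "inj_on h {i \<in> I. m (h i) \<noteq> 0}"
      by (rule inj_on_subset[OF bij_betw_imp_inj_on[OF assms]]) auto
    show "h ` {i \<in> I. m (h i) \<noteq> 0} = {j \<in> J. m j \<noteq> 0}"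
      unfolding bij_betw_imp_surj_on[OF assms, symmetric] by auto
  qed
qed

lemma pull_back_in_multiplicities:
  assumes "bij_betw h I J" and "m \<in> multiplicities J'"
  shows "pull_back I h m \<in> multiplicities I"
proof -
  have "finite {j \<in> J. m j \<noteq> 0}" using assms(2) by (simp add: multiplicities_def)
  then have "finite {i. pull_back I h m i \<noteq> 0}" using bij_betw_finite[OF pull_back_support[OF assms(1)]] by blast
  then show ?thesis by (auto simp: multiplicities_def pull_back_def)
qed

lemma total_weight_pull_back:
  assumes "bij_betw h I J"
  shows "total_weight (a \<circ> h) (pull_back I h m) = (\<Sum>j\<in>{j \<in> J. m j \<noteq> 0}. wscale (of_nat (m j)) (a j))"
proof -
  have "total_weight (a \<circ> h) (pull_back I h m) =
      (\<Sum>i\<in>{i. pull_back I h m i \<noteq> 0}. wscale (of_nat (m (h i))) (a (h i)))"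
    unfolding total_weight_def by (rule sum.cong) (auto simp: pull_back_def)
  also have "\<dots> = (\<Sum>j\<in>{j \<in> J. m j \<noteq> 0}. wscale (of_nat (m j)) (a j))"
    by (rule sum.reindex_bij_betw[OF pull_back_support[OF assms]])
  finally show ?thesis .
qed

lemma multiplicities_split:
  fixes h1 :: "'a \<Rightarrow> 'j" and h2 :: "'b \<Rightarrow> 'j" and a :: "'j \<Rightarrow> weight"
  assumes bij1: "bij_betw h1 I1 J1" and bij2: "bij_betw h2 I2 J2" and disj: "J1 \<inter> J2 = {}"
  defines "\<Psi> \<equiv> \<lambda>m. (pull_back I1 h1 m, pull_back I2 h2 m)"
  shows "bij_betw \<Psi> (multiplicities (J1 \<union> J2)) (multiplicities I1 \<times> multiplicities I2)"
    and "m \<in> multiplicities (J1 \<union> J2) \<Longrightarrow>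
      total_weight (a \<circ> h1) (fst (\<Psi> m)) + total_weight (a \<circ> h2) (snd (\<Psi> m)) = total_weight a m"
proof -
  let ?g1 = "inv_into I1 h1" and ?g2 = "inv_into I2 h2"
  have inv1: "bij_betw ?g1 J1 I1" and inv2: "bij_betw ?g2 J2 I2"
    by (rule bij_betw_inv_into[OF bij1], rule bij_betw_inv_into[OF bij2])
  \<comment> \<open>The inverse of \<open>\<Psi>\<close>; at most one of the two summands is nonzero.\<close>
  define \<Theta> where "\<Theta> = (\<lambda>(m1, m2) j. pull_back J1 ?g1 m1 j + pull_back J2 ?g2 m2 j)"
  have pull_pull: "pull_back J (inv_into I h) (pull_back I h m) j = (if j \<in> J then m j else 0)"
    if "bij_betw h I J" for I h J and m :: "'j \<Rightarrow> nat" and j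
    using bij_betw_inv_into_right[OF that, of j] bij_betwE[OF bij_betw_inv_into[OF that]]
    by (auto simp: pull_back_def)
  show "bij_betw \<Psi> (multiplicities (J1 \<union> J2)) (multiplicities I1 \<times> multiplicities I2)"
  proof (rule bij_betw_byWitness[where f' = \<Theta>])
    show "\<forall>m\<in>multiplicities (J1 \<union> J2). \<Theta> (\<Psi> m) = m"
    proof (intro ballI ext)
      fix m j assume m: "m \<in> multiplicities (J1 \<union> J2)"
      have "\<not> (j \<in> J1 \<and> j \<in> J2)" using disj by blast
      then show "\<Theta> (\<Psi> m) j = m j"
        using multiplicities_outside[OF m, of j] by (simp add: \<Theta>_def \<Psi>_def pull_pull[OF bij1] pull_pull[OF bij2])
    qed
    show "\<forall>p\<in>multiplicities I1 \<times> multiplicities I2. \<Psi> (\<Theta> p) = p"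
    proof
      fix p assume "p \<in> multiplicities I1 \<times> multiplicities I2"
      then obtain m1 m2 where p: "p = (m1, m2)" "m1 \<in> multiplicities I1" "m2 \<in> multiplicities I2" by blast
      have "pull_back I1 h1 (\<Theta> p) i = m1 i" for i
      proof (cases "i \<in> I1")
        case True
        then have "h1 i \<in> J1" "h1 i \<notin> J2" using bij_betwE[OF bij1] disj by auto
        then show ?thesis
          using True bij_betw_inv_into_left[OF bij1 True] by (simp add: p \<Theta>_def pull_back_def)
      next
        case False
        then show ?thesis using multiplicities_outside[OF p(2) False] by (simp add: pull_back_def)
      qed
      moreover have "pull_back I2 h2 (\<Theta> p) i = m2 i" for i
      proof (cases "i \<in> I2")
        case True
        then have "h2 i \<in> J2" "h2 i \<notin> J1" using bij_betwE[OF bij2] disj by auto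
        then show ?thesis
          using True bij_betw_inv_into_left[OF bij2 True] by (simp add: p \<Theta>_def pull_back_def)
      next
        case False
        then show ?thesis using multiplicities_outside[OF p(3) False] by (simp add: pull_back_def)
      qed
      ultimately have "pull_back I1 h1 (\<Theta> p) = m1" "pull_back I2 h2 (\<Theta> p) = m2" by blast+
      then show "\<Psi> (\<Theta> p) = p" by (simp only: \<Psi>_def) (simp only: p)
    qed
    show "\<Psi> ` multiplicities (J1 \<union> J2) \<subseteq> multiplicities I1 \<times> multiplicities I2"
      using pull_back_in_multiplicities[OF bij1] pull_back_in_multiplicities[OF bij2] unfolding \<Psi>_def by blast
    show "\<Theta> ` (multiplicities I1 \<times> multiplicities I2) \<subseteq> multiplicities (J1 \<union> J2)"
    proof (intro image_subsetI)
      fix p assume "p \<in> multiplicities I1 \<times> multiplicities I2"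
      then obtain m1 m2 where p: "p = (m1, m2)" "m1 \<in> multiplicities I1" "m2 \<in> multiplicities I2" by blast
      let ?m1 = "pull_back J1 ?g1 m1" and ?m2 = "pull_back J2 ?g2 m2"
      have "?m1 \<in> multiplicities J1" "?m2 \<in> multiplicities J2"
        by (rule pull_back_in_multiplicities[OF inv1 p(2)], rule pull_back_in_multiplicities[OF inv2 p(3)])
      moreover have "{j. \<Theta> p j \<noteq> 0} = {j. ?m1 j \<noteq> 0} \<union> {j. ?m2 j \<noteq> 0}" by (auto simp: \<Theta>_def p(1))
      ultimately show "\<Theta> p \<in> multiplicities (J1 \<union> J2)" unfolding multiplicities_def by auto
    qed
  qed
  assume m: "m \<in> multiplicities (J1 \<union> J2)"
  have support: "{j. m j \<noteq> 0} = {j \<in> J1. m j \<noteq> 0} \<union> {j \<in> J2. m j \<noteq> 0}"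
    using m by (auto simp: multiplicities_def)
  have "finite {j. m j \<noteq> 0}" using m by (simp add: multiplicities_def)
  then have "finite {j \<in> J1. m j \<noteq> 0}" "finite {j \<in> J2. m j \<noteq> 0}" unfolding support by simp_all
  moreover have "{j \<in> J1. m j \<noteq> 0} \<inter> {j \<in> J2. m j \<noteq> 0} = {}" using disj by blast
  ultimately have "total_weight a m =
      (\<Sum>j\<in>{j \<in> J1. m j \<noteq> 0}. wscale (of_nat (m j)) (a j)) + (\<Sum>j\<in>{j \<in> J2. m j \<noteq> 0}. wscale (of_nat (m j)) (a j))"
    unfolding total_weight_def support by (rule sum.union_disjoint)
  then show "total_weight (a \<circ> h1) (fst (\<Psi> m)) + total_weight (a \<circ> h2) (snd (\<Psi> m)) = total_weight a m"
    by (simp add: \<Psi>_def total_weight_pull_back[OF bij1] total_weight_pull_back[OF bij2])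
qed

section \<open>The generating function of all patterns\<close>

definition col_index :: "nat \<Rightarrow> (nat \<times> nat) set" where
  "col_index n = {1..n} \<times> {1..}"

text \<open>
  The number of parts \<open>k\<close> in the conjugate of the partition in column \<open>j\<close>.
\<close>

definition col_mult :: "nat \<Rightarrow> pattern \<Rightarrow> nat \<times> nat \<Rightarrow> nat" where
  "col_mult n d = (\<lambda>(j, k). if (j, k) \<in> col_index n
     then d (int j + int k - 1) (int j) - d (int j + int k) (int j) else 0)"

definition col_weight :: "nat \<Rightarrow> nat \<times> nat \<Rightarrow> weight" where
  "col_weight n = (\<lambda>(j, k). ext_eps n (int j) - ext_eps n (int j + int k))"

lemma col_mult_telescope:
  assumes gt: "gt_pattern n d" and j: "j \<in> {1..n}"
  shows "d (int j + int k) (int j) = col_mult n d (j, Suc k) + d (int j + int (Suc k)) (int j)"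
proof -
  have "d (int j + int (Suc k)) (int j) \<le> d (int j + int k) (int j)" by (rule gt_antimono[OF gt]) auto
  then show ?thesis using j by (simp add: col_mult_def col_index_def)
qed

lemma gt_vanish:
  assumes gt: "gt_pattern n d" and n: "n > 0"
  obtains K :: nat where "\<And>i j. i \<ge> j + int K \<Longrightarrow> d i j = 0"
proof -
  obtain K where K: "\<And>i j. d i j \<noteq> 0 \<Longrightarrow> i \<le> j + int K"
    using gt_bounded_support[OF gt n] by blast
  have "d i j = 0" if "i \<ge> j + int (Suc K)" for i j using K[of i j] that by (cases "d i j = 0") auto
  then show thesis by (rule that)
qed

lemma col_mult_support:
  assumes K: "\<And>i j. i \<ge> j + int K \<Longrightarrow> d i j = 0"
  shows "{p. col_mult n d p \<noteq> 0} \<subseteq> {1..n} \<times> {1..K}"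
proof
  fix p assume p: "p \<in> {p. col_mult n d p \<noteq> 0}"
  obtain j k where jk: "p = (j, k)" by (cases p)
  have "(j, k) \<in> col_index n" "d (int j + int k - 1) (int j) \<noteq> 0"
    using p by (auto simp: jk col_mult_def split: if_splits)
  moreover have "\<not> int j + int k - 1 \<ge> int j + int K" using K[of "int j" "int j + int k - 1"] calculation(2) by blast
  ultimately show "p \<in> {1..n} \<times> {1..K}" by (auto simp: jk col_index_def)
qed

lemma col_mult_in_multiplicities:
  assumes gt: "gt_pattern n d" and n: "n > 0"
  shows "col_mult n d \<in> multiplicities (col_index n)"
proof -
  obtain K :: nat where K: "\<And>i j. i \<ge> j + int K \<Longrightarrow> d i j = 0" using gt_vanish[OF gt n] by blast
  have "finite {p. col_mult n d p \<noteq> 0}" by (rule finite_subset[OF col_mult_support[OF K]]) auto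
  then show ?thesis by (auto simp: multiplicities_def col_mult_def split: if_splits)
qed

text \<open>
  Abel summation in each column: a part \<open>k\<close> of the conjugate partition contributes one to the first \<open>k\<close>
  entries of the column, and the corresponding simple roots sum up to \<open>E\<^sub>j - E\<^bsub>j+k\<^esub>\<close>.
\<close>

lemma col_mult_depth:
  assumes gt: "gt_pattern n d" and n: "n \<ge> 2"
  shows "total_weight (col_weight n) (col_mult n d) = pattern_depth n d"
proof -
  have n0: "n > 0" using n by simp
  obtain K :: nat where K: "\<And>i j. i \<ge> j + int K \<Longrightarrow> d i j = 0" using gt_vanish[OF gt n0] by blast
  let ?D = "\<lambda>j k. of_nat (d (int j + int k) (int j)) :: complex"
  let ?E = "\<lambda>j k. ext_eps n (int j + int k)"
  have abel: "(\<Sum>k<N. wscale (of_nat (col_mult n d (j, Suc k))) (col_weight n (j, Suc k))) =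
      (\<Sum>k<N. wscale (?D j k) (alpha n (int j + int k))) - wscale (?D j N) (?E j 0 - ?E j N)"
    if j: "j \<in> {1..n}" for j N
  proof (induction N)
    case 0
    show ?case by simp
  next
    case (Suc N)
    have D: "?D j N = of_nat (col_mult n d (j, Suc N)) + ?D j (Suc N)"
      using col_mult_telescope[OF gt j, of N] by simp
    have \<alpha>: "alpha n (int j + int N) = ?E j N - ?E j (Suc N)"
      by (simp add: alpha_eq_ext_eps[OF n] algebra_simps)
    have w: "col_weight n (j, Suc N) = ?E j 0 - ?E j (Suc N)" by (simp add: col_weight_def)
    let ?c = "of_nat (col_mult n d (j, Suc N)) :: complex"
    have "wscale ?c (?E j 0 - ?E j (Suc N)) - wscale (?D j N) (?E j 0 - ?E j N) =
       wscale (?D j N) (?E j N - ?E j (Suc N)) - wscale (?D j (Suc N)) (?E j 0 - ?E j (Suc N))"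
      unfolding D wv.scale_left_distrib wv.scale_right_diff_distrib by (simp add: algebra_simps)
    then show ?case unfolding sum.lessThan_Suc Suc.IH \<alpha> w by (simp add: algebra_simps)
  qed
  have col: "(\<Sum>k\<in>{1..K}. wscale (of_nat (col_mult n d (j, k))) (col_weight n (j, k))) = col_depth n d (int j)"
    if j: "j \<in> {1..n}" for j
  proof -
    have zero: "?D j K = 0" using K[of "int j" "int j + int K"] by simp
    have "(\<Sum>k\<in>{1..K}. wscale (of_nat (col_mult n d (j, k))) (col_weight n (j, k))) =
        (\<Sum>k<K. wscale (of_nat (col_mult n d (j, Suc k))) (col_weight n (j, Suc k)))"
      by (rule sum.reindex_bij_witness[where i = Suc and j = "\<lambda>k. k - 1"]) auto
    also have "\<dots> = (\<Sum>k<K. wscale (?D j k) (alpha n (int j + int k)))"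
      unfolding abel[OF j] zero by simp
    also have "\<dots> = (\<Sum>i\<in>{int j..<int j + int K}. wscale (of_nat (d i (int j))) (alpha n i))"
      by (rule sum.reindex_bij_witness[where j = "\<lambda>k. int j + int k" and i = "\<lambda>i. nat (i - int j)"]) auto
    also have "\<dots> = col_depth n d (int j)"
    proof (rule col_depth_upto[OF gt n0, symmetric])
      show "i < int j + int K" if "d i (int j) \<noteq> 0" for i
        using K[of "int j" i] that by (cases "i < int j + int K") auto
    qed
    finally show ?thesis .
  qed
  have "total_weight (col_weight n) (col_mult n d) =
      (\<Sum>p\<in>{1..n} \<times> {1..K}. wscale (of_nat (col_mult n d p)) (col_weight n p))"
    by (rule total_weight_superset[OF _ col_mult_support[OF K]]) auto
  also have "\<dots> = (\<Sum>j\<in>{1..n}. \<Sum>k\<in>{1..K}. wscale (of_nat (col_mult n d (j, k))) (col_weight n (j, k)))"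
    unfolding sum.cartesian_product by (simp add: case_prod_beta')
  also have "\<dots> = pattern_depth n d"
    unfolding pattern_depth_columns[OF gt n0] by (rule sum.cong[OF refl col])
  finally show ?thesis .
qed

definition pattern_of_mult :: "nat \<Rightarrow> (nat \<times> nat \<Rightarrow> nat) \<Rightarrow> pattern" where
  "pattern_of_mult n m i j = (if i < j then 0
     else \<Sum>k\<in>{k. m (residue n j, k) \<noteq> 0 \<and> int k > i - j}. m (residue n j, k))"

lemma mult_col_finite: "m \<in> multiplicities I \<Longrightarrow> finite {k. m (j, k) \<noteq> 0}"
proof -
  assume "m \<in> multiplicities I"
  then have "finite {p. m p \<noteq> 0}" by (simp add: multiplicities_def)
  then have "finite (snd ` {p. m p \<noteq> 0})" by (rule finite_imageI)
  moreover have "{k. m (j, k) \<noteq> 0} \<subseteq> snd ` {p. m p \<noteq> 0}" by force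
  ultimately show ?thesis by (rule rev_finite_subset)
qed

lemma gt_pattern_of_mult:
  assumes m: "m \<in> multiplicities (col_index n)" and n: "n > 0"
  shows "gt_pattern n (pattern_of_mult n m)"
  unfolding gt_pattern_def
proof (intro conjI allI impI)
  fix i j :: int assume "i < j" then show "pattern_of_mult n m i j = 0" by (simp add: pattern_of_mult_def)
next
  fix i j :: int assume "j \<le> i"
  have "(\<Sum>k\<in>{k. m (residue n j, k) \<noteq> 0 \<and> int k > i + 1 - j}. m (residue n j, k)) \<le>
      (\<Sum>k\<in>{k. m (residue n j, k) \<noteq> 0 \<and> int k > i - j}. m (residue n j, k))"
    by (rule sum_mono2) (use mult_col_finite[OF m] in auto)
  then show "pattern_of_mult n m (i + 1) j \<le> pattern_of_mult n m i j"
    using \<open>j \<le> i\<close> by (simp add: pattern_of_mult_def)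
next
  fix i j :: int
  have "residue n (j + int n) = residue n j" using residue_shift[of n j 1] by simp
  then show "pattern_of_mult n m (i + int n) (j + int n) = pattern_of_mult n m i j"
    by (simp add: pattern_of_mult_def)
next
  fix i :: int
  have "finite (snd ` {p. m p \<noteq> 0})" using m by (simp add: multiplicities_def)
  then obtain K where K: "\<And>k. k \<in> snd ` {p. m p \<noteq> 0} \<Longrightarrow> k \<le> K" by (meson finite_nat_set_iff_bounded_le)
  have "{j. j \<le> i \<and> pattern_of_mult n m i j \<noteq> 0} \<subseteq> {i - int K..i}"
  proof
    fix j assume j: "j \<in> {j. j \<le> i \<and> pattern_of_mult n m i j \<noteq> 0}"
    have "{k. m (residue n j, k) \<noteq> 0 \<and> int k > i - j} \<noteq> {}"
    proof
      assume "{k. m (residue n j, k) \<noteq> 0 \<and> int k > i - j} = {}"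
      then have "pattern_of_mult n m i j = 0" unfolding pattern_of_mult_def by (simp only: sum.empty if_cancel)
      then show False using j by simp
    qed
    then obtain k where "m (residue n j, k) \<noteq> 0" "int k > i - j" by blast
    moreover from this(1) have "k \<le> K" using K[of k] by force
    ultimately show "j \<in> {i - int K..i}" using j by auto
  qed
  then show "finite {j. j \<le> i \<and> pattern_of_mult n m i j \<noteq> 0}" by (rule finite_subset) simp
qed

lemma col_mult_bij:
  assumes n: "n > 0"
  shows "bij_betw (col_mult n) {d. gt_pattern n d} (multiplicities (col_index n))"
proof (rule bij_betw_imageI)
  show "inj_on (col_mult n) {d. gt_pattern n d}"
  proof (rule inj_onI, unfold mem_Collect_eq)
    fix d e assume gt: "gt_pattern n d" "gt_pattern n e" and eq: "col_mult n d = col_mult n e"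
    obtain K :: nat where K: "\<And>i j. i \<ge> j + int K \<Longrightarrow> d i j = 0" using gt_vanish[OF gt(1) n] by blast
    obtain K' :: nat where K': "\<And>i j. i \<ge> j + int K' \<Longrightarrow> e i j = 0" using gt_vanish[OF gt(2) n] by blast
    show "d = e"
    proof (rule gt_eqI[OF n gt])
      fix j k assume j: "j \<in> {1..n}"
      show "d (int j + int k) (int j) = e (int j + int k) (int j)"
      proof (induction "K + K' - k" arbitrary: k)
        case 0
        then show ?case using K[of "int j" "int j + int k"] K'[of "int j" "int j + int k"] by simp
      next
        case (Suc x)
        have "d (int j + int (Suc k)) (int j) = e (int j + int (Suc k)) (int j)"
          by (rule Suc.hyps(1)) (use Suc.hyps(2) in simp)
        then show ?case using col_mult_telescope[OF gt(1) j, of k] col_mult_telescope[OF gt(2) j, of k] eq by simp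
      qed
    qed
  qed
  show "col_mult n ` {d. gt_pattern n d} = multiplicities (col_index n)"
  proof (intro equalityI subsetI)
    fix m assume "m \<in> col_mult n ` {d. gt_pattern n d}"
    then show "m \<in> multiplicities (col_index n)" using col_mult_in_multiplicities[OF _ n] by blast
  next
    fix m assume m: "m \<in> multiplicities (col_index n)"
    have gt: "gt_pattern n (pattern_of_mult n m)" by (rule gt_pattern_of_mult[OF m n])
    have "col_mult n (pattern_of_mult n m) p = m p" for p
    proof (cases "p \<in> col_index n")
      case True
      obtain j k where p: "p = (j, k)" by (cases p)
      have j: "j \<in> {1..n}" and k: "k \<ge> 1" using True by (auto simp: p col_index_def)
      obtain k' where k': "k = Suc k'" using k by (cases k) auto
      let ?S = "{k. m (j, k) \<noteq> 0 \<and> k > k'}" and ?T = "{k. m (j, k) \<noteq> 0 \<and> k > Suc k'}"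
      have fin: "finite ?T" using mult_col_finite[OF m, of j] by (rule rev_finite_subset) auto
      have "sum (\<lambda>k. m (j, k)) ?S = m (j, k) + sum (\<lambda>k. m (j, k)) ?T"
      proof (cases "m (j, k) = 0")
        case True
        have "?S = ?T"
        proof (intro Set.set_eqI iffI)
          fix x assume x: "x \<in> ?S"
          then have "x \<noteq> Suc k'" using True k' by auto
          then show "x \<in> ?T" using x by simp
        qed simp
        then show ?thesis using True by simp
      next
        case False
        then have "?S = insert k ?T" using k' by auto
        moreover have "k \<notin> ?T" using k' by simp
        ultimately show ?thesis using fin by simp
      qed
      moreover have "pattern_of_mult n m (int j + int k') (int j) = sum (\<lambda>k. m (j, k)) ?S"
        "pattern_of_mult n m (int j + int (Suc k')) (int j) = sum (\<lambda>k. m (j, k)) ?T"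
      proof -
        have "int j + int t - int j < int k \<longleftrightarrow> t < k" for t k by linarith
        then show "pattern_of_mult n m (int j + int k') (int j) = sum (\<lambda>k. m (j, k)) ?S"
          "pattern_of_mult n m (int j + int (Suc k')) (int j) = sum (\<lambda>k. m (j, k)) ?T"
          unfolding pattern_of_mult_def residue_of_nat[OF j] by (simp_all only:) simp_all
      qed
      ultimately show ?thesis
        using col_mult_telescope[OF gt j, of k'] by (simp add: p k')
    next
      case False
      then show ?thesis using multiplicities_outside[OF m False] by (cases p) (simp add: col_mult_def)
    qed
    then have "col_mult n (pattern_of_mult n m) = m" by blast
    then show "m \<in> col_mult n ` {d. gt_pattern n d}"
      using gt by (intro image_eqI[of _ _ "pattern_of_mult n m"]) simp_all
  qed
qed

text \<open>
  The first index of a positive real root \<open>E\<^sub>l - E\<^sub>r\<close> can be moved into \<open>1, \<dots>, n\<close>. It is then determined by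
  the coordinates of the root, and the second one by its height.
\<close>

lemma real_root_bij:
  assumes n: "n \<ge> 2"
  shows "bij_betw (col_weight n) {(j, k) \<in> col_index n. \<not> n dvd k} (pos_real_roots n)"
proof (rule bij_betw_imageI)
  have n0: "n > 0" using n by simp
  let ?J = "{(j, k) \<in> col_index n. \<not> n dvd k}"
  have shift_mod: "(int j + int k) mod int n = int j mod int n \<longleftrightarrow> n dvd k" for j k
  proof -
    have "(int j + int k) mod int n = int j mod int n \<longleftrightarrow> int n dvd (int j + int k) - int j"
      by (rule mod_eq_dvd_iff)
    then show ?thesis by (simp only: add_diff_cancel_left' of_nat_dvd_iff)
  qed
  show "inj_on (col_weight n) ?J"
  proof (rule inj_onI)
    fix p q assume pq: "p \<in> ?J" "q \<in> ?J" and eq: "col_weight n p = col_weight n q"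
    obtain j k where p: "p = (j, k)" by (cases p)
    obtain j' k' where q: "q = (j', k')" by (cases q)
    have j: "j \<in> {1..n}" "\<not> n dvd k" and j': "j' \<in> {1..n}" "\<not> n dvd k'"
      using pq by (auto simp: p q col_index_def)
    have "coord n (col_weight n p) (int j) = coord n (col_weight n q) (int j)" by (simp add: eq)
    then have "int j mod int n = int j' mod int n"
      using shift_mod[of j k] j(2)
      by (auto simp: p q col_weight_def coord_diff coord_ext_eps[OF n0] split: if_splits)
    then have "residue n (int j) = residue n (int j')" using residue_eq_iff[OF n0] by blast
    then have jj: "j = j'" using j j' by (simp only: residue_of_nat)
    have "height n (col_weight n p) = height n (col_weight n q)" by (simp add: eq)
    then have "(of_nat k :: complex) = of_nat k'"
      by (simp add: p q col_weight_def height_diff height_ext_eps[OF n0])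
    then show "p = q" using jj by (simp add: p q)
  qed
  show "col_weight n ` ?J = pos_real_roots n"
  proof (intro equalityI subsetI)
    fix \<alpha> assume "\<alpha> \<in> col_weight n ` ?J"
    then obtain j k where jk: "\<alpha> = ext_eps n (int j) - ext_eps n (int j + int k)" "k \<ge> 1" "\<not> n dvd k"
      by (auto simp: col_weight_def col_index_def)
    have "int j < int j + int k" "int j mod int n \<noteq> (int j + int k) mod int n"
      using jk(2,3) shift_mod[of j k] by auto
    then show "\<alpha> \<in> pos_real_roots n" unfolding pos_real_roots_eq[OF n] using jk(1) by blast
  next
    fix \<alpha> assume "\<alpha> \<in> pos_real_roots n"
    then obtain l r where lr: "\<alpha> = ext_eps n l - ext_eps n r" "l < r" "l mod int n \<noteq> r mod int n"
      unfolding pos_real_roots_eq[OF n] by blast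
    let ?t = "- ((l - 1) div int n)"
    let ?j = "residue n l" and ?k = "nat (r - l)"
    have "\<alpha> = ext_eps n (l + int n * ?t) - ext_eps n (r + int n * ?t)"
      unfolding ext_eps_shift[OF n0] lr(1) by simp
    also have "r + int n * ?t = int ?j + int ?k" unfolding int_residue[OF n0] using lr(2) by simp
    also have "l + int n * ?t = int ?j" by (rule int_residue[OF n0, symmetric])
    finally have \<alpha>: "\<alpha> = col_weight n (?j, ?k)" by (simp add: col_weight_def)
    have "\<not> n dvd ?k"
    proof
      assume "n dvd ?k"
      then have "int n dvd int ?k" by (simp only: of_nat_dvd_iff)
      then have "int n dvd r - l" using lr(2) by simp
      then show False using lr(3) mod_eq_dvd_iff[of r "int n" l] by simp
    qed
    moreover have "(?j, ?k) \<in> col_index n" using residue_range[OF n0, of l] lr(2) by (simp add: col_index_def)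
    ultimately show "\<alpha> \<in> col_weight n ` ?J" using \<alpha> by (intro image_eqI[of _ _ "(?j, ?k)"]) auto
  qed
qed

lemma imaginary_bij:
  assumes n: "n > 0"
  shows "bij_betw (\<lambda>(m, c). (c, m * n)) ({1..} \<times> {1..n}) {(j, k) \<in> col_index n. n dvd k}"
proof (rule bij_betw_byWitness[where f' = "\<lambda>(j, k). (k div n, j)"])
  show "\<forall>p\<in>{1..} \<times> {1..n}. (\<lambda>(j, k). (k div n, j)) ((\<lambda>(m, c). (c, m * n)) p) = p" using n by auto
  show "\<forall>p\<in>{(j, k) \<in> col_index n. n dvd k}. (\<lambda>(m, c). (c, m * n)) ((\<lambda>(j, k). (k div n, j)) p) = p"
    by auto
  show "(\<lambda>(m, c). (c, m * n)) ` ({1..} \<times> {1..n}) \<subseteq> {(j, k) \<in> col_index n. n dvd k}"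
    using n by (auto simp: col_index_def)
  show "(\<lambda>(j, k). (k div n, j)) ` {(j, k) \<in> col_index n. n dvd k} \<subseteq> {1..} \<times> {1..n}"
    using n by (auto simp: col_index_def dvd_def)
qed

text \<open>
  The multiplicities of the pairs \<open>(j, k)\<close> with \<open>n\<close> dividing \<open>k\<close> give the factors for the imaginary roots,
  the others those for the real roots.
\<close>

lemma char_M0_patterns:
  assumes n: "n \<ge> 2"
  shows "char_M0 n = gen_fun {d. gt_pattern n d} (\<lambda>d. - pattern_depth n d) (\<lambda>_. 1)"
proof -
  have n0: "n > 0" using n by simp
  let ?I1 = "{1..} \<times> {1..n} :: (nat \<times> nat) set" and ?I2 = "pos_real_roots n"
  let ?J1 = "{(j, k) \<in> col_index n. n dvd k}" and ?J2 = "{(j, k) \<in> col_index n. \<not> n dvd k}"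
  let ?h1 = "\<lambda>(m, c). (c, m * n)" and ?h2 = "inv_into ?J2 (col_weight n)"
  let ?a1 = "\<lambda>(m, c). wscale (of_nat m) delta" and ?a2 = "\<lambda>\<alpha> :: weight. \<alpha>"
  define \<Psi> where "\<Psi> m = (pull_back ?I1 ?h1 m, pull_back ?I2 ?h2 m)" for m :: "nat \<times> nat \<Rightarrow> nat"
  have J: "?J1 \<union> ?J2 = col_index n" "?J1 \<inter> ?J2 = {}" by auto
  have bij2: "bij_betw ?h2 ?I2 ?J2" by (rule bij_betw_inv_into[OF real_root_bij[OF n]])
  note split = multiplicities_split[OF imaginary_bij[OF n0] bij2 J(2), folded \<Psi>_def, unfolded J(1)]
  have a1: "(col_weight n \<circ> ?h1) i = ?a1 i" if i: "i \<in> ?I1" for i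
  proof -
    obtain m c where mc: "i = (m, c)" by (cases i)
    have index: "int c + int (m * n) = int c + int n * int m" by simp
    have "ext_eps n (int c + int (m * n)) = ext_eps n (int c) - wscale (of_nat m) delta"
      unfolding index ext_eps_shift[OF n0] by simp
    then show ?thesis unfolding mc col_weight_def o_def prod.case by simp
  qed
  have a2: "(col_weight n \<circ> ?h2) \<alpha> = ?a2 \<alpha>" if "\<alpha> \<in> ?I2" for \<alpha>
    using bij_betw_inv_into_right[OF real_root_bij[OF n] that] by simp
  have depth: "total_weight ?a1 (fst (\<Psi> (col_mult n d))) + total_weight ?a2 (snd (\<Psi> (col_mult n d))) = pattern_depth n d"
    if gt: "gt_pattern n d" for d
  proof -
    have m: "col_mult n d \<in> multiplicities (col_index n)" by (rule col_mult_in_multiplicities[OF gt n0])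
    have "total_weight ?a1 (fst (\<Psi> (col_mult n d))) = total_weight (col_weight n \<circ> ?h1) (fst (\<Psi> (col_mult n d)))"
      by (rule total_weight_cong, rule a1[symmetric]) (auto simp: \<Psi>_def pull_back_def split: if_splits)
    moreover have "total_weight ?a2 (snd (\<Psi> (col_mult n d))) = total_weight (col_weight n \<circ> ?h2) (snd (\<Psi> (col_mult n d)))"
    proof (rule total_weight_cong, rule a2[symmetric], rule ccontr)
      fix \<alpha> assume "snd (\<Psi> (col_mult n d)) \<alpha> \<noteq> 0" "\<alpha> \<notin> ?I2"
      then show False by (simp add: \<Psi>_def pull_back_def)
    qed
    ultimately show ?thesis using split(2)[OF m, of "col_weight n"] col_mult_depth[OF gt n] by simp
  qed
  have bij: "bij_betw (\<Psi> \<circ> col_mult n) {d. gt_pattern n d} (multiplicities ?I1 \<times> multiplicities ?I2)"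
    by (rule bij_betw_trans[OF col_mult_bij[OF n0] split(1)])
  have nz1: "?a1 i \<noteq> 0" if "i \<in> ?I1" for i
    using that by (auto simp: wscale_def delta_def zero_prod_def)
  have nz2: "\<alpha> \<noteq> 0" if \<alpha>: "\<alpha> \<in> ?I2" for \<alpha>
  proof
    assume "\<alpha> = 0"
    moreover obtain l r where "\<alpha> = ext_eps n l - ext_eps n r" "l < r"
      using \<alpha> unfolding pos_real_roots_eq[OF n] by blast
    then have "height n \<alpha> = of_int (r - l)" "r - l \<noteq> 0" by (simp_all add: height_diff height_ext_eps[OF n0])
    ultimately show False using height_zero[of n] by (metis of_int_eq_0_iff)
  qed
  have fin: "finite {p \<in> multiplicities ?I1 \<times> multiplicities ?I2.
      - total_weight ?a1 (fst p) + - total_weight ?a2 (snd p) = \<nu>}" (is "finite ?S") for \<nu>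
  proof -
    have "?S \<subseteq> (\<Psi> \<circ> col_mult n) ` {d. gt_pattern n d \<and> Re (height n (pattern_depth n d)) \<le> Re (height n (- \<nu>))}"
    proof
      fix p assume p: "p \<in> ?S"
      then have "p \<in> (\<Psi> \<circ> col_mult n) ` {d. gt_pattern n d}" using bij_betw_imp_surj_on[OF bij] by blast
      then obtain d where d: "gt_pattern n d" "p = \<Psi> (col_mult n d)" by auto
      have "- total_weight ?a1 (fst p) + - total_weight ?a2 (snd p) = \<nu>" using p by blast
      then have "- pattern_depth n d = \<nu>"
        unfolding d(2) depth[OF d(1), symmetric] by simp
      then have "pattern_depth n d = - \<nu>" by (metis minus_minus)
      then show "p \<in> (\<Psi> \<circ> col_mult n) ` {d. gt_pattern n d \<and> Re (height n (pattern_depth n d)) \<le> Re (height n (- \<nu>))}"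
        using d by (intro image_eqI[of _ _ d]) auto
    qed
    then show ?thesis using finite_bounded_patterns[OF n] by (rule finite_subset[OF _ finite_imageI])
  qed
  have "char_M0 n = gen_fun (multiplicities ?I1) (\<lambda>m. - total_weight ?a1 m) (\<lambda>_. 1) \<star>
      gen_fun (multiplicities ?I2) (\<lambda>m. - total_weight ?a2 m) (\<lambda>_. 1)"
    using fprod_geom[of ?I1 ?a1, OF nz1] fprod_geom[of ?I2 ?a2, OF nz2]
    by (simp add: char_M0_def case_prod_beta')
  also have "\<dots> = gen_fun (multiplicities ?I1 \<times> multiplicities ?I2)
      (\<lambda>p. - total_weight ?a1 (fst p) + - total_weight ?a2 (snd p)) (\<lambda>_. 1 * 1)"
    by (rule gen_fun_mult[OF fin])
  also have "\<dots> = gen_fun {d. gt_pattern n d} (\<lambda>d. - pattern_depth n d) (\<lambda>_. 1)"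
  proof (rule gen_fun_bij[OF bij, symmetric])
    fix d assume "d \<in> {d. gt_pattern n d}"
    then have gt: "gt_pattern n d" by simp
    show "- total_weight ?a1 (fst ((\<Psi> \<circ> col_mult n) d)) + - total_weight ?a2 (snd ((\<Psi> \<circ> col_mult n) d)) =
      - pattern_depth n d"
      unfolding depth[OF gt, symmetric] o_def by simp
  qed simp
  finally show ?thesis .
qed

section \<open>Weight spaces and the character formula\<close>

lemma pairing_nondegenerate:
  assumes v: "v \<in> hdual n" and zero: "\<And>h. h \<in> hdual n \<Longrightarrow> pairing n v h = 0"
  shows "v = 0"
proof -
  obtain c a b where cab: "v = (c, a, b)" by (rule prod_cases3)
  \<comment> \<open>Conjugating, and exchanging the coefficients of \<open>\<delta>\<close> and \<open>\<omega>\<^sub>0\<close>, turns the bilinear form into the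
    Hermitian norm of \<open>v\<close>.\<close>
  define h where "h = (\<lambda>i. cnj (c i), cnj b, cnj a)"
  have "(\<Sum>i=1..n. cnj (c i)) = cnj (\<Sum>i=1..n. c i)" by simp
  also have "\<dots> = 0" using v by (simp add: cab hdual_def del: cnj_sum)
  finally have "h \<in> hdual n" using v by (simp add: h_def hdual_def cab)
  then have "pairing n v h = 0" by (rule zero)
  then have "(\<Sum>i=1..n. c i * cnj (c i)) + a * cnj a + b * cnj b = 0"
    by (simp add: cab h_def pairing_def)
  then have "complex_of_real ((\<Sum>i=1..n. (cmod (c i))\<^sup>2) + (cmod a)\<^sup>2 + (cmod b)\<^sup>2) = 0"
    by (simp only: of_real_add of_real_sum complex_norm_square)
  then have sum0: "(\<Sum>i=1..n. (cmod (c i))\<^sup>2) + (cmod a)\<^sup>2 + (cmod b)\<^sup>2 = 0"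
    by (simp only: of_real_eq_0_iff)
  have nonneg: "(\<Sum>i=1..n. (cmod (c i))\<^sup>2) \<ge> 0" by (rule sum_nonneg) simp
  have "(cmod a)\<^sup>2 = 0" "(cmod b)\<^sup>2 = 0" "(\<Sum>i=1..n. (cmod (c i))\<^sup>2) = 0"
    using sum0 nonneg zero_le_power2[of "cmod a"] zero_le_power2[of "cmod b"] by linarith+
  then have "a = 0" "b = 0" and c: "\<forall>i\<in>{1..n}. c i = 0" by (simp_all add: sum_nonneg_eq_0_iff)
  moreover have "c i = 0" for i
    using c v by (cases "i \<in> {1..n}") (auto simp: hdual_def cab)
  ultimately show ?thesis by (simp add: cab zero_prod_def fun_eq_iff)
qed

lemma weight_eq_iff_pairing:
  assumes "v \<in> hdual n" "w \<in> hdual n"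
  shows "(\<forall>h\<in>hdual n. pairing n v h = pairing n w h) \<longleftrightarrow> v = w"
proof
  assume "\<forall>h\<in>hdual n. pairing n v h = pairing n w h"
  then have "v - w = 0"
    using assms by (intro pairing_nondegenerate[of _ n]) (auto simp: hdual_diff pairing_diff_left)
  then show "v = w" by simp
qed simp

interpretation pm: vector_space pm_scale
  by (rule vector_space_pm_scale)

lemma lookup_sum_pm: "Poly_Mapping.lookup (sum f A) b = (\<Sum>x\<in>A. Poly_Mapping.lookup (f x) b)"
  by (induction A rule: infinite_finite_induct) (simp_all add: lookup_add)

lemma keys_xi: "Poly_Mapping.keys (xi d) = {d}"
  by (simp add: xi_def)

lemma span_xi: "pm.span (xi ` D) = {v. Poly_Mapping.keys v \<subseteq> D}"
proof (intro equalityI subsetI)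
  fix v assume "v \<in> pm.span (xi ` D)"
  then show "v \<in> {v. Poly_Mapping.keys v \<subseteq> D}"
  proof (induction rule: pm.span_induct_alt)
    case base
    show ?case by simp
  next
    case (step c x y)
    then obtain d where d: "x = xi d" "d \<in> D" by blast
    have "Poly_Mapping.keys (pm_scale c x + y) \<subseteq> insert d (Poly_Mapping.keys y)"
      by (auto simp: in_keys_iff lookup_add lookup_pm_scale d xi_def lookup_single when_def split: if_splits)
    then show ?case using step d by auto
  qed
next
  fix v :: "pattern \<Rightarrow>\<^sub>0 complex" assume v: "v \<in> {v. Poly_Mapping.keys v \<subseteq> D}"
  have "v = (\<Sum>d\<in>Poly_Mapping.keys v. pm_scale (Poly_Mapping.lookup v d) (xi d))"
    by (rule poly_mapping_eqI)
      (auto simp: lookup_sum_pm lookup_pm_scale xi_def lookup_single when_def in_keys_iff if_distrib cong: if_cong)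
  also have "\<dots> \<in> pm.span (xi ` D)"
    using v by (intro pm.span_sum pm.span_scale pm.span_base) auto
  finally show "v \<in> pm.span (xi ` D)" .
qed

lemma independent_xi: "pm.independent (xi ` D)"
proof
  assume "pm.dependent (xi ` D)"
  then obtain d where d: "d \<in> D" "xi d \<in> pm.span (xi ` D - {xi d})"
    unfolding pm.dependent_def by blast
  have "xi ` D - {xi d} \<subseteq> xi ` (D - {d})" by blast
  then have "xi d \<in> pm.span (xi ` (D - {d}))" using d(2) pm.span_mono by blast
  then show False by (simp add: span_xi keys_xi)
qed

lemma dim_xi: "pm.dim (xi ` D) = card D"
proof -
  have "inj_on xi D" by (rule inj_onI) (metis keys_xi singleton_inject)
  then show ?thesis by (simp add: pm.dim_eq_card_independent[OF independent_xi] card_image)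
qed

text \<open>
  The Cartan subalgebra acts diagonally in the basis \<open>\<xi>\<^sub>d\<close>, so a weight vector is supported on patterns with
  the given eigenvalues, and the form separates weights.
\<close>

lemma weight_space_L:
  assumes n: "n \<ge> 2" and \<Lambda>: "\<Lambda> \<in> hdual n" and \<nu>: "\<nu> \<in> hdual n"
  shows "weight_space n (L_space n \<Lambda>) (\<lambda>h. L_act n \<Lambda> u (h, 0)) \<nu> =
    pm.span (xi ` {d \<in> permitted n \<Lambda>. \<Lambda> - pattern_depth n d = \<nu>})"
proof (intro Set.set_eqI)
  fix v
  have act: "Poly_Mapping.lookup (L_act n \<Lambda> u (h, 0) v) d =
      pairing n (\<Lambda> - pattern_depth n d) h * Poly_Mapping.lookup v d" for h d
    by (auto simp: L_act_def Poly_Mapping.lookup_mapp when_def in_keys_iff)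
  have in_h: "\<Lambda> - pattern_depth n d \<in> hdual n" for d
    by (rule hdual_diff[OF \<Lambda> pattern_depth_in_hdual[OF n]])
  have "(\<forall>h\<in>hdual n. L_act n \<Lambda> u (h, 0) v = pm_scale (pairing n \<nu> h) v) \<longleftrightarrow>
      (\<forall>d\<in>Poly_Mapping.keys v. \<forall>h\<in>hdual n. pairing n (\<Lambda> - pattern_depth n d) h = pairing n \<nu> h)"
    unfolding poly_mapping_eq_iff fun_eq_iff act lookup_pm_scale by (auto simp: in_keys_iff)
  also have "\<dots> \<longleftrightarrow> (\<forall>d\<in>Poly_Mapping.keys v. \<Lambda> - pattern_depth n d = \<nu>)"
    unfolding weight_eq_iff_pairing[OF in_h \<nu>] ..
  finally show "v \<in> weight_space n (L_space n \<Lambda>) (\<lambda>h. L_act n \<Lambda> u (h, 0)) \<nu> \<longleftrightarrow>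
      v \<in> pm.span (xi ` {d \<in> permitted n \<Lambda>. \<Lambda> - pattern_depth n d = \<nu>})"
    unfolding weight_space_def L_space_def span_xi by auto
qed

lemma fsum_patterns:
  "fsum (\<lambda>d. fexp (- pattern_depth n d)) D = gen_fun D (\<lambda>d. - pattern_depth n d) (\<lambda>_. 1)"
  using fsum_eq_gen_fun[of D "\<lambda>_. 1" "\<lambda>d. - pattern_depth n d"] by simp

lemma P_char_apply: "P_char n \<Lambda> \<nu> = int (card {d \<in> permitted n \<Lambda>. \<Lambda> - pattern_depth n d = \<nu>})"
proof -
  have "- pattern_depth n d = \<nu> - \<Lambda> \<longleftrightarrow> \<Lambda> - pattern_depth n d = \<nu>" for d
    by (auto simp: algebra_simps)
  then show ?thesis by (simp add: P_char_def fexp_fmult fsum_patterns gen_fun_def)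
qed

lemma char_L_eq_P_char:
  assumes n: "n \<ge> 2" and \<Lambda>: "\<Lambda> \<in> hdual n"
  shows "char_L n \<Lambda> u = P_char n \<Lambda>"
proof
  fix \<nu>
  show "char_L n \<Lambda> u \<nu> = P_char n \<Lambda> \<nu>"
  proof (cases "\<nu> \<in> hdual n")
    case True
    then show ?thesis
      by (simp add: char_L_def char_of_def weight_space_L[OF n \<Lambda> True] dim_xi P_char_apply)
  next
    case False
    then have none: "{d \<in> permitted n \<Lambda>. \<Lambda> - pattern_depth n d = \<nu>} = {}"
      using hdual_diff[OF \<Lambda> pattern_depth_in_hdual[OF n]] by auto
    show ?thesis unfolding P_char_apply none using False by (simp add: char_L_def char_of_def)
  qed
qed

lemma (in dominant_weight) weyl_character:
  "P_char n \<Lambda> = char_M0 n \<star> weyl_sum n \<Lambda>"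
proof
  fix \<nu>
  let ?D = "{d. gt_pattern n d}" and ?W = "int_weyl n \<Lambda>"
  let ?\<phi> = "\<lambda>d. - pattern_depth n d" and ?\<psi> = "\<lambda>w. w (\<Lambda> + rho n) - rho n"
  have weyl: "weyl_sum n \<Lambda> = gen_fun ?W ?\<psi> weyl_sign"
    unfolding weyl_sum_def weyl_sign_def by (rule fsum_eq_gen_fun) simp
  have configs_eq: "{p \<in> ?D \<times> ?W. ?\<phi> (fst p) + ?\<psi> (snd p) = \<mu>} = configs (\<mu> + rho n)" for \<mu>
  proof -
    have "- x + (z - rho n) = \<mu> \<longleftrightarrow> z - x = \<mu> + rho n" for x z :: weight
      by (auto simp: algebra_simps)
    then show ?thesis by (auto simp: configs_def v0_def)
  qed
  have "char_M0 n \<star> weyl_sum n \<Lambda> =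
      gen_fun (?D \<times> ?W) (\<lambda>p. ?\<phi> (fst p) + ?\<psi> (snd p)) (\<lambda>p. 1 * weyl_sign (snd p))"
    unfolding char_M0_patterns[OF n] weyl by (rule gen_fun_mult) (simp only: configs_eq finite_configs)
  then have "(char_M0 n \<star> weyl_sum n \<Lambda>) \<nu> = (\<Sum>(d, w)\<in>configs (\<nu> + rho n). weyl_sign w)"
    unfolding gen_fun_def configs_eq[symmetric] by (simp add: case_prod_beta')
  also have "\<dots> = int (card {d \<in> permitted n \<Lambda>. v0 - pattern_depth n d = \<nu> + rho n})"
    by (rule signed_count)
  also have "{d \<in> permitted n \<Lambda>. v0 - pattern_depth n d = \<nu> + rho n} =
      {d \<in> permitted n \<Lambda>. \<Lambda> - pattern_depth n d = \<nu>}"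
  proof -
    have "\<Lambda> + rho n - x = \<nu> + rho n \<longleftrightarrow> \<Lambda> - x = \<nu>" for x
      unfolding diff_add_eq[symmetric] by (rule add_right_cancel)
    then show ?thesis by (simp add: v0_def)
  qed
  finally show "P_char n \<Lambda> \<nu> = (char_M0 n \<star> weyl_sum n \<Lambda>) \<nu>" by (simp add: P_char_apply)
qed

theorem theorem3p23:
  fixes n :: nat and \<Lambda> :: weight and u :: complex
  assumes "n \<ge> 3"
    and "dominant n \<Lambda>"
    and "Re (kappa n \<Lambda>) > 0"
    and "kappa n \<Lambda> \<noteq> of_nat n"
  shows "P_char n \<Lambda> = char_L n \<Lambda> u \<and>
    char_L n \<Lambda> u = char_M0 n \<star> weyl_sum n \<Lambda>"
proof -
  have n: "n \<ge> 2" using assms(1) by simp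
  interpret dominant_weight n \<Lambda> by unfold_locales (rule n assms(2,3))+
  have "\<Lambda> \<in> hdual n" using assms(2) by (simp add: dominant_def)
  from char_L_eq_P_char[OF n this] weyl_character show ?thesis by simp
qed

end
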